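(* Let the power $P>0$ and the integers $M\ge 2$, $1\le K\le M$ be fixed, and let the number of users $N\to\infty$ in the MIMO broadcast channel described in the context. For every user selection strategy $S$, if $\lim_{N\to\infty}(\mathcal{R}_{\mathrm{Opt}}-\mathcal{R}_S)=0$, then $$\mathbb{E}\{\mathcal{N}_S\}=\ln\ln\ln N+\omega(1),$$ i.e. $\mathbb{E}\{\mathcal{N}_S\}-\ln\ln\ln N\to\infty$ as $N\to\infty$.
   Context: Model (MIMO broadcast channel). A base station (BS) with $M$ antennas transmits to $N$ users, each with $K\le M$ antennas. User $k$ receives $\mathbf{y}_k=\mathbf{H}_k\mathbf{x}+\mathbf{n}_k$, where $\mathbf{x}\in\mathbb{C}^{M}$ satisfies $\mathbb{E}\{\mathrm{Tr}(\mathbf{x}\mathbf{x}^H)\}\le P$, $\mathbf{n}_k\sim\mathcal{CN}(\mathbf{0},\mathbf{I}_K)$, and the matrices $\mathbf{H}_k\in\mathbb{C}^{K\times M}$ are independent with i.i.d. $\mathcal{CN}(0,1)$ entries. Fading is block fading with frames long enough for communication at rates close to capacity. User $k$ knows $\mathbf{H}_k$ perfectly; the BS knows about the channels only what the users feed back. Rates are in nats and are averaged over the channel realizations. The maximum sum-rate (perfect channel knowledge at the BS) is $\mathcal{R}_{\mathrm{Opt}}=\mathbb{E}\big\{\max\ln|\mathbf{I}_M+\sum_{n=1}^N\mathbf{H}_n^H\mathbf{Q}_n\mathbf{H}_n|\big\}$, the maximum being over positive semidefinite $K\times K$ matrices $\mathbf{Q}_n$ with $\sum_n\mathrm{Tr}(\mathbf{Q}_n)=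 P$. A user selection strategy $S$ (specified for each $N$) consists of: a rule, the same for all users, by which each user decides from its own channel whether to send information to the BS (so each user sends with the same probability $p_S$, independently of the others) and what to send; and a rule by which the BS chooses the users to serve and the transmitted signal as a function of the received feedback only. $\mathcal{N}_S$ is the number of users who send information to the BS (so $\mathcal{N}_S$ is Binomial$(N,p_S)$), and $\mathcal{R}_S$ is the average sum-rate achieved by $S$. *)

theory Defs
  imports "HOL-Probability.Probability"
begin

section \<open>Complex Gaussian channel and noise\<close>

text \<open>Density of \<open>CN(0,1)\<close> with respect to Lebesgue measure on the complex plane: real and
  imaginary part are independent with variance 1/2 each.\<close>
definition cn_density :: "complex \<Rightarrow> real" where
  "cn_density z = exp (- (cmod z)\<^sup>2) / pi"

definition noise_law :: "(complex ^ 'k::finite) measure" where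
  "noise_law = density lborel (\<lambda>z. ennreal (\<Prod>i\<in>UNIV. cn_density (z $ i)))"

text \<open>In \<^typ>\<open>complex ^ 'm ^ 'k\<close> the row index \<^typ>\<open>'k\<close> ranges over the antennas of a user
  and the column index \<^typ>\<open>'m\<close> over those of the base station.\<close>
definition channel_law :: "(complex ^ 'm::finite ^ 'k::finite) measure" where
  "channel_law = density lborel (\<lambda>h. ennreal (\<Prod>i\<in>UNIV. \<Prod>j\<in>UNIV. cn_density (h $ i $ j)))"

definition channels_law :: "nat \<Rightarrow> (nat \<Rightarrow> complex ^ 'm::finite ^ 'k::finite) measure" where
  "channels_law N = PiM {..<N} (\<lambda>_. channel_law)"

section \<open>Maximum sum-rate\<close>

definition herm :: "complex ^ 'm ^ 'k \<Rightarrow> complex ^ 'k ^ 'm" where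
  "herm A = (\<chi> i j. cnj (A $ j $ i))"

definition psd :: "complex ^ 'k ^ 'k::finite \<Rightarrow> bool" where
  "psd A \<longleftrightarrow> herm A = A \<and> (\<forall>x. 0 \<le> Re (\<Sum>i\<in>UNIV. cnj (x $ i) * (A *v x) $ i))"

text \<open>For \<open>N > 0\<close> the admissible \<open>Q\<close> form a nonempty compact set (up to the irrelevant values
  \<open>Q n\<close> with \<open>n \<ge> N\<close>), so the supremum is a maximum; the determinant is real and at least 1.\<close>
definition opt_sum_rate :: "real \<Rightarrow> nat \<Rightarrow> (nat \<Rightarrow> complex ^ 'm::finite ^ 'k::finite) \<Rightarrow> real" where
  "opt_sum_rate P N H =
     Sup {ln (Re (det (mat 1 + (\<Sum>n<N. herm (H n) ** Q n ** H n)))) | Q.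
            (\<forall>n<N. psd (Q n)) \<and> (\<Sum>n<N. trace (Q n)) = complex_of_real P}"

definition R_opt :: "'m::finite itself \<Rightarrow> 'k::finite itself \<Rightarrow> real \<Rightarrow> nat \<Rightarrow> real" where
  "R_opt _ _ P N = (\<integral>H. opt_sum_rate P N (H :: nat \<Rightarrow> complex ^ 'm ^ 'k) \<partial>channels_law N)"

section \<open>User selection strategies\<close>

text \<open>What the base station does in a frame: it serves the users in \<open>served\<close>, the message
  \<open>message k\<close> being intended for user \<open>k\<close>, and sends \<open>signal \<omega> t\<close> at the times \<open>t < duration\<close>.
  Messages and signal are random variables on the probability space \<open>source\<close>. Nothing is assumed
  about the distribution of the signal or about how it depends on the messages, so arbitrary
  coding (linear or not, dirty-paper coding included) is covered.\<close>
record ('m, 'w, 'o) transmission =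
  served :: "nat set"
  duration :: nat
  source :: "'o measure"
  msg_space :: "'w measure"
  message :: "nat \<Rightarrow> 'o \<Rightarrow> 'w"
  signal :: "'o \<Rightarrow> nat \<Rightarrow> complex ^ 'm"

text \<open>The power constraint \<open>E{Tr(x x\<^sup>H)} \<le> P\<close>, averaged over the duration of the transmission;
  \<open>Tr(x x\<^sup>H)\<close> is the squared Euclidean norm of \<open>x\<close>.\<close>
definition valid_transmission ::
    "real \<Rightarrow> nat \<Rightarrow> ('m::finite, 'w, 'o) transmission \<Rightarrow> bool" where
  "valid_transmission P N a \<longleftrightarrow>
     served a \<subseteq> {..<N} \<and> 0 < duration a \<and>
     prob_space (source a) \<and>
     prob_space.indep_vars (source a) (\<lambda>_. msg_space a) (message a) (served a) \<and>
     signal a \<in> source a \<rightarrow>\<^sub>M PiM {..<duration a} (\<lambda>_. borel) \<and>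
     integrable (source a) (\<lambda>\<omega>. \<Sum>t<duration a. (norm (signal a \<omega> t))\<^sup>2) \<and>
     (\<integral>\<omega>. (\<Sum>t<duration a. (norm (signal a \<omega> t))\<^sup>2) \<partial>source a) \<le> real (duration a) * P"

definition received ::
    "complex ^ 'm::finite ^ 'k::finite \<Rightarrow> nat \<Rightarrow> (nat \<Rightarrow> complex ^ 'm) \<Rightarrow> (nat \<Rightarrow> complex ^ 'k)
      \<Rightarrow> (nat \<Rightarrow> complex ^ 'k)" where
  "received h T x z = (\<lambda>t\<in>{..<T}. h *v x t + z t)"

text \<open>Rate, in nats per channel use, of user \<open>k\<close> with channel \<open>h\<close>: the mutual information between
  the message for \<open>k\<close> and the signal received by \<open>k\<close>. Noise and source are independent. The signals
  meant for other users act as interference through \<open>signal\<close>.\<close>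
definition user_rate ::
    "('m::finite, 'w, 'o) transmission \<Rightarrow> nat \<Rightarrow> complex ^ 'm ^ 'k::finite \<Rightarrow> real" where
  "user_rate a k h =
     prob_space.mutual_information
       (source a \<Otimes>\<^sub>M PiM {..<duration a} (\<lambda>_. noise_law)) (exp 1)
       (msg_space a) (PiM {..<duration a} (\<lambda>_. borel))
       (\<lambda>(\<omega>, z). message a k \<omega>)
       (\<lambda>(\<omega>, z). received h (duration a) (signal a \<omega>) z)
     / real (duration a)"

text \<open>A strategy for a given number of users. \<^term>\<open>None\<close> means that the user sends nothing.\<close>
record ('m, 'k, 'f, 'w, 'o) strategy =
  user_rule :: "complex ^ 'm ^ 'k \<Rightarrow> 'f option"
  bs_rule :: "(nat \<Rightarrow> 'f option) \<Rightarrow> ('m, 'w, 'o) transmission"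

definition feedback ::
    "('m::finite, 'k::finite, 'f, 'w, 'o) strategy \<Rightarrow> nat \<Rightarrow> (nat \<Rightarrow> complex ^ 'm ^ 'k)
      \<Rightarrow> nat \<Rightarrow> 'f option" where
  "feedback S N H = (\<lambda>k. if k < N then user_rule S (H k) else None)"

definition sum_rate ::
    "('m::finite, 'k::finite, 'f, 'w, 'o) strategy \<Rightarrow> nat \<Rightarrow> (nat \<Rightarrow> complex ^ 'm ^ 'k) \<Rightarrow> real" where
  "sum_rate S N H =
     (let a = bs_rule S (feedback S N H) in \<Sum>k\<in>served a. user_rate a k (H k))"

text \<open>The two measurability conditions only ensure that the probability of sending and the average
  of the sum-rate make sense.\<close>
definition user_selection_strategy ::
    "real \<Rightarrow> nat \<Rightarrow> ('m::finite, 'k::finite, 'f, 'w, 'o) strategy \<Rightarrow> bool" where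
  "user_selection_strategy P N S \<longleftrightarrow>
     {h. user_rule S h \<noteq> None} \<in> sets borel \<and>
     (\<forall>f. valid_transmission P N (bs_rule S f)) \<and>
     sum_rate S N \<in> borel_measurable (channels_law N)"

definition avg_sum_rate ::
    "('m::finite, 'k::finite, 'f, 'w, 'o) strategy \<Rightarrow> nat \<Rightarrow> real" where
  "avg_sum_rate S N = (\<integral>H. sum_rate S N H \<partial>channels_law N)"

definition num_senders ::
    "('m::finite, 'k::finite, 'f, 'w, 'o) strategy \<Rightarrow> nat \<Rightarrow> (nat \<Rightarrow> complex ^ 'm ^ 'k) \<Rightarrow> nat" where
  "num_senders S N H = card {k. k < N \<and> feedback S N H k \<noteq> None}"

definition expected_senders ::
    "('m::finite, 'k::finite, 'f, 'w, 'o) strategy \<Rightarrow> nat \<Rightarrow> real" where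
  "expected_senders S N = (\<integral>H. real (num_senders S N H) \<partial>channels_law N)"

end

theory Submission
  imports Defs "HOL-Real_Asymp.Real_Asymp"
begin

text \<open>
  Two bounds determine the cost of silence. If \<open>\<rho>\<close> exceeds the norms of all channels \<open>H\<^sub>k\<close>, then every
  received signal is a degraded version of the single \<open>M\<close>-dimensional signal \<open>\<rho> x + n\<close>, so that
  independent messages have total rate at most \<open>M ln (1 + \<rho>\<^sup>2 P / M)\<close>. Since the largest of the \<open>N\<close>
  squared channel norms is about \<open>ln N\<close>, no strategy gains more than \<open>o(1)\<close> over
  \<open>U = M ln (P ln N / M)\<close>, and \<open>M\<close> users with nearly orthogonal channels of squared norm about \<open>ln N\<close>
  show that the maximum sum-rate is at least \<open>U - o(1)\<close>. When no user sends anything, the served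
  users are statistically identical, so each of them may be given one and the same channel, and the
  first bound limits the expected sum-rate to a constant. Hence a strategy loses about
  \<open>(1 - p)\<^sup>N U\<close>, where \<open>p\<close> is the probability of sending; if \<open>N p \<le> ln ln ln N + O(1)\<close>, then
  \<open>(1 - p)\<^sup>N\<close> is at least a constant times \<open>1 / ln ln N\<close> and the loss does not vanish.
\<close>

section \<open>Gaussian densities on Euclidean spaces\<close>

text \<open>Nothing is known about how the signal encodes the messages, so there is no input density
  to work with. The argument uses only the conditional densities of received blocks given the source
  point, which are Gaussian, and the likelihood ratios between the joint law and the product law of
  message and output; all users are compared at once with one Gaussian reference law for the
  enhanced signal. Mutual information is a total function here: it is 0 when there is no
  Radon-Nikodym density or when the logarithm is not integrable. Users of rate 0 are therefore
  discarded first, and for the others a nonzero value certifies both regularity conditions. The law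
  of the largest channel norm is never computed: the excesses of the squared norms over a level t
  are added up, and their mean is controlled by an exponential moment with parameter \<theta> < 1.
  The level t = ln N / \<theta> compensates the factor N and costs about M ln (1/\<theta>) in rate.
  Dually, good channels are sought at squared length \<beta> ln N with \<beta> < 1, slightly below
  the typical maximum, where they exist with probability close to 1.\<close>

definition gauss :: "real \<Rightarrow> 'a::euclidean_space \<Rightarrow> real" where
  "gauss v x = exp (- (norm x)\<^sup>2 / v) / sqrt (pi * v) ^ DIM('a)"

lemma gauss_pos: "v > 0 \<Longrightarrow> gauss v x > 0"
  by (simp add: gauss_def)

lemma borel_measurable_gauss [measurable]: "gauss v \<in> borel_measurable borel"
  unfolding gauss_def by measurable

text \<open>The variance is v/2 in each real direction, so on complex vectors \<open>gauss 1\<close>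
  is the CN(0, I) density and \<open>gauss v\<close> that of CN(0, v I).\<close>

lemma gauss_eq_prod:
  assumes "v > 0"
  shows "gauss v (x::'a::euclidean_space) = (\<Prod>b\<in>Basis. normal_density 0 (sqrt (v / 2)) (x \<bullet> b))"
proof -
  have "(norm x)\<^sup>2 = (\<Sum>b\<in>Basis. (x \<bullet> b)\<^sup>2)"
    by (subst euclidean_inner[of x x, folded power2_norm_eq_inner]) (simp add: power2_eq_square)
  then have "- (norm x)\<^sup>2 / v = (\<Sum>b\<in>Basis. - (x \<bullet> b)\<^sup>2 / v)"
    by (simp add: sum_negf sum_divide_distrib)
  then show ?thesis
    using assms by (simp add: gauss_def normal_density_def exp_sum prod_dividef power_one_over divide_simps)
qed

lemma nn_integral_gauss:
  assumes "v > 0"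
  shows "(\<integral>\<^sup>+x. ennreal (gauss v (x::'a::euclidean_space)) \<partial>lborel) = 1"
proof -
  have "(\<integral>\<^sup>+x. ennreal (gauss v (x::'a)) \<partial>lborel)
    = (\<integral>\<^sup>+x. (\<Prod>b\<in>Basis. ennreal (normal_density 0 (sqrt (v / 2)) ((x::'a) \<bullet> b))) \<partial>lborel)"
    using assms by (simp add: gauss_eq_prod prod_ennreal)
  also have "\<dots> = (\<Prod>b\<in>(Basis::'a set). \<integral>\<^sup>+x. ennreal (normal_density 0 (sqrt (v / 2)) x) \<partial>lborel)"
    using assms by (intro nn_integral_lborel_prod) auto
  also have "(\<integral>\<^sup>+x. ennreal (normal_density 0 (sqrt (v / 2)) x) \<partial>lborel) = 1"
    using assms prob_space.emeasure_space_1[OF prob_space_normal_density[of "sqrt (v/2)" 0]]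
    by (simp add: emeasure_density)
  finally show ?thesis by simp
qed

lemma nn_integral_lborel_shift:
  fixes c :: "'a::euclidean_space"
  assumes [measurable]: "f \<in> borel_measurable borel"
  shows "(\<integral>\<^sup>+x. f (c + x) \<partial>lborel) = (\<integral>\<^sup>+x. f x \<partial>lborel)"
proof -
  have "(\<integral>\<^sup>+x. f x \<partial>lborel) = (\<integral>\<^sup>+x. f x \<partial>distr lborel borel ((+) c))"
    by (simp add: lborel_distr_plus)
  then show ?thesis
    by (simp add: nn_integral_distr)
qed

lemma nn_integral_gauss_shift:
  assumes "v > 0"
  shows "(\<integral>\<^sup>+x. ennreal (gauss v (x - c)) \<partial>lborel) = 1"
  using nn_integral_lborel_shift[of "\<lambda>x. ennreal (gauss v x)" "- c"] nn_integral_gauss[OF assms]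
  by simp

lemma prod_cn_density: "(\<Prod>i\<in>UNIV. cn_density (z $ i)) = gauss 1 (z :: complex ^ 'k::finite)"
proof -
  have "(\<Prod>i\<in>UNIV. cn_density (z $ i)) = exp (\<Sum>i\<in>UNIV. - (cmod (z $ i))\<^sup>2) / pi ^ CARD('k)"
    by (simp add: cn_density_def exp_sum prod_dividef)
  also have "(\<Sum>i\<in>UNIV. - (cmod (z $ i))\<^sup>2) = - (norm z)\<^sup>2"
    by (subst norm_vec_def) (simp add: L2_set_def sum_nonneg sum_negf)
  also have "pi ^ CARD('k) = sqrt pi ^ DIM(complex ^ 'k)"
    by (simp add: mult.commute[of _ 2] power_mult)
  finally show ?thesis by (simp add: gauss_def)
qed

lemma noise_law_eq: "(noise_law :: (complex ^ 'k::finite) measure) = density lborel (gauss 1)"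
  by (simp add: noise_law_def prod_cn_density)

lemma channel_law_eq:
  "(channel_law :: (complex ^ 'm::finite ^ 'k::finite) measure) = density lborel (gauss 1)"
proof -
  have "(\<Prod>i\<in>UNIV. \<Prod>j\<in>UNIV. cn_density (h $ i $ j)) = gauss 1 h" for h :: "complex ^ 'm ^ 'k"
  proof -
    have "(\<Prod>i\<in>UNIV. \<Prod>j\<in>UNIV. cn_density (h $ i $ j)) = (\<Prod>i\<in>UNIV. gauss 1 (h $ i))"
      by (simp add: prod_cn_density)
    also have "\<dots> = exp (\<Sum>i\<in>UNIV. - (norm (h $ i))\<^sup>2) / (sqrt pi ^ DIM(complex ^ 'm)) ^ CARD('k)"
      by (simp add: gauss_def exp_sum prod_dividef)
    also have "(\<Sum>i\<in>UNIV. - (norm (h $ i))\<^sup>2) = - (norm h)\<^sup>2"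
      by (subst (2) norm_vec_def) (simp add: L2_set_def sum_nonneg sum_negf)
    also have "(sqrt pi ^ DIM(complex ^ 'm)) ^ CARD('k) = sqrt pi ^ DIM(complex ^ 'm ^ 'k)"
      by (simp add: power_mult[symmetric] mult.commute)
    finally show ?thesis by (simp add: gauss_def)
  qed
  then show ?thesis
    by (simp add: channel_law_def)
qed

lemma prob_space_density_gauss: "v > 0 \<Longrightarrow> prob_space (density lborel (\<lambda>x. gauss v (x - c)))"
  by (rule prob_spaceI) (simp add: emeasure_density nn_integral_gauss_shift)

lemma prob_space_gauss: "v > 0 \<Longrightarrow> prob_space (density lborel (gauss v))"
  using prob_space_density_gauss[of v 0] by simp

lemma integrable_gauss: "v > 0 \<Longrightarrow> integrable lborel (gauss v :: 'a::euclidean_space \<Rightarrow> real)"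
  using nn_integral_gauss[of v, where 'a='a]
  by (intro integrableI_nonneg) (auto simp: less_imp_le gauss_pos)

lemma integral_gauss: "v > 0 \<Longrightarrow> (\<integral>x. gauss v (x::'a::euclidean_space) \<partial>lborel) = 1"
  using nn_integral_gauss[of v, where 'a='a]
  by (subst integral_eq_nn_integral) (auto simp: less_imp_le gauss_pos)

lemma integral_exp_norm_sq:
  assumes "a > 0"
  shows "integrable lborel (\<lambda>x::'a::euclidean_space. exp (- a * (norm x)\<^sup>2))"
    and "(\<integral>x. exp (- a * (norm (x::'a))\<^sup>2) \<partial>lborel) = sqrt (pi / a) ^ DIM('a)"
proof -
  have eq: "exp (- a * (norm x)\<^sup>2) = sqrt (pi / a) ^ DIM('a) * gauss (1 / a) x" for x :: 'a
    using assms by (simp add: gauss_def mult.commute)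
  show "integrable lborel (\<lambda>x::'a::euclidean_space. exp (- a * (norm x)\<^sup>2))"
    unfolding eq using assms by (intro integrable_mult_right integrable_gauss) auto
  show "(\<integral>x. exp (- a * (norm (x::'a))\<^sup>2) \<partial>lborel) = sqrt (pi / a) ^ DIM('a)"
    unfolding eq using assms by (simp add: integral_gauss)
qed

lemma integrable_norm_sq_gauss:
  "integrable lborel (\<lambda>x::'a::euclidean_space. (norm x)\<^sup>2 * gauss 1 x)"
proof (rule Bochner_Integration.integrable_bound)
  show "integrable lborel (\<lambda>x::'a. 2 / sqrt pi ^ DIM('a) * exp (- (1/2) * (norm x)\<^sup>2))"
    by (intro integrable_mult_right integral_exp_norm_sq) auto
  \<comment> \<open>Half of the exponent absorbs the polynomial factor.\<close>
  have "s * exp (- s) \<le> 2 * exp (- (1/2) * s)" if "s \<ge> 0" for s :: real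
  proof -
    have "s * exp (- s) = 2 * ((s / 2) * exp (- (s/2))) * exp (- (s/2))"
      by (simp add: exp_add[symmetric])
    also have "(s / 2) * exp (- (s/2)) \<le> exp (s/2) * exp (- (s/2))"
      using exp_ge_add_one_self[of "s/2"] that by (intro mult_right_mono, linarith) simp
    finally show ?thesis by (simp add: exp_add[symmetric])
  qed
  from this[of "(norm x)\<^sup>2" for x :: 'a]
  show "AE x in lborel. norm ((norm x)\<^sup>2 * gauss 1 x) \<le> norm (2 / sqrt pi ^ DIM('a) * exp (- (1/2) * (norm (x::'a))\<^sup>2))"
    by (intro AE_I2) (simp add: gauss_def divide_right_mono)
qed measurable

text \<open>The Gaussian integral \<open>(pi/a)\<^bsup>d/2\<^esup>\<close>, as a function of \<open>a\<close>, lies above its tangent line at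
  \<open>a = 1\<close>, whose slope is minus the second moment.\<close>
lemma integral_norm_sq_gauss:
  "(\<integral>x. (norm x)\<^sup>2 * gauss 1 (x::'a::euclidean_space) \<partial>lborel) = DIM('a) / 2"
proof -
  define m where "m = (\<integral>x. (norm x)\<^sup>2 * gauss 1 (x::'a) \<partial>lborel)"
  define F where "F a = sqrt (1 / a) ^ DIM('a) - 1 + (a - 1) * m" for a :: real
  have F: "F a \<ge> 0" if "a > 0" for a
  proof -
    have "1 - (a - 1) * m = (\<integral>x. gauss 1 (x::'a) - (a - 1) * ((norm x)\<^sup>2 * gauss 1 x) \<partial>lborel)"
      unfolding m_def
      by (subst Bochner_Integration.integral_diff)
        (auto intro!: integrable_gauss integrable_norm_sq_gauss integrable_mult_right simp: integral_gauss)
    also have "\<dots> \<le> (\<integral>x. 1 / sqrt pi ^ DIM('a) * exp (- a * (norm (x::'a))\<^sup>2) \<partial>lborel)"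
    proof (rule integral_mono)
      show "gauss 1 x - (a - 1) * ((norm x)\<^sup>2 * gauss 1 x) \<le> 1 / sqrt pi ^ DIM('a) * exp (- a * (norm x)\<^sup>2)" for x :: 'a
      proof -
        have "exp (- (norm x)\<^sup>2) * (1 + - (a - 1) * (norm x)\<^sup>2)
            \<le> exp (- (norm x)\<^sup>2) * exp (- (a - 1) * (norm x)\<^sup>2)"
          by (intro mult_left_mono exp_ge_add_one_self) simp
        also have "\<dots> = exp (- a * (norm x)\<^sup>2)"
          by (simp add: exp_add[symmetric] algebra_simps)
        finally have "exp (- a * (norm x)\<^sup>2) \<ge> exp (- (norm x)\<^sup>2) * (1 - (a - 1) * (norm x)\<^sup>2)"
          by (simp add: algebra_simps)
        then have "exp (- a * (norm x)\<^sup>2) / sqrt pi ^ DIM('a) \<ge> exp (- (norm x)\<^sup>2) * (1 - (a - 1) * (norm x)\<^sup>2) / sqrt pi ^ DIM('a)"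
          by (rule divide_right_mono) simp
        then show ?thesis by (simp add: gauss_def algebra_simps diff_divide_distrib add_divide_distrib)
      qed
    qed (auto intro!: Bochner_Integration.integrable_diff integrable_gauss integrable_norm_sq_gauss integrable_mult_right
        integrable_divide integral_exp_norm_sq(1)[of a, simplified] that)
    also have "\<dots> = sqrt (1 / a) ^ DIM('a)"
      using that integral_exp_norm_sq(2)[of a, where 'a='a] by (simp add: real_sqrt_divide power_divide)
    finally show ?thesis by (simp add: F_def)
  qed
  have der: "(F has_real_derivative m - DIM('a) / 2) (at 1)"
    unfolding F_def[abs_def] by (auto intro!: derivative_eq_intros)
  have "m - DIM('a) / 2 = 0"
  proof (rule DERIV_local_min[OF der])
    show "\<forall>y. \<bar>1 - y\<bar> < 1 \<longrightarrow> F 1 \<le> F y"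
    proof (intro allI impI)
      fix y :: real assume "\<bar>1 - y\<bar> < 1"
      then have "F y \<ge> 0" by (intro F) auto
      then show "F 1 \<le> F y" by (simp add: F_def)
    qed
  qed simp
  then show ?thesis by (simp add: m_def)
qed

section \<open>Degraded Gaussian channels\<close>

text \<open>The kernel is Gaussian with mean \<open>A z\<close> and covariance \<open>I - A A\<^sup>T\<close>, whose inverse is \<open>R\<close> below. Its
  normalising constant is found without determinants, by integrating the identity \<open>key\<close> (completion
  of the square) over both variables.\<close>
lemma gaussian_degradation_kernel:
  fixes A :: "'a::euclidean_space \<Rightarrow> 'b::euclidean_space"
  assumes A: "linear A" and bound: "\<And>x. norm (A x) \<le> c * norm x" and c: "0 \<le> c" "c < 1"
  obtains \<kappa> :: "'a \<Rightarrow> 'b \<Rightarrow> real"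
  where "(\<lambda>(z, y). \<kappa> z y) \<in> borel_measurable borel"
    and "\<And>z y. \<kappa> z y > 0"
    and "\<And>z. (\<integral>\<^sup>+y. \<kappa> z y \<partial>lborel) = 1"
    and "\<And>x y. (\<integral>\<^sup>+z. ennreal (gauss 1 (z - x)) * \<kappa> z y \<partial>lborel) = gauss 1 (y - A x)"
proof -
  define B where "B = adjoint A"
  have B: "linear B" unfolding B_def by (rule adjoint_linear[OF A])
  have AB: "A x \<bullet> y = x \<bullet> B y" for x y
    unfolding B_def by (simp add: adjoint_works[OF A])
  have B_bound: "norm (B y) \<le> c * norm y" for y
  proof -
    have "norm (B y) * norm (B y) = A (B y) \<bullet> y"
      by (simp add: AB power2_eq_square[symmetric] power2_norm_eq_inner)
    also have "\<dots> \<le> norm (A (B y)) * norm y" by (rule norm_cauchy_schwarz)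
    also have "\<dots> \<le> c * norm (B y) * norm y" by (intro mult_right_mono bound) auto
    finally have "norm (B y) * norm (B y) \<le> norm (B y) * (c * norm y)" by (simp add: mult_ac)
    then show ?thesis
      using c by (cases "norm (B y) = 0") (auto simp: mult_le_cancel_left)
  qed
  have B_le: "B v \<bullet> B v \<le> c\<^sup>2 * (v \<bullet> v)" for v
    using power_mono[OF B_bound[of v], of 2] by (simp add: power_mult_distrib power2_norm_eq_inner)
  define S where "S y = y - A (B y)" for y
  have S: "linear S"
    unfolding S_def by (intro linear_compose_sub linear_id[unfolded id_def] linear_compose[OF B A, unfolded o_def])
  have c2: "c\<^sup>2 < 1" using c by (simp add: power_less_one_iff)
  have SS: "S v \<bullet> v = v \<bullet> v - B v \<bullet> B v" for v
    by (simp add: S_def inner_diff_left AB)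
  \<comment> \<open>The form of \<open>S\<close> is at least 1 - c^2 times the squared norm; this is
    where the strict bound c < 1 enters.\<close>
  have "inj S"
  proof (rule injI)
    fix v w assume "S v = S w"
    then have "S (v - w) \<bullet> (v - w) = 0" by (simp add: linear_diff[OF S])
    then have "(v - w) \<bullet> (v - w) \<le> c\<^sup>2 * ((v - w) \<bullet> (v - w))"
      using B_le[of "v - w"] by (simp add: SS)
    then have "(1 - c\<^sup>2) * ((v - w) \<bullet> (v - w)) \<le> 0" by (simp add: algebra_simps)
    then have "(v - w) \<bullet> (v - w) \<le> 0"
      using c2 by (simp add: mult_le_0_iff)
    then show "v = w" using inner_ge_zero[of "v - w"] inner_eq_zero_iff[of "v - w"] by simp
  qed
  then obtain R where R: "linear R" and RS: "\<And>v. R (S v) = v" and SR: "\<And>v. S (R v) = v"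
    using linear_injective_isomorphism[OF S] by metis
  have S_sym: "S v \<bullet> w = v \<bullet> S w" for v w
    by (simp add: S_def inner_diff_left inner_diff_right AB) (metis AB inner_commute)
  have R_sym: "R v \<bullet> w = v \<bullet> R w" for v w
    using S_sym[of "R v" "R w"] by (simp add: SR)
  have R_pos: "v \<bullet> R v \<ge> 0" for v
  proof -
    have "v \<bullet> R v = S (R v) \<bullet> R v" by (simp add: SR)
    also have "\<dots> \<ge> 0"
      using B_le[of "R v"] mult_right_mono[of "c\<^sup>2" 1 "R v \<bullet> R v"] c2 by (simp add: SS)
    finally show ?thesis .
  qed
  have [measurable]: "A \<in> borel_measurable borel" "R \<in> borel_measurable borel"
    using A R by (auto intro!: borel_measurable_continuous_onI linear_continuous_on linear_conv_bounded_linear[THEN iffD1])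
  define E where "E z y = exp (- ((y - A z) \<bullet> R (y - A z)))" for z y
  have E_meas [measurable]: "(\<lambda>(z, y). E z y) \<in> borel_measurable (borel \<Otimes>\<^sub>M borel)"
    unfolding E_def by measurable
  have [measurable]: "E z \<in> borel_measurable borel" for z unfolding E_def by measurable
  have [measurable]: "(\<lambda>z. E z y) \<in> borel_measurable borel" for y unfolding E_def by measurable
  have E_pos: "E z y > 0" for z y by (simp add: E_def)
  \<comment> \<open>If z is standard and y is drawn from the kernel, then y is standard too and z
    has conditional mean \<open>B y\<close>; \<open>q\<close> is the unnormalised conditional
    density of z - \<open>B y\<close>.\<close>
  define q where "q u = exp (- ((norm u)\<^sup>2 + A u \<bullet> R (A u)))" for u :: 'a
  have [measurable]: "q \<in> borel_measurable borel" unfolding q_def by measurable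
  have key: "exp (- (norm z)\<^sup>2) * E z y = exp (- (norm y)\<^sup>2) * q (z - B y)" for z y
  proof -
    define u where "u = z - B y"
    have z: "z = u + B y" by (simp add: u_def)
    have d: "y - A z = S y - A u" by (simp add: z S_def linear_add[OF A])
    have "(y - A z) \<bullet> R (y - A z) = (S y - A u) \<bullet> (y - R (A u))"
      by (simp add: d linear_diff[OF R] RS)
    also have "\<dots> = S y \<bullet> y - S y \<bullet> R (A u) - A u \<bullet> y + A u \<bullet> R (A u)"
      by (simp add: inner_diff_left inner_diff_right)
    also have "S y \<bullet> R (A u) = y \<bullet> A u"
      by (simp add: R_sym[symmetric] RS)
    also have "S y \<bullet> y = (norm y)\<^sup>2 - (norm (B y))\<^sup>2"
      by (simp add: SS power2_norm_eq_inner)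
    finally have 1: "(y - A z) \<bullet> R (y - A z) = (norm y)\<^sup>2 - (norm (B y))\<^sup>2 - 2 * (A u \<bullet> y) + A u \<bullet> R (A u)"
      by (simp add: inner_commute)
    have "(norm z)\<^sup>2 = (norm u)\<^sup>2 + 2 * (u \<bullet> B y) + (norm (B y))\<^sup>2"
      by (simp add: z power2_norm_eq_inner inner_add_left inner_add_right inner_commute)
    then have "(norm z)\<^sup>2 + (y - A z) \<bullet> R (y - A z) = (norm y)\<^sup>2 + ((norm u)\<^sup>2 + A u \<bullet> R (A u))"
      by (simp add: 1 AB)
    then show ?thesis
      by (simp add: E_def q_def exp_add[symmetric] u_def[symmetric])
  qed
  \<comment> \<open>\<open>c1\<close> is dominated by a Gaussian integral and hence finite; the
    relation \<open>c01\<close> below carries this over to \<open>c0\<close>, the normalising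
    constant of the kernel.\<close>
  define c0 where "c0 = (\<integral>\<^sup>+y. E 0 y \<partial>lborel)"
  define c1 where "c1 = (\<integral>\<^sup>+u. q u \<partial>lborel)"
  let ?a = "sqrt pi ^ DIM('a)" and ?b = "sqrt pi ^ DIM('b)"
  have E_shift: "E (x + n) y = E n (y - A x)" for x n y
    by (simp add: E_def linear_add[OF A] algebra_simps)
  have E_int: "(\<integral>\<^sup>+y. E z y \<partial>lborel) = c0" for z
  proof -
    have "(\<integral>\<^sup>+y. E z y \<partial>lborel) = (\<integral>\<^sup>+y. E 0 (- A z + y) \<partial>lborel)"
      using E_shift[of z 0] by simp
    also have "\<dots> = c0" unfolding c0_def by (rule nn_integral_lborel_shift) simp
    finally show ?thesis .
  qed
  have z_int: "(\<integral>\<^sup>+z. ennreal (gauss 1 z) * E z y \<partial>lborel) = ennreal (exp (- (norm y)\<^sup>2) / ?a) * c1" for y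
  proof -
    have "ennreal (gauss 1 z) * E z y = ennreal (exp (- (norm y)\<^sup>2) / ?a) * q (- B y + z)" for z
      using key[of z y] by (simp add: gauss_def ennreal_mult''[symmetric] q_def E_def)
    then have "(\<integral>\<^sup>+z. ennreal (gauss 1 z) * E z y \<partial>lborel)
        = ennreal (exp (- (norm y)\<^sup>2) / ?a) * (\<integral>\<^sup>+z. q (- B y + z) \<partial>lborel)"
      by (simp add: nn_integral_cmult)
    also have "(\<integral>\<^sup>+z. q (- B y + z) \<partial>lborel) = c1"
      unfolding c1_def by (rule nn_integral_lborel_shift) simp
    finally show ?thesis .
  qed
  have expint: "(\<integral>\<^sup>+x. exp (- (norm (x::'c::euclidean_space))\<^sup>2) \<partial>lborel) = ennreal (sqrt pi ^ DIM('c))"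
    by (subst nn_integral_eq_integral) (use integral_exp_norm_sq[of 1, where 'a='c] in auto)
  have "c0 = (\<integral>\<^sup>+z. ennreal (gauss 1 z) * (\<integral>\<^sup>+y. E z y \<partial>lborel) \<partial>lborel)"
    by (simp add: E_int nn_integral_multc nn_integral_gauss)
  also have "\<dots> = (\<integral>\<^sup>+z. \<integral>\<^sup>+y. ennreal (gauss 1 z) * E z y \<partial>lborel \<partial>lborel)"
    by (simp add: nn_integral_cmult)
  also have "\<dots> = (\<integral>\<^sup>+y. \<integral>\<^sup>+z. ennreal (gauss 1 z) * E z y \<partial>lborel \<partial>lborel)"
    by (rule lborel_pair.Fubini') simp
  also have "\<dots> = ennreal (?b / ?a) * c1"
  proof -
    have "(\<integral>\<^sup>+y. ennreal (exp (- (norm (y::'b))\<^sup>2) / ?a) \<partial>lborel)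
        = (\<integral>\<^sup>+y. ennreal (exp (- (norm (y::'b))\<^sup>2)) * ennreal (1 / ?a) \<partial>lborel)"
      by (simp add: ennreal_mult''[symmetric])
    also have "\<dots> = ennreal (?b / ?a)"
      by (subst nn_integral_multc) (auto simp: expint ennreal_mult''[symmetric])
    finally show ?thesis
      by (simp add: z_int nn_integral_multc)
  qed
  finally have c01: "c0 = ennreal (?b / ?a) * c1" .
  have "c1 \<le> (\<integral>\<^sup>+u. exp (- (norm (u::'a))\<^sup>2) \<partial>lborel)"
    unfolding c1_def by (intro nn_integral_mono) (use R_pos in \<open>auto simp: q_def\<close>)
  then have c1_fin: "c1 < \<top>" by (rule le_less_trans) (simp add: expint)
  then have c0_fin: "c0 < \<top>" by (simp add: c01 ennreal_mult_less_top)
  have "c0 \<noteq> 0"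
  proof
    assume "c0 = 0"
    then have "AE y in (lborel :: 'b measure). ennreal (E 0 y) = 0"
      unfolding c0_def by (subst (asm) nn_integral_0_iff_AE) auto
    then have "AE y in (lborel :: 'b measure). False"
    proof eventually_elim
      fix y assume "ennreal (E 0 y) = 0"
      then show False using E_pos[of 0 y] by (simp add: ennreal_eq_0_iff)
    qed
    then show False
      by (subst (asm) AE_iff_measurable[OF _ refl]) auto
  qed
  then have pos: "enn2real c0 > 0" using c0_fin by (simp add: enn2real_positive_iff zero_less_iff_neq_zero)
  have c0r: "ennreal (enn2real c0) = c0" using c0_fin by simp
  define \<kappa> where "\<kappa> z y = E z y / enn2real c0" for z y
  have \<kappa>: "ennreal (\<kappa> z y) = E z y / c0" for z y
    using divide_ennreal[of "E z y" "enn2real c0"] pos E_pos[of z y] by (simp add: \<kappa>_def c0r less_imp_le)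
  show thesis
  proof (rule that[of \<kappa>])
    have "(\<lambda>(z, y). E z y / enn2real c0) \<in> borel_measurable (borel \<Otimes>\<^sub>M borel)" by measurable
    then show "(\<lambda>(z, y). \<kappa> z y) \<in> borel_measurable borel"
      by (simp add: \<kappa>_def borel_prod)
    show "\<kappa> z y > 0" for z y using pos by (simp add: \<kappa>_def E_pos)
    show "(\<integral>\<^sup>+y. \<kappa> z y \<partial>lborel) = 1" for z
      using \<open>c0 \<noteq> 0\<close> c0_fin by (simp add: \<kappa> nn_integral_divide E_int)
    show "(\<integral>\<^sup>+z. ennreal (gauss 1 (z - x)) * \<kappa> z y \<partial>lborel) = gauss 1 (y - A x)" for x y
    proof -
      have [measurable]: "(\<lambda>z. \<kappa> z y) \<in> borel_measurable borel" unfolding \<kappa>_def by measurable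
      have "(\<integral>\<^sup>+z. ennreal (gauss 1 (z - x)) * \<kappa> z y \<partial>lborel)
          = (\<integral>\<^sup>+n. ennreal (gauss 1 (x + n - x)) * \<kappa> (x + n) y \<partial>lborel)"
        by (rule nn_integral_lborel_shift[symmetric]) measurable
      also have "\<dots> = (\<integral>\<^sup>+n. ennreal (gauss 1 n) * E n (y - A x) / c0 \<partial>lborel)"
        by (simp add: \<kappa> E_shift ennreal_times_divide)
      also have "\<dots> = ennreal (exp (- (norm (y - A x))\<^sup>2) / ?a) * c1 / c0"
        by (simp add: nn_integral_divide z_int)
      also have "\<dots> = ennreal (gauss 1 (y - A x))"
      proof -
        obtain r where r: "c1 = ennreal r" "r \<ge> 0" using c1_fin by (cases c1) auto
        have "r > 0" using \<open>c0 \<noteq> 0\<close> r c01 by (cases "r = 0") auto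
        have "c0 = ennreal (?b / ?a * r)" using c01 r by (simp add: ennreal_mult''[symmetric])
        then show ?thesis using r \<open>r > 0\<close>
          by (simp add: ennreal_mult''[symmetric] divide_ennreal gauss_def)
      qed
      finally show ?thesis .
    qed
  qed
qed


section \<open>Gaussian noise over a block of channel uses\<close>

lemma density_PiM_lborel:
  fixes f :: "'i \<Rightarrow> 'a::euclidean_space \<Rightarrow> real"
  assumes I: "finite I" and [measurable]: "\<And>i. f i \<in> borel_measurable borel"
    and nn: "\<And>i x. f i x \<ge> 0" and prob: "\<And>i. prob_space (density lborel (f i))"
  shows "density (PiM I (\<lambda>_. lborel)) (\<lambda>z. ennreal (\<Prod>i\<in>I. f i (z i))) = PiM I (\<lambda>i. density lborel (f i))"
proof -
  interpret L: product_sigma_finite "\<lambda>_::'i. lborel :: 'a measure" by standard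
  interpret F: product_prob_space "\<lambda>i. density lborel (f i)" I
    by (intro product_prob_spaceI prob)
  show ?thesis
  proof (rule F.PiM_eqI[OF I])
    show "sets (density (PiM I (\<lambda>_. lborel)) (\<lambda>z. ennreal (\<Prod>i\<in>I. f i (z i)))) = sets (PiM I (\<lambda>i. density lborel (f i)))"
      by (auto intro!: sets_PiM_cong)
    fix A assume A: "\<And>i. i \<in> I \<Longrightarrow> A i \<in> sets (density lborel (\<lambda>x. ennreal (f i x)))"
    have [measurable]: "Pi\<^sub>E I A \<in> sets (PiM I (\<lambda>_. lborel))"
      using A by (intro sets_PiM_I_finite I) auto
    have [measurable]: "(\<lambda>z. \<Prod>i\<in>I. f i (z i)) \<in> borel_measurable (PiM I (\<lambda>_. lborel))"
      by measurable
    have "emeasure (density (PiM I (\<lambda>_. lborel)) (\<lambda>z. ennreal (\<Prod>i\<in>I. f i (z i)))) (Pi\<^sub>E I A)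
        = (\<integral>\<^sup>+z. ennreal (\<Prod>i\<in>I. f i (z i)) * indicator (Pi\<^sub>E I A) z \<partial>PiM I (\<lambda>_. lborel))"
      by (subst emeasure_density) auto
    also have "\<dots> = (\<integral>\<^sup>+z. (\<Prod>i\<in>I. ennreal (f i (z i)) * indicator (A i) (z i)) \<partial>PiM I (\<lambda>_. lborel))"
    proof (rule nn_integral_cong)
      fix z :: "'i \<Rightarrow> 'a" assume "z \<in> space (PiM I (\<lambda>_. lborel))"
      then have "z \<in> Pi\<^sub>E I A \<longleftrightarrow> (\<forall>i\<in>I. z i \<in> A i)"
        by (auto simp: space_PiM PiE_def Pi_def)
      then have "indicator (Pi\<^sub>E I A) z = (\<Prod>i\<in>I. indicator (A i) (z i) :: ennreal)"
        using I by (cases "z \<in> Pi\<^sub>E I A") (auto simp: indicator_def prod_zero_iff intro!: prod.neutral)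
      then show "ennreal (\<Prod>i\<in>I. f i (z i)) * indicator (Pi\<^sub>E I A) z = (\<Prod>i\<in>I. ennreal (f i (z i)) * indicator (A i) (z i))"
        using nn by (simp add: prod.distrib prod_ennreal)
    qed
    also have "\<dots> = (\<Prod>i\<in>I. \<integral>\<^sup>+x. ennreal (f i x) * indicator (A i) x \<partial>lborel)"
      using A by (intro L.product_nn_integral_prod I) auto
    also have "\<dots> = (\<Prod>i\<in>I. emeasure (density lborel (f i)) (A i))"
      using A by (intro prod.cong refl) (simp add: emeasure_density)
    finally show "emeasure (density (PiM I (\<lambda>_. lborel)) (\<lambda>z. ennreal (\<Prod>i\<in>I. f i (z i)))) (Pi\<^sub>E I A)
        = (\<Prod>i\<in>I. emeasure (density lborel (\<lambda>x. ennreal (f i x))) (A i))" .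
  qed
qed

text \<open>Conditional density of a received block, given the noiseless block \<open>x\<close> and
  unit noise that is independent over time.\<close>

definition gauss_vec :: "'i set \<Rightarrow> ('i \<Rightarrow> 'a::euclidean_space) \<Rightarrow> ('i \<Rightarrow> 'a) \<Rightarrow> real" where
  "gauss_vec I x z = (\<Prod>i\<in>I. gauss 1 (z i - x i))"

lemma gauss_vec_pos: "gauss_vec I x z > 0"
  unfolding gauss_vec_def by (intro prod_pos) (simp add: gauss_pos)

lemma density_gauss_vec:
  fixes x :: "'i \<Rightarrow> 'a::euclidean_space"
  assumes "finite I"
  shows "density (PiM I (\<lambda>_. lborel)) (gauss_vec I x) = PiM I (\<lambda>i. density lborel (\<lambda>y. gauss 1 (y - x i)))"
  unfolding gauss_vec_def
  by (intro density_PiM_lborel assms) (auto intro: prob_space_density_gauss simp: gauss_pos less_imp_le)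

lemma nn_integral_gauss_vec:
  fixes x :: "'i \<Rightarrow> 'a::euclidean_space"
  assumes "finite I"
  shows "(\<integral>\<^sup>+z. gauss_vec I x z \<partial>PiM I (\<lambda>_. lborel)) = 1"
proof -
  interpret F: product_prob_space "\<lambda>i. density lborel (\<lambda>y. ennreal (gauss 1 (y - x i)))" I
    by (intro product_prob_spaceI prob_space_density_gauss) simp
  have "emeasure (density (PiM I (\<lambda>_. lborel)) (gauss_vec I x)) (space (PiM I (\<lambda>_. lborel))) = 1"
    unfolding density_gauss_vec[OF assms] using F.emeasure_space_1 by (simp add: space_PiM)
  then show ?thesis
    by (subst (asm) emeasure_density) (auto simp: gauss_vec_def cong: nn_integral_cong)
qed

lemma distr_gauss_vec_shift:
  fixes x :: "'i \<Rightarrow> 'a::euclidean_space"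
  assumes I: "finite I"
  shows "distr (PiM I (\<lambda>_. density lborel (gauss 1))) (PiM I (\<lambda>_. borel)) (\<lambda>n. \<lambda>i\<in>I. x i + n i)
    = density (PiM I (\<lambda>_. lborel)) (gauss_vec I x)"
  unfolding density_gauss_vec[OF I]
proof -
  interpret N: product_prob_space "\<lambda>_::'i. density lborel (\<lambda>y::'a. ennreal (gauss 1 y))" I
    by (intro product_prob_spaceI prob_space_gauss) simp
  interpret F: product_prob_space "\<lambda>i. density lborel (\<lambda>y::'a. ennreal (gauss 1 (y - x i)))" I
    by (intro product_prob_spaceI prob_space_density_gauss) simp
  show "distr (PiM I (\<lambda>_. density lborel (gauss 1))) (PiM I (\<lambda>_. borel)) (\<lambda>n. \<lambda>i\<in>I. x i + n i)
     = PiM I (\<lambda>i. density lborel (\<lambda>y. gauss 1 (y - x i)))"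
  proof (rule F.PiM_eqI[OF I])
    show "sets (distr (PiM I (\<lambda>_. density lborel (gauss 1))) (PiM I (\<lambda>_. borel)) (\<lambda>n. \<lambda>i\<in>I. x i + n i))
        = sets (PiM I (\<lambda>i. density lborel (\<lambda>y. gauss 1 (y - x i))))"
      by (auto intro!: sets_PiM_cong)
    fix A assume A: "\<And>i. i \<in> I \<Longrightarrow> A i \<in> sets (density lborel (\<lambda>y. ennreal (gauss 1 (y - x i))))"
    have "Pi\<^sub>E I A \<in> sets (PiM I (\<lambda>_. borel))"
      using A by (intro sets_PiM_I_finite I) auto
    then have "emeasure (distr (PiM I (\<lambda>_. density lborel (gauss 1))) (PiM I (\<lambda>_. borel)) (\<lambda>n. \<lambda>i\<in>I. x i + n i)) (Pi\<^sub>E I A)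
        = emeasure (PiM I (\<lambda>_. density lborel (gauss 1))) ((\<lambda>n. \<lambda>i\<in>I. x i + n i) -` Pi\<^sub>E I A \<inter> space (PiM I (\<lambda>_. density lborel (gauss 1))))"
      by (subst emeasure_distr) auto
    also have "(\<lambda>n. \<lambda>i\<in>I. x i + n i) -` Pi\<^sub>E I A \<inter> space (PiM I (\<lambda>_. density lborel (gauss 1)))
        = Pi\<^sub>E I (\<lambda>i. (\<lambda>n. x i + n) -` A i)"
      by (auto simp: space_PiM PiE_def Pi_def)
    also have "emeasure (PiM I (\<lambda>_. density lborel (gauss 1))) \<dots>
        = (\<Prod>i\<in>I. emeasure (density lborel (gauss 1)) ((\<lambda>n. x i + n) -` A i))"
      using A by (intro N.emeasure_PiM I) (auto intro!: measurable_sets_borel[of _ borel])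
    also have "\<dots> = (\<Prod>i\<in>I. emeasure (density lborel (\<lambda>y. gauss 1 (y - x i))) (A i))"
    proof (rule prod.cong[OF refl])
      fix i assume "i \<in> I"
      with A have Ai [measurable]: "A i \<in> sets borel" by auto
      have "(\<integral>\<^sup>+y. ennreal (gauss 1 (y - x i)) * indicator (A i) y \<partial>lborel)
        = (\<integral>\<^sup>+n. ennreal (gauss 1 (x i + n - x i)) * indicator (A i) (x i + n) \<partial>lborel)"
        by (rule nn_integral_lborel_shift[symmetric]) measurable
      also have "\<dots> = (\<integral>\<^sup>+n. ennreal (gauss 1 n) * indicator ((\<lambda>n. x i + n) -` A i) n \<partial>lborel)"
        by (simp add: indicator_def)
      finally show "emeasure (density lborel (gauss 1)) ((\<lambda>n. x i + n) -` A i) = emeasure (density lborel (\<lambda>y. gauss 1 (y - x i))) (A i)"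
        by (subst (1 2) emeasure_density) (auto intro!: measurable_sets_borel[of _ borel])
    qed
    finally show "emeasure (distr (PiM I (\<lambda>_. density lborel (gauss 1))) (PiM I (\<lambda>_. borel)) (\<lambda>n. \<lambda>i\<in>I. x i + n i)) (Pi\<^sub>E I A)
        = (\<Prod>i\<in>I. emeasure (density lborel (\<lambda>y. ennreal (gauss 1 (y - x i)))) (A i))" .
  qed
qed

section \<open>Information carried by independent messages\<close>

lemma AE_pair_fst:
  assumes "sigma_finite_measure N" and "AE x in M. P x"
  shows "AE p in M \<Otimes>\<^sub>M N. P (fst p)"
proof -
  interpret N: sigma_finite_measure N by fact
  obtain A where A: "{x \<in> space M. \<not> P x} \<subseteq> A" "emeasure M A = 0" "A \<in> sets M"
    using assms(2) by (rule AE_E)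
  show ?thesis
  proof (rule AE_I[where N = "A \<times> space N"])
    show "emeasure (M \<Otimes>\<^sub>M N) (A \<times> space N) = 0"
      using A by (simp add: N.emeasure_pair_measure_Times)
  qed (use A in \<open>auto simp: space_pair_measure\<close>)
qed

text \<open>Jensen's inequality for the concave logarithm. The mean is a nonnegative integral
  because it will be a likelihood ratio averaged over a kernel, whose finiteness is known only
  almost everywhere. Its positivity is recorded since the logarithm of a product of such means is
  split into a sum later.\<close>

lemma (in prob_space) expectation_ln_le:
  assumes [measurable]: "X \<in> borel_measurable M" and pos: "AE x in M. 0 < X x"
    and fin: "(\<integral>\<^sup>+x. ennreal (X x) \<partial>M) < \<top>" and int: "integrable M (\<lambda>x. ln (X x))"
  shows "expectation (\<lambda>x. ln (X x)) \<le> ln (enn2real (\<integral>\<^sup>+x. ennreal (X x) \<partial>M))"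
    and "0 < enn2real (\<integral>\<^sup>+x. ennreal (X x) \<partial>M)"
proof -
  have nn: "AE x in M. 0 \<le> X x" using pos by eventually_elim simp
  have X: "integrable M X" using fin nn by (intro integrableI_nonneg) auto
  have eq: "enn2real (\<integral>\<^sup>+x. ennreal (X x) \<partial>M) = expectation X"
    by (rule integral_eq_nn_integral[symmetric]) (use nn in auto)
  have "- ln (expectation X) \<le> expectation (\<lambda>x. - ln (X x))"
    by (rule jensens_inequality[where I = "{0<..}"])
      (use X pos int minus_log_convex[of "exp 1"] in \<open>auto simp: log_def\<close>)
  then show "expectation (\<lambda>x. ln (X x)) \<le> ln (enn2real (\<integral>\<^sup>+x. ennreal (X x) \<partial>M))"
    by (simp add: eq)
  have "expectation X > 0"
  proof (rule ccontr)
    assume "\<not> expectation X > 0"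
    moreover have "expectation X \<ge> 0" using nn by (rule integral_nonneg_AE)
    ultimately have "AE x in M. X x = 0"
      using integral_nonneg_eq_0_iff_AE[OF X nn] by simp
    with pos have "AE x in M. False" by eventually_elim simp
    then show False by simp
  qed
  then show "0 < enn2real (\<integral>\<^sup>+x. ennreal (X x) \<partial>M)" by (simp add: eq)
qed

text \<open>The tangent of \<open>ln\<close> at y lies above the graph. It yields Gibbs' inequality
  and, later, the linear price of an unusually large channel norm.\<close>

lemma ln_le_ln_add: "x > 0 \<Longrightarrow> y > 0 \<Longrightarrow> ln x \<le> ln y + x / y - (1::real)"
  using ln_le_minus_one[of "x / y"] by (simp add: ln_div)

text \<open>Fubini for the product of \<open>g\<close>, \<open>\<kappa>\<close> and
  \<open>J\<close>: integrating over the intermediate variable first turns \<open>g\<close> and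
  \<open>\<kappa>\<close> into \<open>f\<close>, and the assumption \<open>int\<close> becomes
  absolute integrability of the whole. The third conclusion guards against points where the inner
  integral fails to exist and \<open>L\<close> has its default value 0.\<close>

lemma integral_degraded:
  fixes g :: "'a \<Rightarrow> 'z \<Rightarrow> real" and \<kappa> :: "'z \<Rightarrow> 'y \<Rightarrow> real" and J :: "'a \<Rightarrow> 'y \<Rightarrow> real"
  assumes "sigma_finite_measure M" "sigma_finite_measure Z" "sigma_finite_measure Y"
    and [measurable]: "(\<lambda>(\<omega>, z). g \<omega> z) \<in> borel_measurable (M \<Otimes>\<^sub>M Z)"
      "(\<lambda>(z, y). \<kappa> z y) \<in> borel_measurable (Z \<Otimes>\<^sub>M Y)"
      "(\<lambda>(\<omega>, y). J \<omega> y) \<in> borel_measurable (M \<Otimes>\<^sub>M Y)"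
    and g_nonneg: "\<And>\<omega> z. 0 \<le> g \<omega> z" and \<kappa>_nonneg: "\<And>z y. 0 \<le> \<kappa> z y"
    and f_nonneg: "\<And>\<omega> y. 0 \<le> f \<omega> y"
    and f: "\<And>\<omega> y. \<omega> \<in> space M \<Longrightarrow> y \<in> space Y \<Longrightarrow> (\<integral>\<^sup>+z. ennreal (g \<omega> z) * \<kappa> z y \<partial>Z) = ennreal (f \<omega> y)"
    and int: "integrable (M \<Otimes>\<^sub>M Y) (\<lambda>(\<omega>, y). f \<omega> y * J \<omega> y)"
  defines "L \<equiv> \<lambda>\<omega> z. (\<integral>y. \<kappa> z y * J \<omega> y \<partial>Y)"
  shows "integrable (M \<Otimes>\<^sub>M Z) (\<lambda>(\<omega>, z). g \<omega> z * L \<omega> z)"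
    and "(\<integral>p. (case p of (\<omega>, z) \<Rightarrow> g \<omega> z * L \<omega> z) \<partial>(M \<Otimes>\<^sub>M Z)) = (\<integral>p. (case p of (\<omega>, y) \<Rightarrow> f \<omega> y * J \<omega> y) \<partial>(M \<Otimes>\<^sub>M Y))"
    and "AE p in M \<Otimes>\<^sub>M Z. g (fst p) (snd p) > 0 \<longrightarrow> integrable Y (\<lambda>y. \<kappa> (snd p) y * J (fst p) y)"
proof -
  interpret M: sigma_finite_measure M by fact
  interpret Z: sigma_finite_measure Z by fact
  interpret Y: sigma_finite_measure Y by fact
  interpret ZY: pair_sigma_finite Z Y ..
  interpret MZ: pair_sigma_finite M Z ..
  interpret MY: pair_sigma_finite M Y ..
  interpret MZY: pair_sigma_finite "M \<Otimes>\<^sub>M Z" Y ..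
  have L_meas [measurable]: "(\<lambda>(\<omega>, z). L \<omega> z) \<in> borel_measurable (M \<Otimes>\<^sub>M Z)"
    unfolding L_def by measurable
  have [measurable]: "(\<lambda>z. g \<omega> z) \<in> borel_measurable Z" "(\<lambda>y. J \<omega> y) \<in> borel_measurable Y" if "\<omega> \<in> space M" for \<omega>
    using that by measurable
  have [measurable]: "(\<lambda>(\<omega>, y). f \<omega> y * J \<omega> y) \<in> borel_measurable (M \<Otimes>\<^sub>M Y)"
    using int by auto
  define F where "F p y = g (fst p) (snd p) * \<kappa> (snd p) y * J (fst p) y" for p y
  have [measurable]: "(\<lambda>(p, y). F p y) \<in> borel_measurable ((M \<Otimes>\<^sub>M Z) \<Otimes>\<^sub>M Y)"
    unfolding F_def by measurable
  have inner: "(\<integral>\<^sup>+z. \<integral>\<^sup>+y. ennreal \<bar>F (\<omega>, z) y\<bar> \<partial>Y \<partial>Z) = (\<integral>\<^sup>+y. ennreal \<bar>f \<omega> y * J \<omega> y\<bar> \<partial>Y)"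
    if \<omega> [measurable]: "\<omega> \<in> space M" for \<omega>
  proof -
    have "(\<integral>\<^sup>+z. \<integral>\<^sup>+y. ennreal \<bar>F (\<omega>, z) y\<bar> \<partial>Y \<partial>Z) = (\<integral>\<^sup>+y. \<integral>\<^sup>+z. ennreal \<bar>F (\<omega>, z) y\<bar> \<partial>Z \<partial>Y)"
      by (rule ZY.Fubini'[symmetric]) (simp add: F_def)
    also have "\<dots> = (\<integral>\<^sup>+y. \<integral>\<^sup>+z. ennreal (g \<omega> z) * \<kappa> z y * ennreal \<bar>J \<omega> y\<bar> \<partial>Z \<partial>Y)"
      using g_nonneg \<kappa>_nonneg by (simp add: F_def abs_mult ennreal_mult)
    also have "\<dots> = (\<integral>\<^sup>+y. ennreal (f \<omega> y) * ennreal \<bar>J \<omega> y\<bar> \<partial>Y)"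
      by (intro nn_integral_cong) (simp add: nn_integral_multc f \<omega>)
    finally show ?thesis using f_nonneg by (simp add: abs_mult ennreal_mult)
  qed
  have F_int: "integrable ((M \<Otimes>\<^sub>M Z) \<Otimes>\<^sub>M Y) (\<lambda>(p, y). F p y)"
  proof (rule integrableI_bounded)
    have "(\<integral>\<^sup>+x. ennreal (norm (case x of (p, y) \<Rightarrow> F p y)) \<partial>((M \<Otimes>\<^sub>M Z) \<Otimes>\<^sub>M Y))
        = (\<integral>\<^sup>+p. \<integral>\<^sup>+y. ennreal \<bar>F p y\<bar> \<partial>Y \<partial>(M \<Otimes>\<^sub>M Z))"
      by (subst Y.nn_integral_fst[symmetric]) auto
    also have "\<dots> = (\<integral>\<^sup>+\<omega>. \<integral>\<^sup>+z. \<integral>\<^sup>+y. ennreal \<bar>F (\<omega>, z) y\<bar> \<partial>Y \<partial>Z \<partial>M)"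
      by (subst Z.nn_integral_fst[symmetric]) auto
    also have "\<dots> = (\<integral>\<^sup>+\<omega>. \<integral>\<^sup>+y. ennreal \<bar>f \<omega> y * J \<omega> y\<bar> \<partial>Y \<partial>M)"
      by (intro nn_integral_cong) (simp add: inner)
    also have "\<dots> = (\<integral>\<^sup>+x. ennreal (norm (case x of (\<omega>, y) \<Rightarrow> f \<omega> y * J \<omega> y)) \<partial>(M \<Otimes>\<^sub>M Y))"
      by (subst Y.nn_integral_fst[symmetric]) auto
    also have "\<dots> < \<infinity>" using int by (simp add: integrable_iff_bounded)
    finally show "(\<integral>\<^sup>+x. ennreal (norm (case x of (p, y) \<Rightarrow> F p y)) \<partial>((M \<Otimes>\<^sub>M Z) \<Otimes>\<^sub>M Y)) < \<infinity>" .
  qed simp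
  have gL: "g \<omega> z * L \<omega> z = (\<integral>y. F (\<omega>, z) y \<partial>Y)" for \<omega> z
    by (simp add: F_def L_def mult.assoc)
  have "integrable (M \<Otimes>\<^sub>M Z) (\<lambda>p. \<integral>y. F p y \<partial>Y)"
    by (rule MZY.integrable_fst[OF F_int])
  then show gL_int: "integrable (M \<Otimes>\<^sub>M Z) (\<lambda>(\<omega>, z). g \<omega> z * L \<omega> z)"
    by (simp add: gL split_beta')
  have fin: "AE \<omega> in M. (\<integral>\<^sup>+y. ennreal \<bar>f \<omega> y * J \<omega> y\<bar> \<partial>Y) < \<infinity>"
    using MY.AE_integrable_fst[of "\<lambda>\<omega> y. f \<omega> y * J \<omega> y"] int by (auto simp: integrable_iff_bounded elim: eventually_mono)
  have "(\<integral>p. (case p of (\<omega>, z) \<Rightarrow> g \<omega> z * L \<omega> z) \<partial>(M \<Otimes>\<^sub>M Z)) = (\<integral>\<omega>. \<integral>z. g \<omega> z * L \<omega> z \<partial>Z \<partial>M)"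
    using gL_int by (rule MZ.integral_fst[symmetric])
  also have "\<dots> = (\<integral>\<omega>. \<integral>y. f \<omega> y * J \<omega> y \<partial>Y \<partial>M)"
  proof (rule integral_cong_AE)
    show "AE \<omega> in M. (\<integral>z. g \<omega> z * L \<omega> z \<partial>Z) = (\<integral>y. f \<omega> y * J \<omega> y \<partial>Y)"
      using fin AE_space
    proof eventually_elim
      fix \<omega> assume *: "(\<integral>\<^sup>+y. ennreal \<bar>f \<omega> y * J \<omega> y\<bar> \<partial>Y) < \<infinity>" and \<omega> [measurable]: "\<omega> \<in> space M"
      have "integrable (Z \<Otimes>\<^sub>M Y) (\<lambda>(z, y). F (\<omega>, z) y)"
      proof (rule integrableI_bounded)
        show "(\<lambda>(z, y). F (\<omega>, z) y) \<in> borel_measurable (Z \<Otimes>\<^sub>M Y)"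
          unfolding F_def by simp
        then show "(\<integral>\<^sup>+x. ennreal (norm (case x of (z, y) \<Rightarrow> F (\<omega>, z) y)) \<partial>(Z \<Otimes>\<^sub>M Y)) < \<infinity>"
          using * inner[OF \<omega>] by (subst Y.nn_integral_fst[symmetric]) auto
      qed
      from ZY.Fubini_integral[OF this]
      have "(\<integral>z. g \<omega> z * L \<omega> z \<partial>Z) = (\<integral>y. \<integral>z. F (\<omega>, z) y \<partial>Z \<partial>Y)"
        by (simp add: gL)
      also have "\<dots> = (\<integral>y. f \<omega> y * J \<omega> y \<partial>Y)"
      proof (rule Bochner_Integration.integral_cong[OF refl])
        fix y assume y: "y \<in> space Y"
        then have "(\<integral>z. g \<omega> z * \<kappa> z y \<partial>Z) = f \<omega> y"
          using f[OF \<omega> y] g_nonneg \<kappa>_nonneg f_nonneg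
          by (subst integral_eq_nn_integral) (auto simp: ennreal_mult)
        then show "(\<integral>z. F (\<omega>, z) y \<partial>Z) = f \<omega> y * J \<omega> y"
          by (simp add: F_def)
      qed
      finally show "(\<integral>z. g \<omega> z * L \<omega> z \<partial>Z) = (\<integral>y. f \<omega> y * J \<omega> y \<partial>Y)" .
    qed
  qed measurable
  also have "\<dots> = (\<integral>p. (case p of (\<omega>, y) \<Rightarrow> f \<omega> y * J \<omega> y) \<partial>(M \<Otimes>\<^sub>M Y))"
    using int by (rule MY.integral_fst)
  finally show "(\<integral>p. (case p of (\<omega>, z) \<Rightarrow> g \<omega> z * L \<omega> z) \<partial>(M \<Otimes>\<^sub>M Z)) = (\<integral>p. (case p of (\<omega>, y) \<Rightarrow> f \<omega> y * J \<omega> y) \<partial>(M \<Otimes>\<^sub>M Y))" .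
  have "AE p in M \<Otimes>\<^sub>M Z. integrable Y (\<lambda>y. F p y)"
    by (rule MZY.AE_integrable_fst[OF F_int])
  then show "AE p in M \<Otimes>\<^sub>M Z. g (fst p) (snd p) > 0 \<longrightarrow> integrable Y (\<lambda>y. \<kappa> (snd p) y * J (fst p) y)"
    by eventually_elim (auto simp: F_def mult.assoc)
qed


text \<open>Gibbs' inequality for the single density \<open>q(z) \<Prod>\<^sub>k E[R\<^sub>k(W\<^sub>k, y\<^sub>k) | z]\<close>, whose total mass is at most 1
  because the messages \<open>W\<^sub>k\<close> are independent; this combines data processing, the chain
  rule and the comparison with a reference law \<open>q\<close> in one step.\<close>
lemma (in prob_space) sum_information_le:
  fixes g :: "'a \<Rightarrow> 'z \<Rightarrow> real" and \<kappa> :: "'i \<Rightarrow> 'z \<Rightarrow> 'y \<Rightarrow> real" and R :: "'i \<Rightarrow> 'w \<Rightarrow> 'y \<Rightarrow> real"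
  assumes Z: "sigma_finite_measure Z" and Y: "sigma_finite_measure Y" and I: "finite I"
    and W: "indep_vars (\<lambda>_. D) W I"
    and g_meas [measurable]: "(\<lambda>(\<omega>, z). g \<omega> z) \<in> borel_measurable (M \<Otimes>\<^sub>M Z)"
    and q_meas [measurable]: "q \<in> borel_measurable Z"
    and \<kappa>_meas: "\<And>k. k \<in> I \<Longrightarrow> (\<lambda>(z, y). \<kappa> k z y) \<in> borel_measurable (Z \<Otimes>\<^sub>M Y)"
    and R_meas: "\<And>k. k \<in> I \<Longrightarrow> (\<lambda>(w, y). R k w y) \<in> borel_measurable (D \<Otimes>\<^sub>M Y)"
    and g_pos: "\<And>\<omega> z. 0 < g \<omega> z" and q_pos: "\<And>z. 0 < q z" and \<kappa>_pos: "\<And>k z y. 0 < \<kappa> k z y"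
    and R_nonneg: "\<And>k w y. 0 \<le> R k w y" and f_nonneg: "\<And>k \<omega> y. 0 \<le> f k \<omega> y"
    and g_1: "\<And>\<omega>. \<omega> \<in> space M \<Longrightarrow> (\<integral>\<^sup>+z. g \<omega> z \<partial>Z) = 1" and q_1: "(\<integral>\<^sup>+z. q z \<partial>Z) = 1"
    and \<kappa>_1: "\<And>k z. k \<in> I \<Longrightarrow> z \<in> space Z \<Longrightarrow> (\<integral>\<^sup>+y. \<kappa> k z y \<partial>Y) = 1"
    and f: "\<And>k \<omega> y. k \<in> I \<Longrightarrow> \<omega> \<in> space M \<Longrightarrow> y \<in> space Y \<Longrightarrow>
      (\<integral>\<^sup>+z. ennreal (g \<omega> z) * \<kappa> k z y \<partial>Z) = ennreal (f k \<omega> y)"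
    and R_marginal: "\<And>k. k \<in> I \<Longrightarrow> AE y in Y. (\<integral>\<^sup>+\<omega>. R k (W k \<omega>) y \<partial>M) \<le> 1"
    and R_pos: "\<And>k. k \<in> I \<Longrightarrow> AE p in M \<Otimes>\<^sub>M Y. 0 < R k (W k (fst p)) (snd p)"
    and int: "\<And>k. k \<in> I \<Longrightarrow> integrable (M \<Otimes>\<^sub>M Y) (\<lambda>(\<omega>, y). f k \<omega> y * ln (R k (W k \<omega>) y))"
    and int_g: "integrable (M \<Otimes>\<^sub>M Z) (\<lambda>(\<omega>, z). g \<omega> z * ln (g \<omega> z / q z))"
  shows "(\<Sum>k\<in>I. \<integral>p. (case p of (\<omega>, y) \<Rightarrow> f k \<omega> y * ln (R k (W k \<omega>) y)) \<partial>(M \<Otimes>\<^sub>M Y))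
    \<le> (\<integral>p. (case p of (\<omega>, z) \<Rightarrow> g \<omega> z * ln (g \<omega> z / q z)) \<partial>(M \<Otimes>\<^sub>M Z))"
proof -
  interpret Z: sigma_finite_measure Z by fact
  interpret Y: sigma_finite_measure Y by fact
  interpret ZY: pair_sigma_finite Z Y ..
  interpret MZ: pair_sigma_finite M Z ..
  interpret MY: pair_sigma_finite M Y ..
  note \<kappa>_meas [measurable] R_meas [measurable]
  have W_meas [measurable]: "W k \<in> M \<rightarrow>\<^sub>M D" if "k \<in> I" for k
    using W that by (auto simp: indep_vars_def)
  \<comment> \<open>\<open>L\<close> averages the log-likelihood ratio over the kernel and
    \<open>\<psi>\<close> the ratio itself, so Jensen's inequality gives L \<le> ln
    \<open>\<psi>\<close>. For fixed z, \<open>\<psi>\<close> depends on \<omega> through the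
    message of user k alone.\<close>
  define L where "L k \<omega> z = (\<integral>y. \<kappa> k z y * ln (R k (W k \<omega>) y) \<partial>Y)" for k \<omega> z
  define \<psi> where "\<psi> k z w = (\<integral>\<^sup>+y. ennreal (\<kappa> k z y) * R k w y \<partial>Y)" for k z w
  have \<psi>_meas [measurable]: "(\<lambda>(z, w). \<psi> k z w) \<in> borel_measurable (Z \<Otimes>\<^sub>M D)" if [measurable]: "k \<in> I" for k
    unfolding \<psi>_def by measurable
  have [measurable]: "\<psi> k z \<in> borel_measurable D" if [measurable]: "k \<in> I" "z \<in> space Z" for k z
    by measurable
  have \<psi>W_meas [measurable]: "(\<lambda>p. \<psi> k (snd p) (W k (fst p))) \<in> borel_measurable (M \<Otimes>\<^sub>M Z)"
    if [measurable]: "k \<in> I" for k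
    by measurable
  have \<psi>_marginal: "(\<integral>\<^sup>+\<omega>. \<psi> k z (W k \<omega>) \<partial>M) \<le> 1" if k [measurable]: "k \<in> I" and z [measurable]: "z \<in> space Z" for k z
  proof -
    have "(\<integral>\<^sup>+\<omega>. \<psi> k z (W k \<omega>) \<partial>M) = (\<integral>\<^sup>+y. \<integral>\<^sup>+\<omega>. ennreal (\<kappa> k z y) * R k (W k \<omega>) y \<partial>M \<partial>Y)"
      unfolding \<psi>_def by (rule MY.Fubini'[symmetric]) simp
    also have "\<dots> = (\<integral>\<^sup>+y. ennreal (\<kappa> k z y) * (\<integral>\<^sup>+\<omega>. R k (W k \<omega>) y \<partial>M) \<partial>Y)"
      by (intro nn_integral_cong nn_integral_cmult) simp
    also have "\<dots> \<le> (\<integral>\<^sup>+y. ennreal (\<kappa> k z y) * 1 \<partial>Y)"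
      using R_marginal[OF k] by (intro nn_integral_mono_AE) (auto elim!: eventually_mono intro!: mult_left_mono simp del: mult_1_right)
    finally show ?thesis using \<kappa>_1[OF k z] by simp
  qed
  \<comment> \<open>Stated for every subset: singletons give the finiteness of each
    \<open>\<psi>\<close> almost everywhere, the full set the total mass of the competing
    density.\<close>
  have q_\<psi>: "(\<integral>\<^sup>+p. ennreal (q (snd p)) * (\<Prod>k\<in>K. \<psi> k (snd p) (W k (fst p))) \<partial>(M \<Otimes>\<^sub>M Z)) \<le> 1" if K: "K \<subseteq> I" for K
  proof -
    have [measurable]: "k \<in> I" if "k \<in> K" for k using that K by auto
    have "(\<integral>\<^sup>+p. ennreal (q (snd p)) * (\<Prod>k\<in>K. \<psi> k (snd p) (W k (fst p))) \<partial>(M \<Otimes>\<^sub>M Z))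
        = (\<integral>\<^sup>+z. \<integral>\<^sup>+\<omega>. ennreal (q z) * (\<Prod>k\<in>K. \<psi> k z (W k \<omega>)) \<partial>M \<partial>Z)"
      by (subst MZ.nn_integral_snd[symmetric]) auto
    also have "\<dots> \<le> (\<integral>\<^sup>+z. ennreal (q z) \<partial>Z)"
    proof (rule nn_integral_mono)
      fix z assume z [measurable]: "z \<in> space Z"
      have "indep_vars (\<lambda>_. D) W K" using W K by (rule indep_vars_subset)
      then have "indep_vars (\<lambda>_. borel) (\<lambda>k \<omega>. \<psi> k z (W k \<omega>)) K"
        by (rule indep_vars_compose2) measurable
      then have "(\<integral>\<^sup>+\<omega>. (\<Prod>k\<in>K. \<psi> k z (W k \<omega>)) \<partial>M) = (\<Prod>k\<in>K. \<integral>\<^sup>+\<omega>. \<psi> k z (W k \<omega>) \<partial>M)"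
        by (intro indep_vars_nn_integral) (use I K in \<open>auto intro: finite_subset\<close>)
      also have "\<dots> \<le> (\<Prod>k\<in>K. 1)"
        using K z by (intro prod_mono_ennreal \<psi>_marginal) auto
      finally have "(\<integral>\<^sup>+\<omega>. (\<Prod>k\<in>K. \<psi> k z (W k \<omega>)) \<partial>M) \<le> 1" by simp
      then show "(\<integral>\<^sup>+\<omega>. ennreal (q z) * (\<Prod>k\<in>K. \<psi> k z (W k \<omega>)) \<partial>M) \<le> ennreal (q z)"
        using mult_left_mono[of _ 1 "ennreal (q z)"] by (subst nn_integral_cmult) auto
    qed
    finally show ?thesis using q_1 by simp
  qed
  have \<psi>_fin: "AE p in M \<Otimes>\<^sub>M Z. \<psi> k (snd p) (W k (fst p)) < \<top>" if k [measurable]: "k \<in> I" for k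
  proof -
    have "(\<integral>\<^sup>+p. ennreal (q (snd p)) * \<psi> k (snd p) (W k (fst p)) \<partial>(M \<Otimes>\<^sub>M Z)) \<le> 1"
      using q_\<psi>[of "{k}"] k by simp
    then have "AE p in M \<Otimes>\<^sub>M Z. ennreal (q (snd p)) * \<psi> k (snd p) (W k (fst p)) \<noteq> \<infinity>"
      by (intro nn_integral_noteq_infinite) (auto simp: top_unique)
    then show ?thesis
      by eventually_elim (use q_pos in \<open>auto simp: ennreal_mult_eq_top_iff less_top[symmetric] ennreal_eq_0_iff not_le\<close>)
  qed
  note deg = integral_degraded[where J = "\<lambda>\<omega> y. ln (R k (W k \<omega>) y)" and \<kappa> = "\<kappa> k" and g = g and f = "f k" for k,
      OF sigma_finite_measure_axioms Z Y g_meas \<kappa>_meas, folded L_def]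
  have gL_int: "integrable (M \<Otimes>\<^sub>M Z) (\<lambda>(\<omega>, z). g \<omega> z * L k \<omega> z)" if k [measurable]: "k \<in> I" for k
    by (rule deg(1)) (use k g_pos \<kappa>_pos f_nonneg f int in \<open>auto simp: less_imp_le\<close>)
  have gL_eq: "(\<integral>p. (case p of (\<omega>, z) \<Rightarrow> g \<omega> z * L k \<omega> z) \<partial>(M \<Otimes>\<^sub>M Z))
      = (\<integral>p. (case p of (\<omega>, y) \<Rightarrow> f k \<omega> y * ln (R k (W k \<omega>) y)) \<partial>(M \<Otimes>\<^sub>M Y))" if k [measurable]: "k \<in> I" for k
    by (rule deg(2)) (use k g_pos \<kappa>_pos f_nonneg f int in \<open>auto simp: less_imp_le\<close>)
  have int_\<kappa>: "AE p in M \<Otimes>\<^sub>M Z. g (fst p) (snd p) > 0 \<longrightarrow> integrable Y (\<lambda>y. \<kappa> k (snd p) y * ln (R k (W k (fst p)) y))" if k [measurable]: "k \<in> I" for k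
    by (rule deg(3)) (use k g_pos \<kappa>_pos f_nonneg f int in \<open>auto simp: less_imp_le\<close>)
  have L_le: "AE p in M \<Otimes>\<^sub>M Z. 0 < enn2real (\<psi> k (snd p) (W k (fst p)))
      \<and> L k (fst p) (snd p) \<le> ln (enn2real (\<psi> k (snd p) (W k (fst p))))" if k [measurable]: "k \<in> I" for k
  proof -
    \<comment> \<open>For almost every \<omega> the exceptional set in y is null for
      \<open>Y\<close>, hence null for every kernel law, which has a density relative to
      \<open>Y\<close>.\<close>
    have "AE \<omega> in M. AE y in Y. 0 < R k (W k \<omega>) y"
      using MY.AE_pair[OF R_pos[OF k]] by simp
    from AE_pair_fst[OF Z this] int_\<kappa>[OF k] \<psi>_fin[OF k] AE_space
    show ?thesis
    proof eventually_elim
      fix p assume pos: "AE y in Y. 0 < R k (W k (fst p)) y"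
        and int: "g (fst p) (snd p) > 0 \<longrightarrow> integrable Y (\<lambda>y. \<kappa> k (snd p) y * ln (R k (W k (fst p)) y))"
        and fin: "\<psi> k (snd p) (W k (fst p)) < \<top>" and p: "p \<in> space (M \<Otimes>\<^sub>M Z)"
      obtain \<omega> z where pz: "p = (\<omega>, z)" and [measurable]: "\<omega> \<in> space M" and z [measurable]: "z \<in> space Z"
        using p by (auto simp: space_pair_measure)
      have [measurable]: "\<kappa> k z \<in> borel_measurable Y" "R k (W k \<omega>) \<in> borel_measurable Y"
        by measurable
      interpret K: prob_space "density Y (\<lambda>y. ennreal (\<kappa> k z y))"
        by (rule prob_spaceI) (simp add: emeasure_density \<kappa>_1[OF k z] cong: nn_integral_cong)
      have eq: "(\<integral>\<^sup>+y. ennreal (R k (W k \<omega>) y) \<partial>density Y (\<lambda>y. ennreal (\<kappa> k z y))) = \<psi> k z (W k \<omega>)"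
        by (simp add: nn_integral_density \<psi>_def)
      have posK: "AE y in density Y (\<lambda>y. ennreal (\<kappa> k z y)). 0 < R k (W k \<omega>) y"
        using pos by (subst AE_density) (auto simp: pz)
      have intK: "integrable (density Y (\<lambda>y. ennreal (\<kappa> k z y))) (\<lambda>y. ln (R k (W k \<omega>) y))"
        using int g_pos \<kappa>_pos by (subst integrable_density) (auto simp: pz less_imp_le)
      have LK: "K.expectation (\<lambda>y. ln (R k (W k \<omega>) y)) = L k \<omega> z"
        using \<kappa>_pos by (subst integral_density) (auto simp: L_def less_imp_le)
      show "0 < enn2real (\<psi> k (snd p) (W k (fst p)))
          \<and> L k (fst p) (snd p) \<le> ln (enn2real (\<psi> k (snd p) (W k (fst p))))"
        using K.expectation_ln_le[of "R k (W k \<omega>)"] posK intK fin by (simp add: eq LK pz)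
    qed
  qed
  \<comment> \<open>The competing density of Gibbs' inequality. An infinite factor becomes 0 under
    \<open>enn2real\<close>, which can only lower the total mass.\<close>
  define T where "T p = q (snd p) * (\<Prod>k\<in>I. enn2real (\<psi> k (snd p) (W k (fst p))))" for p
  have [measurable]: "T \<in> borel_measurable (M \<Otimes>\<^sub>M Z)"
    unfolding T_def by measurable
  have T_nn: "T p \<ge> 0" for p using q_pos by (simp add: T_def less_imp_le prod_nonneg)
  have T_le: "(\<integral>\<^sup>+p. ennreal (T p) \<partial>(M \<Otimes>\<^sub>M Z)) \<le> 1"
  proof -
    have "ennreal (T p) \<le> ennreal (q (snd p)) * (\<Prod>k\<in>I. \<psi> k (snd p) (W k (fst p)))" for p
      unfolding T_def using q_pos
      by (subst ennreal_mult)
        (auto simp: less_imp_le prod_nonneg prod_ennreal[symmetric] intro!: mult_left_mono prod_mono_ennreal simp: ennreal_enn2real_if)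
    then have "(\<integral>\<^sup>+p. ennreal (T p) \<partial>(M \<Otimes>\<^sub>M Z)) \<le> (\<integral>\<^sup>+p. ennreal (q (snd p)) * (\<Prod>k\<in>I. \<psi> k (snd p) (W k (fst p))) \<partial>(M \<Otimes>\<^sub>M Z))"
      by (intro nn_integral_mono)
    then show ?thesis using q_\<psi>[of I] by (rule order_trans) simp
  qed
  have T_int: "integrable (M \<Otimes>\<^sub>M Z) T"
    using T_nn T_le by (intro integrableI_nonneg) (auto intro: le_less_trans)
  have T_integral: "(\<integral>p. T p \<partial>(M \<Otimes>\<^sub>M Z)) \<le> 1"
    using T_nn T_le by (subst integral_eq_nn_integral) (auto intro!: enn2real_leI)
  have g_nn: "(\<integral>\<^sup>+p. ennreal (g (fst p) (snd p)) \<partial>(M \<Otimes>\<^sub>M Z)) = 1"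
    by (subst Z.nn_integral_fst[symmetric]) (auto simp: g_1 emeasure_space_1 cong: nn_integral_cong)
  have g_int: "integrable (M \<Otimes>\<^sub>M Z) (\<lambda>p. g (fst p) (snd p))"
    using g_nn g_pos by (intro integrableI_nonneg) (auto simp: less_imp_le)
  have g_integral: "(\<integral>p. g (fst p) (snd p) \<partial>(M \<Otimes>\<^sub>M Z)) = 1"
    using g_nn g_pos by (subst integral_eq_nn_integral) (auto simp: less_imp_le)
  let ?s = "\<lambda>p. g (fst p) (snd p) * ln (g (fst p) (snd p) / q (snd p))"
  have s_int: "integrable (M \<Otimes>\<^sub>M Z) ?s" using int_g by (simp add: split_beta')
  have "(\<Sum>k\<in>I. \<integral>p. (case p of (\<omega>, y) \<Rightarrow> f k \<omega> y * ln (R k (W k \<omega>) y)) \<partial>(M \<Otimes>\<^sub>M Y))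
      = (\<Sum>k\<in>I. \<integral>p. g (fst p) (snd p) * L k (fst p) (snd p) \<partial>(M \<Otimes>\<^sub>M Z))"
    using gL_eq by (intro sum.cong refl) (simp add: split_beta')
  also have "\<dots> = (\<integral>p. (\<Sum>k\<in>I. g (fst p) (snd p) * L k (fst p) (snd p)) \<partial>(M \<Otimes>\<^sub>M Z))"
    using gL_int by (intro Bochner_Integration.integral_sum[symmetric]) (simp add: split_beta')
  \<comment> \<open>Pointwise, Jensen's bound followed by the tangent inequality at g/q. The
    correction \<open>T\<close> - g has integral at most 0, since g has mass 1 and \<open>T\<close>
    at most 1.\<close>
  also have "\<dots> \<le> (\<integral>p. ?s p + (T p - g (fst p) (snd p)) \<partial>(M \<Otimes>\<^sub>M Z))"
  proof (rule integral_mono_AE)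
    show "integrable (M \<Otimes>\<^sub>M Z) (\<lambda>p. \<Sum>k\<in>I. g (fst p) (snd p) * L k (fst p) (snd p))"
      using gL_int by (intro Bochner_Integration.integrable_sum) (simp add: split_beta')
    show "integrable (M \<Otimes>\<^sub>M Z) (\<lambda>p. ?s p + (T p - g (fst p) (snd p)))"
      by (intro Bochner_Integration.integrable_add Bochner_Integration.integrable_diff s_int T_int g_int)
    have "AE p in M \<Otimes>\<^sub>M Z. \<forall>k\<in>I. 0 < enn2real (\<psi> k (snd p) (W k (fst p)))
      \<and> L k (fst p) (snd p) \<le> ln (enn2real (\<psi> k (snd p) (W k (fst p))))"
      using I L_le by (intro AE_finite_allI) auto
    then show "AE p in M \<Otimes>\<^sub>M Z. (\<Sum>k\<in>I. g (fst p) (snd p) * L k (fst p) (snd p)) \<le> ?s p + (T p - g (fst p) (snd p))"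
    proof eventually_elim
      fix p assume p: "\<forall>k\<in>I. 0 < enn2real (\<psi> k (snd p) (W k (fst p)))
        \<and> L k (fst p) (snd p) \<le> ln (enn2real (\<psi> k (snd p) (W k (fst p))))"
      define c where "c = g (fst p) (snd p)"
      define d where "d = q (snd p)"
      define r where "r = (\<Prod>k\<in>I. enn2real (\<psi> k (snd p) (W k (fst p))))"
      have pos: "c > 0" "d > 0" "r > 0"
        using g_pos q_pos p by (auto simp: c_def d_def r_def intro!: prod_pos)
      have "(\<Sum>k\<in>I. L k (fst p) (snd p)) \<le> (\<Sum>k\<in>I. ln (enn2real (\<psi> k (snd p) (W k (fst p)))))"
        using p by (intro sum_mono) auto
      also have "\<dots> = ln r"
        unfolding r_def using p I by (intro ln_prod[symmetric]) (auto simp: less_imp_neq[symmetric])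
      also have "\<dots> \<le> ln (c / d) + r / (c / d) - 1"
        using pos by (intro ln_le_ln_add) auto
      finally have "c * (\<Sum>k\<in>I. L k (fst p) (snd p)) \<le> c * (ln (c / d) + r / (c / d) - 1)"
        using pos by (intro mult_left_mono) auto
      also have "\<dots> = c * ln (c / d) + (d * r - c)"
        using pos by (simp add: field_simps)
      finally show "(\<Sum>k\<in>I. g (fst p) (snd p) * L k (fst p) (snd p)) \<le> ?s p + (T p - g (fst p) (snd p))"
        by (simp add: sum_distrib_left c_def d_def r_def T_def)
    qed
  qed
  also have "\<dots> = (\<integral>p. ?s p \<partial>(M \<Otimes>\<^sub>M Z)) + ((\<integral>p. T p \<partial>(M \<Otimes>\<^sub>M Z)) - 1)"
    by (simp add: s_int T_int g_int g_integral)
  also have "\<dots> \<le> (\<integral>p. ?s p \<partial>(M \<Otimes>\<^sub>M Z))" using T_integral by simp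
  finally show ?thesis by (simp add: split_beta')
qed

section \<open>Mutual information as an integral of a log-likelihood ratio\<close>

lemma gauss_vec_measurable [measurable]:
  assumes I: "finite I" and [measurable]: "x \<in> M \<rightarrow>\<^sub>M PiM I (\<lambda>_. borel)"
  shows "(\<lambda>(\<omega>, z). gauss_vec I (x \<omega>) z) \<in> borel_measurable (M \<Otimes>\<^sub>M PiM I (\<lambda>_. lborel :: 'a::euclidean_space measure))"
  unfolding gauss_vec_def by measurable

text \<open>For fixed \<omega> this is the law of shifted noise; integrating over \<omega> then
  allows an arbitrary source space and an arbitrary distribution of the signal.\<close>

lemma distr_signal_plus_noise:
  fixes x :: "'w \<Rightarrow> 'i \<Rightarrow> 'a::euclidean_space"
  assumes I: "finite I" and M: "sigma_finite_measure M"
    and x [measurable]: "x \<in> M \<rightarrow>\<^sub>M PiM I (\<lambda>_. borel)"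
  shows "distr (M \<Otimes>\<^sub>M PiM I (\<lambda>_. density lborel (gauss 1))) (M \<Otimes>\<^sub>M PiM I (\<lambda>_. borel))
      (\<lambda>(\<omega>, n). (\<omega>, \<lambda>i\<in>I. x \<omega> i + n i))
    = density (M \<Otimes>\<^sub>M PiM I (\<lambda>_. lborel)) (\<lambda>(\<omega>, z). gauss_vec I (x \<omega>) z)"
    (is "?L = ?R")
proof (rule measure_eqI)
  interpret M: sigma_finite_measure M by fact
  interpret N: product_prob_space "\<lambda>_::'i. density lborel (\<lambda>y::'a. ennreal (gauss 1 y))" I
    by (intro product_prob_spaceI prob_space_gauss) simp
  interpret L: product_sigma_finite "\<lambda>_::'i. lborel :: 'a measure" by standard
  interpret LI: sigma_finite_measure "PiM I (\<lambda>_::'i. lborel :: 'a measure)"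
    using I by (rule L.sigma_finite)
  let ?N = "PiM I (\<lambda>_. density lborel (\<lambda>y::'a. ennreal (gauss 1 y)))"
  note [measurable_cong] = sets_PiM_cong[OF refl, of I "\<lambda>_. density lborel (\<lambda>y::'a. ennreal (gauss 1 y))" "\<lambda>_. borel", simplified]
    sets_PiM_cong[OF refl, of I "\<lambda>_. lborel :: 'a measure" "\<lambda>_. borel", simplified]
  show "sets ?L = sets ?R"
    by (auto intro!: sets_pair_measure_cong sets_PiM_cong)
  fix B assume "B \<in> sets ?L"
  then have B [measurable]: "B \<in> sets (M \<Otimes>\<^sub>M PiM I (\<lambda>_. borel))" by simp
  have map [measurable]: "(\<lambda>(\<omega>, n). (\<omega>, \<lambda>i\<in>I. x \<omega> i + n i)) \<in> M \<Otimes>\<^sub>M ?N \<rightarrow>\<^sub>M M \<Otimes>\<^sub>M PiM I (\<lambda>_. borel)"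
    by measurable
  have "emeasure ?L B = (\<integral>\<^sup>+p. indicator B p \<partial>?L)"
    by simp
  also have "\<dots> = (\<integral>\<^sup>+p. indicator B (case p of (\<omega>, n) \<Rightarrow> (\<omega>, \<lambda>i\<in>I. x \<omega> i + n i)) \<partial>(M \<Otimes>\<^sub>M ?N))"
    by (rule nn_integral_distr) measurable
  also have "\<dots> = (\<integral>\<^sup>+\<omega>. \<integral>\<^sup>+n. indicator B (\<omega>, \<lambda>i\<in>I. x \<omega> i + n i) \<partial>?N \<partial>M)"
    by (subst N.P.nn_integral_fst[symmetric]) auto
  also have "\<dots> = (\<integral>\<^sup>+\<omega>. \<integral>\<^sup>+z. indicator B (\<omega>, z) \<partial>distr ?N (PiM I (\<lambda>_. borel)) (\<lambda>n. \<lambda>i\<in>I. x \<omega> i + n i) \<partial>M)"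
    by (intro nn_integral_cong, subst nn_integral_distr) auto
  also have "\<dots> = (\<integral>\<^sup>+\<omega>. \<integral>\<^sup>+z. ennreal (gauss_vec I (x \<omega>) z) * indicator B (\<omega>, z) \<partial>PiM I (\<lambda>_. lborel) \<partial>M)"
  proof (rule nn_integral_cong)
    fix \<omega> assume [measurable]: "\<omega> \<in> space M"
    have [measurable]: "(\<lambda>z. gauss_vec I (x \<omega>) z) \<in> borel_measurable (PiM I (\<lambda>_. lborel))"
      unfolding gauss_vec_def by measurable
    show "(\<integral>\<^sup>+z. indicator B (\<omega>, z) \<partial>distr ?N (PiM I (\<lambda>_. borel)) (\<lambda>n. \<lambda>i\<in>I. x \<omega> i + n i))
      = (\<integral>\<^sup>+z. ennreal (gauss_vec I (x \<omega>) z) * indicator B (\<omega>, z) \<partial>PiM I (\<lambda>_. lborel))"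
      unfolding distr_gauss_vec_shift[OF I] by (subst nn_integral_density) auto
  qed
  also have "\<dots> = (\<integral>\<^sup>+p. ennreal (gauss_vec I (x (fst p)) (snd p)) * indicator B p \<partial>(M \<Otimes>\<^sub>M PiM I (\<lambda>_. lborel)))"
    using gauss_vec_measurable[OF I x] by (subst LI.nn_integral_fst[symmetric]) (auto simp: split_beta')
  also have "\<dots> = emeasure ?R B"
    using gauss_vec_measurable[OF I x] by (subst emeasure_density) (auto simp: split_beta')
  finally show "emeasure ?L B = emeasure ?R B" .
qed

text \<open>\<open>RN_deriv\<close> takes its default value 0 here, and the logarithm of 0 is 0.
  Read contrapositively, a nonzero divergence certifies that a density exists.\<close>

lemma KL_divergence_not_absolutely_continuous:
  assumes "\<not> (\<exists>f\<in>borel_measurable M. density M f = N)"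
  shows "KL_divergence b M N = 0"
proof -
  have "RN_deriv M N = (\<lambda>_. 0)"
    using assms by (auto simp: RN_deriv_def)
  then show ?thesis
    by (simp add: KL_divergence_def entropy_density_def comp_def log_def)
qed

text \<open>In the regular case this is Gibbs' inequality. A missing density or a non-integrable
  entropy density yields the value 0 by convention, so neither absolute continuity nor integrability
  has to be assumed.\<close>

lemma KL_divergence_prob_nonneg:
  assumes "prob_space M" "prob_space N" "sets N = sets M" "1 < b"
  shows "0 \<le> KL_divergence b M N"
proof (cases "integrable N (entropy_density b M N) \<and> (\<exists>f\<in>borel_measurable M. density M f = N)")
  case True
  interpret M: prob_space M by fact
  interpret N: prob_space N by fact
  interpret information_space M b by standard fact
  have ac: "absolutely_continuous M N"
    using True absolutely_continuousI_density by blast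
  obtain D where D [measurable]: "D \<in> borel_measurable M" and RN: "AE x in M. RN_deriv M N x = ennreal (D x)"
    and "AE x in N. 0 < D x" and nn: "\<And>x. 0 \<le> D x"
    using M.real_RN_deriv[OF N.finite_measure_axioms ac assms(3)] by metis
  have "N = density M (RN_deriv M N)"
    using M.density_RN_deriv[OF ac assms(3)] by simp
  also have "\<dots> = density M (\<lambda>x. ennreal (D x))"
    using RN by (intro density_cong) auto
  finally have N: "N = density M (\<lambda>x. ennreal (D x))" .
  define E where "E = entropy_density b M N"
  have [measurable]: "E \<in> borel_measurable M" by (simp add: E_def)
  have "integrable N E" using True by (simp add: E_def)
  then have "integrable (density M (\<lambda>x. ennreal (D x))) E" by (simp add: N)
  then have "integrable M (\<lambda>x. D x * E x)"
    by (subst (asm) integrable_density) (auto simp: nn)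
  then have "integrable M (\<lambda>x. D x * log b (D x))"
    by (rule integrable_cong_AE_imp)
      (use RN nn in \<open>auto simp: E_def entropy_density_def elim!: eventually_mono\<close>)
  then show ?thesis
    using KL_nonneg[of D] nn assms(2) N by simp
next
  case False
  then show ?thesis
    using KL_divergence_not_absolutely_continuous[of M N b]
    by (auto simp: KL_divergence_def not_integrable_integral_eq)
qed

text \<open>Supplies the hypotheses of \<open>sum_information_le\<close> for one user,
  \<open>R\<close> being the likelihood ratio of the joint law \<open>Q\<close> of message and
  output against the product of its marginals. The assumption \<open>nz\<close> provides both a
  density and the integrability of its logarithm.\<close>

lemma (in prob_space) KL_divergence_kernel:
  fixes f :: "'a \<Rightarrow> 'y \<Rightarrow> real"
  assumes Y: "sigma_finite_measure Y" and W [measurable]: "W \<in> M \<rightarrow>\<^sub>M D"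
    and f_meas [measurable]: "(\<lambda>(\<omega>, y). f \<omega> y) \<in> borel_measurable (M \<Otimes>\<^sub>M Y)"
    and f_pos: "\<And>\<omega> y. 0 < f \<omega> y"
    and f_1: "\<And>\<omega>. \<omega> \<in> space M \<Longrightarrow> (\<integral>\<^sup>+y. f \<omega> y \<partial>Y) = 1"
  defines "\<xi> \<equiv> density (M \<Otimes>\<^sub>M Y) (\<lambda>(\<omega>, y). ennreal (f \<omega> y))"
  defines "PW \<equiv> distr M D W" and "PY \<equiv> distr \<xi> Y snd" and "Q \<equiv> distr \<xi> (D \<Otimes>\<^sub>M Y) (\<lambda>(\<omega>, y). (W \<omega>, y))"
  defines "R \<equiv> \<lambda>w y. enn2real (RN_deriv (PW \<Otimes>\<^sub>M PY) Q (w, y))"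
  assumes nz: "KL_divergence (exp 1) (PW \<Otimes>\<^sub>M PY) Q \<noteq> 0"
  shows "(\<lambda>(w, y). R w y) \<in> borel_measurable (D \<Otimes>\<^sub>M Y)"
    and "AE y in Y. (\<integral>\<^sup>+\<omega>. R (W \<omega>) y \<partial>M) \<le> 1"
    and "AE p in M \<Otimes>\<^sub>M Y. 0 < R (W (fst p)) (snd p)"
    and "integrable (M \<Otimes>\<^sub>M Y) (\<lambda>(\<omega>, y). f \<omega> y * ln (R (W \<omega>) y))"
    and "KL_divergence (exp 1) (PW \<Otimes>\<^sub>M PY) Q = (\<integral>p. (case p of (\<omega>, y) \<Rightarrow> f \<omega> y * ln (R (W \<omega>) y)) \<partial>(M \<Otimes>\<^sub>M Y))"
proof -
  interpret Y: sigma_finite_measure Y by fact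
  interpret MY: pair_sigma_finite M Y ..
  have sets_\<xi> [measurable_cong, simp]: "sets \<xi> = sets (M \<Otimes>\<^sub>M Y)" by (simp add: \<xi>_def)
  have space_\<xi> [simp]: "space \<xi> = space (M \<Otimes>\<^sub>M Y)" by (simp add: \<xi>_def)
  have sets_PW [measurable_cong, simp]: "sets PW = sets D" by (simp add: PW_def)
  have sets_PY [measurable_cong, simp]: "sets PY = sets Y" by (simp add: PY_def)
  have space_PY [simp]: "space PY = space Y" by (simp add: PY_def)
  have sets_Q [measurable_cong, simp]: "sets Q = sets (D \<Otimes>\<^sub>M Y)" by (simp add: Q_def)
  have sets_PP [measurable_cong, simp]: "sets (PW \<Otimes>\<^sub>M PY) = sets (D \<Otimes>\<^sub>M Y)" by (simp cong: sets_pair_measure_cong)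
  interpret \<xi>: prob_space \<xi>
  proof (rule prob_spaceI)
    have "emeasure \<xi> (space \<xi>) = (\<integral>\<^sup>+p. ennreal (f (fst p) (snd p)) \<partial>(M \<Otimes>\<^sub>M Y))"
      by (subst \<xi>_def, subst emeasure_density) (auto simp: split_beta' cong: nn_integral_cong)
    also have "\<dots> = 1"
      by (subst Y.nn_integral_fst[symmetric]) (auto simp: f_1 emeasure_space_1 cong: nn_integral_cong)
    finally show "emeasure \<xi> (space \<xi>) = 1" .
  qed
  interpret PW: prob_space PW unfolding PW_def by (rule prob_space_distr) simp
  interpret PY: prob_space PY unfolding PY_def by (rule \<xi>.prob_space_distr) simp
  interpret Q: prob_space Q unfolding Q_def by (rule \<xi>.prob_space_distr) measurable
  interpret PP: pair_prob_space PW PY ..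
  define r where "r = RN_deriv (PW \<Otimes>\<^sub>M PY) Q"
  have r_meas [measurable]: "r \<in> borel_measurable (D \<Otimes>\<^sub>M Y)"
    unfolding r_def using borel_measurable_RN_deriv[of "PW \<Otimes>\<^sub>M PY" Q] by simp
  obtain f' where f': "f' \<in> borel_measurable (PW \<Otimes>\<^sub>M PY)" "density (PW \<Otimes>\<^sub>M PY) f' = Q"
    using nz KL_divergence_not_absolutely_continuous by blast
  have r: "density (PW \<Otimes>\<^sub>M PY) r = Q"
    unfolding r_def using density_RN_deriv_density[OF f'(1)] f'(2) by simp
  have ac: "absolutely_continuous (PW \<Otimes>\<^sub>M PY) Q"
    using f' absolutely_continuousI_density by blast
  show R_meas [measurable]: "(\<lambda>(w, y). R w y) \<in> borel_measurable (D \<Otimes>\<^sub>M Y)"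
    unfolding R_def r_def[symmetric] by simp
  \<comment> \<open>As f is positive everywhere, null sets of \<open>\<xi>\<close> are null for the
    underlying product measure.\<close>
  have AE_\<xi>: "AE p in M \<Otimes>\<^sub>M Y. P p" if "AE p in \<xi>. P p" for P
  proof -
    have "AE p in M \<Otimes>\<^sub>M Y. 0 < (case p of (\<omega>, y) \<Rightarrow> ennreal (f \<omega> y)) \<longrightarrow> P p"
      using that unfolding \<xi>_def by (subst (asm) AE_density) simp_all
    then show ?thesis
      by eventually_elim (simp add: split_beta' f_pos)
  qed
  have Wmap: "(\<lambda>(\<omega>, y). (W \<omega>, y)) \<in> \<xi> \<rightarrow>\<^sub>M D \<Otimes>\<^sub>M Y" by measurable
  have AE_Q: "AE p in M \<Otimes>\<^sub>M Y. P (W (fst p), snd p)" if "AE x in Q. P x" for P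
    using AE_\<xi>[OF AE_distrD[OF Wmap that[unfolded Q_def]]] by (simp add: split_beta')
  have "AE x in PW \<Otimes>\<^sub>M PY. r x \<noteq> \<infinity>"
    unfolding r_def by (rule PP.RN_deriv_finite) (use ac Q.sigma_finite_measure_axioms in auto)
  then have "AE x in Q. r x \<noteq> \<infinity>"
    by (rule absolutely_continuous_AE[rotated 2]) (use ac in auto)
  moreover have "AE x in Q. 0 < r x"
    unfolding r[symmetric] by (subst AE_density) auto
  ultimately have "AE x in Q. 0 < enn2real (r x)"
    by eventually_elim (simp add: enn2real_positive_iff less_top[symmetric])
  from AE_Q[OF this] show "AE p in M \<Otimes>\<^sub>M Y. 0 < R (W (fst p)) (snd p)"
    by (simp add: R_def r_def)
  \<comment> \<open>Both sides are the law of the output, because \<open>Q\<close> has that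
    marginal; uniqueness of densities then shows that r has mean 1 over the message.\<close>
  have "density PY (\<lambda>y. \<integral>\<^sup>+w. r (w, y) \<partial>PW) = density PY (\<lambda>_. 1)"
  proof (rule measure_eqI)
    fix B assume "B \<in> sets (density PY (\<lambda>y. \<integral>\<^sup>+w. r (w, y) \<partial>PW))"
    then have B [measurable]: "B \<in> sets Y" by simp
    have "emeasure (density PY (\<lambda>y. \<integral>\<^sup>+w. r (w, y) \<partial>PW)) B = (\<integral>\<^sup>+y. (\<integral>\<^sup>+w. r (w, y) \<partial>PW) * indicator B y \<partial>PY)"
      by (subst emeasure_density) auto
    also have "\<dots> = (\<integral>\<^sup>+y. \<integral>\<^sup>+w. r (w, y) * indicator B y \<partial>PW \<partial>PY)"
      by (intro nn_integral_cong nn_integral_multc[symmetric]) (simp, measurable)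
    also have "\<dots> = (\<integral>\<^sup>+x. r x * indicator B (snd x) \<partial>(PW \<Otimes>\<^sub>M PY))"
      by (subst PP.nn_integral_snd[symmetric]) auto
    also have "\<dots> = (\<integral>\<^sup>+x. indicator B (snd x) \<partial>Q)"
      unfolding r[symmetric] by (subst nn_integral_density) auto
    also have "\<dots> = (\<integral>\<^sup>+p. indicator B (snd p) \<partial>\<xi>)"
      unfolding Q_def by (subst nn_integral_distr) (auto simp: split_beta')
    also have "\<dots> = (\<integral>\<^sup>+y. indicator B y \<partial>PY)"
      unfolding PY_def by (subst nn_integral_distr) auto
    finally show "emeasure (density PY (\<lambda>y. \<integral>\<^sup>+w. r (w, y) \<partial>PW)) B = emeasure (density PY (\<lambda>_. 1)) B"
      by (simp add: emeasure_density)
  qed simp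
  then have marg: "AE y in PY. (\<integral>\<^sup>+w. r (w, y) \<partial>PW) = 1"
    by (subst (asm) PY.density_unique_iff) auto
  have snd_\<xi>: "snd \<in> \<xi> \<rightarrow>\<^sub>M Y" by measurable
  have "AE p in M \<Otimes>\<^sub>M Y. (\<integral>\<^sup>+w. r (w, snd p) \<partial>PW) = 1"
    by (rule AE_\<xi>[OF AE_distrD[OF snd_\<xi> marg[unfolded PY_def]]])
  then have "AE \<omega> in M. AE y in Y. (\<integral>\<^sup>+w. r (w, y) \<partial>PW) = 1"
    using MY.AE_pair[of "\<lambda>p. (\<integral>\<^sup>+w. r (w, snd p) \<partial>PW) = 1"] by simp
  then have "AE y in Y. (\<integral>\<^sup>+w. r (w, y) \<partial>PW) = 1"
    by (simp only: AE_const)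
  then show "AE y in Y. (\<integral>\<^sup>+\<omega>. R (W \<omega>) y \<partial>M) \<le> 1"
    using AE_space
  proof eventually_elim
    \<comment> \<open>An infinite value of the density is lost under \<open>enn2real\<close>, hence
      an inequality instead of the value 1.\<close>
    fix y assume y: "(\<integral>\<^sup>+w. r (w, y) \<partial>PW) = 1" and [measurable]: "y \<in> space Y"
    have "(\<integral>\<^sup>+\<omega>. R (W \<omega>) y \<partial>M) \<le> (\<integral>\<^sup>+\<omega>. r (W \<omega>, y) \<partial>M)"
      by (intro nn_integral_mono) (simp add: R_def r_def ennreal_enn2real_if)
    also have "\<dots> = (\<integral>\<^sup>+w. r (w, y) \<partial>PW)"
      unfolding PW_def by (subst nn_integral_distr) auto
    finally show "(\<integral>\<^sup>+\<omega>. R (W \<omega>) y \<partial>M) \<le> 1" using y by simp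
  qed
  have ed: "entropy_density (exp 1) (PW \<Otimes>\<^sub>M PY) Q = (\<lambda>x. ln (R (fst x) (snd x)))"
    by (auto simp: entropy_density_def R_def log_def fun_eq_iff)
  have int: "integrable Q (\<lambda>x. ln (R (fst x) (snd x)))"
    using nz not_integrable_integral_eq[of Q] unfolding KL_divergence_def ed by blast
  have [measurable]: "(\<lambda>x. ln (R (fst x) (snd x))) \<in> borel_measurable (D \<Otimes>\<^sub>M Y)"
    using R_meas by (simp add: split_beta')
  have "integrable \<xi> (\<lambda>p. ln (R (W (fst p)) (snd p)))"
    using int unfolding Q_def by (subst (asm) integrable_distr_eq) (auto simp: split_beta')
  then show "integrable (M \<Otimes>\<^sub>M Y) (\<lambda>(\<omega>, y). f \<omega> y * ln (R (W \<omega>) y))"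
    unfolding \<xi>_def split_beta' by (subst (asm) integrable_density) (use f_pos in \<open>auto simp: less_imp_le\<close>)
  have "KL_divergence (exp 1) (PW \<Otimes>\<^sub>M PY) Q = (\<integral>p. ln (R (W (fst p)) (snd p)) \<partial>\<xi>)"
    unfolding KL_divergence_def ed unfolding Q_def by (subst integral_distr) (auto simp: split_beta')
  also have "\<dots> = (\<integral>p. (case p of (\<omega>, y) \<Rightarrow> f \<omega> y * ln (R (W \<omega>) y)) \<partial>(M \<Otimes>\<^sub>M Y))"
    unfolding \<xi>_def split_beta' by (subst integral_density) (use f_pos in \<open>auto simp: less_imp_le\<close>)
  finally show "KL_divergence (exp 1) (PW \<Otimes>\<^sub>M PY) Q = (\<integral>p. (case p of (\<omega>, y) \<Rightarrow> f \<omega> y * ln (R (W \<omega>) y)) \<partial>(M \<Otimes>\<^sub>M Y))" .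
qed

section \<open>Moments of the noise and relative entropy to a Gaussian reference law\<close>

lemma integrable_gauss_law:
  "integrable (density lborel (gauss 1)) (\<lambda>y::'a::euclidean_space. (norm y)\<^sup>2)"
  "(\<integral>y. (norm y)\<^sup>2 \<partial>density lborel (\<lambda>y::'a. ennreal (gauss 1 y))) = DIM('a) / 2"
proof -
  show "integrable (density lborel (gauss 1)) (\<lambda>y::'a. (norm y)\<^sup>2)"
    using integrable_norm_sq_gauss[where 'a='a]
    by (subst integrable_density) (auto simp: gauss_pos less_imp_le mult.commute)
  show "(\<integral>y. (norm y)\<^sup>2 \<partial>density lborel (\<lambda>y::'a. ennreal (gauss 1 y))) = DIM('a) / 2"
    using integral_norm_sq_gauss[where 'a='a]
    by (subst integral_density) (auto simp: gauss_pos less_imp_le mult.commute)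
qed

lemma norm_le_one_plus_norm_sq: "norm y \<le> 1 + (norm y)\<^sup>2"
proof -
  have "0 \<le> (norm y - 1 / 2)\<^sup>2" by simp
  then show ?thesis by (simp add: power2_diff power2_eq_square algebra_simps)
qed

lemma gauss_law_mean_zero:
  "integrable (density lborel (gauss 1)) (\<lambda>y::'a::euclidean_space. y)"
  "(\<integral>y. y \<partial>density lborel (\<lambda>y::'a. ennreal (gauss 1 y))) = 0"
proof -
  interpret prob_space "density lborel (\<lambda>y::'a. ennreal (gauss 1 y))"
    by (rule prob_space_gauss) simp
  show "integrable (density lborel (gauss 1)) (\<lambda>y::'a. y)"
  proof (rule Bochner_Integration.integrable_bound)
    show "integrable (density lborel (gauss 1)) (\<lambda>y::'a. 1 + (norm y)\<^sup>2)"
      by (intro Bochner_Integration.integrable_add integrable_gauss_law) simp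
  qed (auto intro: norm_le_one_plus_norm_sq)
  \<comment> \<open>Reflection at the origin preserves both Lebesgue measure and the density, so the
    mean equals its own negative.\<close>
  have "lborel = distr lborel borel (uminus :: 'a \<Rightarrow> 'a)"
    using lborel_affine[of "-1" "0 :: 'a"] by (simp add: density_1 uminus_add_conv_diff[symmetric])
  then have "(\<integral>y. gauss 1 y *\<^sub>R y \<partial>lborel) = (\<integral>y. gauss 1 y *\<^sub>R (y::'a) \<partial>distr lborel borel uminus)"
    by (rule arg_cong)
  then have "(\<integral>y. gauss 1 y *\<^sub>R y \<partial>lborel) = - (\<integral>y. gauss 1 y *\<^sub>R (y::'a) \<partial>lborel)"
    by (simp add: integral_distr gauss_def)
  then have "(2::real) *\<^sub>R (\<integral>y. gauss 1 y *\<^sub>R (y::'a) \<partial>lborel) = 0"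
    unfolding scaleR_2 by (simp only: eq_neg_iff_add_eq_0)
  then show "(\<integral>y. y \<partial>density lborel (\<lambda>y::'a. ennreal (gauss 1 y))) = 0"
    by (subst integral_density) (auto simp: gauss_pos less_imp_le)
qed

lemma (in product_prob_space) PiM_component_integral:
  fixes f :: "_ \<Rightarrow> _ :: {banach, second_countable_topology}"
  assumes i: "i \<in> I" and f: "f \<in> borel_measurable (M i)"
  shows "integrable (PiM I M) (\<lambda>x. f (x i)) \<longleftrightarrow> integrable (M i) f"
    and "(\<integral>x. f (x i) \<partial>PiM I M) = (\<integral>y. f y \<partial>M i)"
proof -
  note C = measurable_component_singleton[OF i, of M]
  show "integrable (PiM I M) (\<lambda>x. f (x i)) \<longleftrightarrow> integrable (M i) f"
    using integrable_distr_eq[OF C f] by (simp add: PiM_component[OF i])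
  show "(\<integral>x. f (x i) \<partial>PiM I M) = (\<integral>y. f y \<partial>M i)"
    using integral_distr[OF C f] by (simp add: PiM_component[OF i])
qed

lemma ln_gauss: "v > 0 \<Longrightarrow> ln (gauss v (x::'a::euclidean_space)) = - (norm x)\<^sup>2 / v - DIM('a) / 2 * (ln pi + ln v)"
  by (simp add: gauss_def ln_div ln_realpow ln_sqrt ln_mult)

text \<open>This is the mean relative entropy of the conditional output law from the product
  reference law \<open>q\<close>. With z = x + n the log-ratio is quadratic in n; the cross term of
  x and n has mean 0 because the noise is centred and independent of the source, so the signal
  enters only through its energy.\<close>

lemma (in prob_space) gauss_vec_energy:
  fixes x :: "'a \<Rightarrow> 'i \<Rightarrow> 'e::euclidean_space"
  assumes I: "finite I" and x [measurable]: "x \<in> M \<rightarrow>\<^sub>M PiM I (\<lambda>_. borel)"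
    and int: "integrable M (\<lambda>\<omega>. \<Sum>i\<in>I. (norm (x \<omega> i))\<^sup>2)" and v: "v > 0"
  defines "g \<equiv> \<lambda>\<omega> z. gauss_vec I (x \<omega>) z" and "q \<equiv> \<lambda>z. \<Prod>i\<in>I. gauss v (z i :: 'e)"
  shows "integrable (M \<Otimes>\<^sub>M PiM I (\<lambda>_. lborel)) (\<lambda>(\<omega>, z). g \<omega> z * ln (g \<omega> z / q z))"
    and "(\<integral>p. (case p of (\<omega>, z) \<Rightarrow> g \<omega> z * ln (g \<omega> z / q z)) \<partial>(M \<Otimes>\<^sub>M PiM I (\<lambda>_. lborel)))
      = card I * (DIM('e) / 2) * (ln v + 1 / v - 1) + expectation (\<lambda>\<omega>. \<Sum>i\<in>I. (norm (x \<omega> i))\<^sup>2) / v"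
proof -
  let ?G = "density lborel (\<lambda>y::'e. ennreal (gauss 1 y))"
  let ?N = "PiM I (\<lambda>_. ?G)"
  let ?d = "DIM('e) / 2"
  interpret N: product_prob_space "\<lambda>_::'i. ?G" I
    by (intro product_prob_spaceI prob_space_gauss) simp
  interpret MN: pair_prob_space M ?N ..
  note [measurable_cong] = sets_PiM_cong[OF refl, of I "\<lambda>_. ?G" "\<lambda>_. borel", simplified]
    sets_PiM_cong[OF refl, of I "\<lambda>_. lborel :: 'e measure" "\<lambda>_. borel", simplified]
  have [measurable]: "(\<lambda>(\<omega>, z). g \<omega> z) \<in> borel_measurable (M \<Otimes>\<^sub>M PiM I (\<lambda>_. lborel))"
    unfolding g_def by (rule gauss_vec_measurable[OF I x])
  have [measurable]: "q \<in> borel_measurable (PiM I (\<lambda>_. borel))"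
    unfolding q_def by measurable
  have g_pos: "g \<omega> z > 0" for \<omega> z by (simp add: g_def gauss_vec_pos)
  have ln_gq: "ln (g \<omega> z / q z) = (\<Sum>i\<in>I. (norm (z i))\<^sup>2 / v - (norm (z i - x \<omega> i))\<^sup>2) + card I * ?d * ln v" for \<omega> z
  proof -
    have "ln (g \<omega> z / q z) = (\<Sum>i\<in>I. ln (gauss 1 (z i - x \<omega> i))) - (\<Sum>i\<in>I. ln (gauss v (z i)))"
      unfolding g_def q_def gauss_vec_def using v I
      by (simp add: ln_div ln_prod prod_pos gauss_pos gauss_pos[THEN less_imp_neq, symmetric])
    also have "\<dots> = (\<Sum>i\<in>I. (norm (z i))\<^sup>2 / v - (norm (z i - x \<omega> i))\<^sup>2 + ?d * ln v)"
      unfolding sum_subtractf[symmetric] using v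
      by (intro sum.cong refl) (simp add: ln_gauss algebra_simps add_divide_distrib)
    finally show ?thesis by (simp add: sum.distrib)
  qed
  \<comment> \<open>The log-likelihood ratio as a function of source and noise, after expanding the
    square of x + n.\<close>
  define \<phi> where "\<phi> \<omega> n = (\<Sum>i\<in>I. (1 / v - 1) * (norm (n i))\<^sup>2 + 2 / v * (x \<omega> i \<bullet> n i) + (norm (x \<omega> i))\<^sup>2 / v) + card I * ?d * ln v" for \<omega> and n :: "'i \<Rightarrow> 'e"
  have \<phi>: "ln (g \<omega> (\<lambda>i\<in>I. x \<omega> i + n i) / q (\<lambda>i\<in>I. x \<omega> i + n i)) = \<phi> \<omega> n" for \<omega> n
    unfolding ln_gq \<phi>_def
    by (simp add: power2_norm_eq_inner inner_add_left inner_add_right inner_commute algebra_simps add_divide_distrib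
        cong: sum.cong)
  have ni: "integrable ?N (\<lambda>n. (norm (n i))\<^sup>2)" "(\<integral>n. (norm (n i))\<^sup>2 \<partial>?N) = ?d"
    "integrable ?N (\<lambda>n. n i)" "(\<integral>n. n i \<partial>?N) = 0" if i: "i \<in> I" for i
  proof -
    have m: "(\<lambda>y::'e. (norm y)\<^sup>2) \<in> borel_measurable ?G" "(\<lambda>y::'e. y) \<in> borel_measurable ?G"
      by simp_all
    show "integrable ?N (\<lambda>n. (norm (n i))\<^sup>2)"
      by (subst N.PiM_component_integral(1)[OF i m(1)]) (rule integrable_gauss_law)
    show "(\<integral>n. (norm (n i))\<^sup>2 \<partial>?N) = ?d"
      by (subst N.PiM_component_integral(2)[OF i m(1)]) (rule integrable_gauss_law)
    show "integrable ?N (\<lambda>n. n i)"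
      by (subst N.PiM_component_integral(1)[OF i m(2)]) (rule gauss_law_mean_zero)
    show "(\<integral>n. n i \<partial>?N) = 0"
      by (subst N.PiM_component_integral(2)[OF i m(2)]) (rule gauss_law_mean_zero)
  qed
  have fst_int: "integrable (M \<Otimes>\<^sub>M ?N) (\<lambda>(\<omega>, n). h \<omega>)" "(\<integral>p. (case p of (\<omega>, n) \<Rightarrow> h \<omega>) \<partial>(M \<Otimes>\<^sub>M ?N)) = expectation h"
    if h: "integrable M h" for h :: "'a \<Rightarrow> real"
  proof -
    have D: "distr (M \<Otimes>\<^sub>M ?N) M fst = M" by (rule N.P.distr_pair_fst)
    show "integrable (M \<Otimes>\<^sub>M ?N) (\<lambda>(\<omega>, n). h \<omega>)"
      using h by (subst (asm) D[symmetric], subst (asm) integrable_distr_eq) (auto simp: split_beta')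
    have "expectation h = (\<integral>\<omega>. h \<omega> \<partial>distr (M \<Otimes>\<^sub>M ?N) M fst)" by (simp add: D)
    also have "\<dots> = (\<integral>p. (case p of (\<omega>, n) \<Rightarrow> h \<omega>) \<partial>(M \<Otimes>\<^sub>M ?N))"
      using h by (subst integral_distr) (auto simp: split_beta')
    finally show "(\<integral>p. (case p of (\<omega>, n) \<Rightarrow> h \<omega>) \<partial>(M \<Otimes>\<^sub>M ?N)) = expectation h" ..
  qed
  have xi: "integrable M (\<lambda>\<omega>. (norm (x \<omega> i))\<^sup>2)" if i [measurable]: "i \<in> I" for i
  proof (rule Bochner_Integration.integrable_bound[OF int])
    show "AE \<omega> in M. norm ((norm (x \<omega> i))\<^sup>2) \<le> norm (\<Sum>i\<in>I. (norm (x \<omega> i))\<^sup>2)"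
      using i I by (auto simp: sum_nonneg intro!: member_le_sum)
  qed measurable
  have n_int: "integrable (M \<Otimes>\<^sub>M ?N) (\<lambda>(\<omega>, n). (norm (n i))\<^sup>2)" "(\<integral>p. (case p of (\<omega>, n) \<Rightarrow> (norm (n i))\<^sup>2) \<partial>(M \<Otimes>\<^sub>M ?N)) = ?d"
    if i [measurable]: "i \<in> I" for i
  proof -
    show int: "integrable (M \<Otimes>\<^sub>M ?N) (\<lambda>(\<omega>, n). (norm (n i))\<^sup>2)"
    proof (rule integrableI_bounded)
      have "(\<integral>\<^sup>+p. ennreal (norm (case p of (\<omega>, n) \<Rightarrow> (norm (n i))\<^sup>2)) \<partial>(M \<Otimes>\<^sub>M ?N)) = (\<integral>\<^sup>+\<omega>. \<integral>\<^sup>+n. ennreal ((norm (n i))\<^sup>2) \<partial>?N \<partial>M)"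
        by (subst N.P.nn_integral_fst[symmetric]) auto
      also have "\<dots> = (\<integral>\<^sup>+n. ennreal ((norm (n i))\<^sup>2) \<partial>?N)"
        by (simp add: emeasure_space_1)
      also have "\<dots> < \<infinity>" using ni(1)[OF i] by (simp add: integrable_iff_bounded)
      finally show "(\<integral>\<^sup>+p. ennreal (norm (case p of (\<omega>, n) \<Rightarrow> (norm (n i))\<^sup>2)) \<partial>(M \<Otimes>\<^sub>M ?N)) < \<infinity>" .
    qed measurable
    show "(\<integral>p. (case p of (\<omega>, n) \<Rightarrow> (norm (n i))\<^sup>2) \<partial>(M \<Otimes>\<^sub>M ?N)) = ?d"
      by (subst MN.integral_fst[symmetric, OF int]) (simp add: ni(2)[OF i] prob_space)
  qed
  have xn_int: "integrable (M \<Otimes>\<^sub>M ?N) (\<lambda>(\<omega>, n). x \<omega> i \<bullet> n i)" "(\<integral>p. (case p of (\<omega>, n) \<Rightarrow> x \<omega> i \<bullet> n i) \<partial>(M \<Otimes>\<^sub>M ?N)) = 0"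
    if i [measurable]: "i \<in> I" for i
  proof -
    show int: "integrable (M \<Otimes>\<^sub>M ?N) (\<lambda>(\<omega>, n). x \<omega> i \<bullet> n i)"
    proof (rule Bochner_Integration.integrable_bound)
      show "integrable (M \<Otimes>\<^sub>M ?N) (\<lambda>p. (case p of (\<omega>, n) \<Rightarrow> (norm (x \<omega> i))\<^sup>2) + (case p of (\<omega>, n) \<Rightarrow> (norm (n i))\<^sup>2))"
        by (intro Bochner_Integration.integrable_add fst_int(1) xi n_int(1) i)
      have "\<bar>a \<bullet> b\<bar> \<le> (norm a)\<^sup>2 + (norm b)\<^sup>2" for a b :: 'e
      proof -
        have "\<bar>a \<bullet> b\<bar> \<le> norm a * norm b" by (rule Cauchy_Schwarz_ineq2)
        also have "\<dots> \<le> (norm a)\<^sup>2 + (norm b)\<^sup>2"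
        proof -
          have "2 * (norm a * norm b) \<le> (norm a)\<^sup>2 + (norm b)\<^sup>2"
            using sum_squares_bound[of "norm a" "norm b"] by (simp add: mult.assoc)
          moreover have "0 \<le> norm a * norm b" by simp
          ultimately show ?thesis by linarith
        qed
        finally show ?thesis .
      qed
      then show "AE p in M \<Otimes>\<^sub>M ?N. norm (case p of (\<omega>, n) \<Rightarrow> x \<omega> i \<bullet> n i)
          \<le> norm ((case p of (\<omega>, n) \<Rightarrow> (norm (x \<omega> i))\<^sup>2) + (case p of (\<omega>, n) \<Rightarrow> (norm (n i))\<^sup>2))"
        by (auto simp: split_beta')
    qed measurable
    show "(\<integral>p. (case p of (\<omega>, n) \<Rightarrow> x \<omega> i \<bullet> n i) \<partial>(M \<Otimes>\<^sub>M ?N)) = 0"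
      by (subst MN.integral_fst[symmetric, OF int]) (simp add: ni[OF i])
  qed
  have \<phi>_bochner: "has_bochner_integral (M \<Otimes>\<^sub>M ?N) (\<lambda>p. \<phi> (fst p) (snd p))
    ((\<Sum>i\<in>I. (1 / v - 1) * ?d + 2 / v * 0 + expectation (\<lambda>\<omega>. (norm (x \<omega> i))\<^sup>2) / v) + card I * ?d * ln v)"
    unfolding \<phi>_def
    using n_int xn_int fst_int[OF xi] MN.P.prob_space
    by (intro has_bochner_integral_add has_bochner_integral_sum has_bochner_integral_mult_right
        has_bochner_integral_divide) (auto simp: has_bochner_integral_iff split_beta')
  have eq: "(\<Sum>i\<in>I. (1 / v - 1) * ?d + 2 / v * 0 + expectation (\<lambda>\<omega>. (norm (x \<omega> i))\<^sup>2) / v) + card I * ?d * ln v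
    = card I * ?d * (ln v + 1 / v - 1) + expectation (\<lambda>\<omega>. \<Sum>i\<in>I. (norm (x \<omega> i))\<^sup>2) / v"
    by (simp add: sum.distrib sum_subtractf xi sum_divide_distrib algebra_simps add_divide_distrib diff_divide_distrib)
  let ?h = "\<lambda>p. ln (g (fst p) (snd p) / q (snd p))"
  let ?m = "\<lambda>(\<omega>, n). (\<omega>, \<lambda>i\<in>I. x \<omega> i + n i)"
  have m [measurable]: "?m \<in> M \<Otimes>\<^sub>M ?N \<rightarrow>\<^sub>M M \<Otimes>\<^sub>M PiM I (\<lambda>_. borel)" by measurable
  have dist: "distr (M \<Otimes>\<^sub>M ?N) (M \<Otimes>\<^sub>M PiM I (\<lambda>_. borel)) ?m = density (M \<Otimes>\<^sub>M PiM I (\<lambda>_. lborel)) (\<lambda>(\<omega>, z). g \<omega> z)"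
    unfolding g_def by (rule distr_signal_plus_noise[OF I sigma_finite_measure_axioms x])
  have h\<phi>: "?h (?m p) = \<phi> (fst p) (snd p)" for p
    using \<phi> by (simp add: split_beta')
  have h_meas [measurable]: "?h \<in> borel_measurable (M \<Otimes>\<^sub>M PiM I (\<lambda>_. borel))"
    by measurable
  have "integrable (distr (M \<Otimes>\<^sub>M ?N) (M \<Otimes>\<^sub>M PiM I (\<lambda>_. borel)) ?m) ?h"
    using \<phi>_bochner by (subst integrable_distr_eq[OF m h_meas]) (simp add: h\<phi> has_bochner_integral_iff)
  then show "integrable (M \<Otimes>\<^sub>M PiM I (\<lambda>_. lborel)) (\<lambda>(\<omega>, z). g \<omega> z * ln (g \<omega> z / q z))"
    unfolding dist unfolding split_beta' by (subst (asm) integrable_density) (use g_pos in \<open>auto simp: less_imp_le\<close>)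
  have "(\<integral>p. ?h p \<partial>distr (M \<Otimes>\<^sub>M ?N) (M \<Otimes>\<^sub>M PiM I (\<lambda>_. borel)) ?m) = (\<integral>p. \<phi> (fst p) (snd p) \<partial>(M \<Otimes>\<^sub>M ?N))"
    by (subst integral_distr[OF m h_meas]) (simp only: h\<phi>)
  then show "(\<integral>p. (case p of (\<omega>, z) \<Rightarrow> g \<omega> z * ln (g \<omega> z / q z)) \<partial>(M \<Otimes>\<^sub>M PiM I (\<lambda>_. lborel)))
      = card I * ?d * (ln v + 1 / v - 1) + expectation (\<lambda>\<omega>. \<Sum>i\<in>I. (norm (x \<omega> i))\<^sup>2) / v"
    unfolding dist unfolding split_beta' using \<phi>_bochner eq
    by (subst (asm) integral_density) (use g_pos in \<open>auto simp: less_imp_le has_bochner_integral_iff\<close>)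
qed

section \<open>Rates of a transmission\<close>

text \<open>The norm of a matrix is here the Frobenius norm, so Cauchy-Schwarz in each row
  suffices.\<close>

lemma norm_matrix_vector_mult_le:
  fixes h :: "complex ^ 'm::finite ^ 'k::finite"
  shows "norm (h *v x) \<le> norm h * norm x"
proof -
  have "norm ((h *v x) $ i) \<le> norm (h $ i) * norm x" for i
  proof -
    have "norm ((h *v x) $ i) \<le> (\<Sum>j\<in>UNIV. \<bar>norm (h $ i $ j)\<bar> * \<bar>norm (x $ j)\<bar>)"
      unfolding matrix_vector_mult_def by (auto intro!: sum_norm_le simp: norm_mult)
    also have "\<dots> \<le> norm (h $ i) * norm x"
      unfolding norm_vec_def by (rule L2_set_mult_ineq)
    finally show ?thesis .
  qed
  then have "norm (h *v x) \<le> L2_set (\<lambda>i. norm (h $ i) * norm x) UNIV"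
    unfolding norm_vec_def[of "h *v x"] by (intro L2_set_mono) auto
  then show ?thesis
    by (simp add: L2_set_left_distrib[symmetric] norm_vec_def[of h])
qed

lemma linear_matrix_vector_mult: "linear ((*v) (h :: complex ^ 'm::finite ^ 'k::finite))"
  by (rule linearI)
    (simp_all add: vec_eq_iff matrix_vector_mult_def scaleR_sum_right distrib_left sum.distrib)

lemma measurable_matrix_vector_mult [measurable]:
  "(*v) (h :: complex ^ 'm::finite ^ 'k::finite) \<in> borel_measurable borel"
  using linear_matrix_vector_mult
  by (auto intro!: borel_measurable_continuous_onI linear_continuous_on linear_conv_bounded_linear[THEN iffD1])

lemma valid_transmissionD:
  assumes "valid_transmission P N a"
  shows "served a \<subseteq> {..<N}" "0 < duration a" "prob_space (source a)"
    "prob_space.indep_vars (source a) (\<lambda>_. msg_space a) (message a) (served a)"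
    "signal a \<in> source a \<rightarrow>\<^sub>M PiM {..<duration a} (\<lambda>_. borel)"
    "integrable (source a) (\<lambda>\<omega>. \<Sum>t<duration a. (norm (signal a \<omega> t))\<^sup>2)"
    "(\<integral>\<omega>. (\<Sum>t<duration a. (norm (signal a \<omega> t))\<^sup>2) \<partial>source a) \<le> real (duration a) * P"
    "finite (served a)" "k \<in> served a \<Longrightarrow> message a k \<in> source a \<rightarrow>\<^sub>M msg_space a"
  using assms finite_subset[of "served a" "{..<N}"] prob_space.indep_vars_def[of "source a" "\<lambda>_. msg_space a" "message a" "served a"]
  by (auto simp: valid_transmission_def)

text \<open>Restricted to the duration, since points of the product space \<open>PiM\<close> are
  extensional functions.\<close>

definition noiseless ::
  "('m::finite, 'w, 'o) transmission \<Rightarrow> complex ^ 'm ^ 'k::finite \<Rightarrow> 'o \<Rightarrow> nat \<Rightarrow> complex ^ 'k" where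
  "noiseless a h \<omega> = (\<lambda>t\<in>{..<duration a}. h *v signal a \<omega> t)"

lemma noiseless_measurable:
  assumes "valid_transmission P N a"
  shows "noiseless a h \<in> source a \<rightarrow>\<^sub>M PiM {..<duration a} (\<lambda>_. borel)"
proof -
  note [measurable] = valid_transmissionD(5)[OF assms]
  show ?thesis unfolding noiseless_def[abs_def] by measurable
qed

definition output_law ::
  "('m::finite, 'w, 'o) transmission \<Rightarrow> complex ^ 'm ^ 'k::finite \<Rightarrow> ('o \<times> (nat \<Rightarrow> complex ^ 'k)) measure" where
  "output_law a h = density (source a \<Otimes>\<^sub>M PiM {..<duration a} (\<lambda>_. lborel))
     (\<lambda>(\<omega>, y). ennreal (gauss_vec {..<duration a} (noiseless a h \<omega>) y))"

text \<open>Signal plus noise maps source and noise to source and received block, with image law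
  \<open>output_law\<close>; the three laws in the definition of mutual information are images of
  it. Passing from \<open>borel\<close> to \<open>lborel\<close> leaves the measurable sets
  unchanged and provides a reference measure for densities.\<close>

lemma user_rate_eq:
  fixes a :: "('m::finite, 'w, 'o) transmission" and h :: "complex ^ 'm ^ 'k::finite"
  assumes a: "valid_transmission P N a" and k: "k \<in> served a"
  defines "Y \<equiv> PiM {..<duration a} (\<lambda>_. lborel :: (complex ^ 'k) measure)"
  shows "user_rate a k h = KL_divergence (exp 1)
      (distr (source a) (msg_space a) (message a k) \<Otimes>\<^sub>M distr (output_law a h) Y snd)
      (distr (output_law a h) (msg_space a \<Otimes>\<^sub>M Y) (\<lambda>(\<omega>, y). (message a k \<omega>, y))) / real (duration a)"
proof -
  let ?I = "{..<duration a}" and ?M = "source a" and ?W = "message a k" and ?D = "msg_space a"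
  let ?G = "density lborel (\<lambda>y::complex ^ 'k. ennreal (gauss 1 y))"
  let ?N = "PiM ?I (\<lambda>_. ?G)" and ?B = "PiM ?I (\<lambda>_. borel :: (complex ^ 'k) measure)"
  interpret M: prob_space ?M by (rule valid_transmissionD[OF a])
  interpret N: product_prob_space "\<lambda>_::nat. ?G" ?I
    by (intro product_prob_spaceI prob_space_gauss) simp
  interpret MN: pair_prob_space ?M ?N ..
  have [measurable]: "?W \<in> ?M \<rightarrow>\<^sub>M ?D" by (rule valid_transmissionD(9)[OF a k])
  note x = noiseless_measurable[OF a, of h]
  note [measurable] = x
  have setsY: "sets Y = sets ?B" unfolding Y_def by (intro sets_PiM_cong) auto
  note [measurable_cong] = sets_PiM_cong[OF refl, of ?I "\<lambda>_. ?G" "\<lambda>_. borel", simplified] setsY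
  let ?m = "\<lambda>(\<omega>, n). (\<omega>, \<lambda>i\<in>?I. noiseless a h \<omega> i + n i)"
  have m: "?m \<in> ?M \<Otimes>\<^sub>M ?N \<rightarrow>\<^sub>M ?M \<Otimes>\<^sub>M ?B" by measurable
  have out: "output_law a h = distr (?M \<Otimes>\<^sub>M ?N) (?M \<Otimes>\<^sub>M ?B) ?m"
    unfolding distr_signal_plus_noise[OF finite_lessThan M.sigma_finite_measure_axioms x]
    by (simp add: output_law_def split_beta')
  have rec: "received h (duration a) (signal a \<omega>) z = (\<lambda>i\<in>?I. noiseless a h \<omega> i + z i)" for \<omega> z
    by (auto simp: received_def noiseless_def restrict_def)
  have 1: "distr (?M \<Otimes>\<^sub>M ?N) ?D (\<lambda>(\<omega>, z). ?W \<omega>) = distr ?M ?D ?W"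
  proof -
    have "distr ?M ?D ?W = distr (distr (?M \<Otimes>\<^sub>M ?N) ?M fst) ?D ?W"
      by (simp only: N.P.distr_pair_fst)
    also have "\<dots> = distr (?M \<Otimes>\<^sub>M ?N) ?D (?W \<circ> fst)"
      by (rule distr_distr) measurable
    finally show ?thesis by (simp add: comp_def split_beta')
  qed
  have 2: "distr (?M \<Otimes>\<^sub>M ?N) ?B (\<lambda>(\<omega>, z). received h (duration a) (signal a \<omega>) z) = distr (output_law a h) Y snd"
  proof -
    have "distr (output_law a h) Y snd = distr (output_law a h) ?B snd"
      by (intro distr_cong setsY) auto
    also have "\<dots> = distr (?M \<Otimes>\<^sub>M ?N) ?B (snd \<circ> ?m)"
      unfolding out by (rule distr_distr[OF _ m]) measurable
    finally show ?thesis by (simp add: comp_def split_beta' rec)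
  qed
  have 3: "distr (?M \<Otimes>\<^sub>M ?N) (?D \<Otimes>\<^sub>M ?B) (\<lambda>x. ((case x of (\<omega>, z) \<Rightarrow> ?W \<omega>), (case x of (\<omega>, z) \<Rightarrow> received h (duration a) (signal a \<omega>) z)))
      = distr (output_law a h) (?D \<Otimes>\<^sub>M Y) (\<lambda>(\<omega>, y). (?W \<omega>, y))"
  proof -
    have "distr (output_law a h) (?D \<Otimes>\<^sub>M Y) (\<lambda>(\<omega>, y). (?W \<omega>, y)) = distr (output_law a h) (?D \<Otimes>\<^sub>M ?B) (\<lambda>(\<omega>, y). (?W \<omega>, y))"
      by (intro distr_cong sets_pair_measure_cong setsY) auto
    also have "\<dots> = distr (?M \<Otimes>\<^sub>M ?N) (?D \<Otimes>\<^sub>M ?B) ((\<lambda>(\<omega>, y). (?W \<omega>, y)) \<circ> ?m)"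
      unfolding out by (rule distr_distr[OF _ m]) measurable
    finally show ?thesis by (simp add: comp_def split_beta' rec)
  qed
  have "prob_space (?M \<Otimes>\<^sub>M ?N)" by (rule MN.P.prob_space_axioms)
  then show ?thesis
    unfolding user_rate_def noise_law_eq by (simp only: prob_space.mutual_information_def 1 2 3)
qed

lemma prob_space_output_law:
  assumes a: "valid_transmission P N a"
  shows "prob_space (output_law a (h :: complex ^ 'm::finite ^ 'k::finite))"
proof -
  let ?I = "{..<duration a}" and ?M = "source a"
  let ?G = "density lborel (\<lambda>y::complex ^ 'k. ennreal (gauss 1 y))"
  let ?N = "PiM ?I (\<lambda>_. ?G)" and ?B = "PiM ?I (\<lambda>_. borel :: (complex ^ 'k) measure)"
  interpret M: prob_space ?M by (rule valid_transmissionD[OF a])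
  interpret N: product_prob_space "\<lambda>_::nat. ?G" ?I
    by (intro product_prob_spaceI prob_space_gauss) simp
  interpret MN: pair_prob_space ?M ?N ..
  note x = noiseless_measurable[OF a, of h]
  note [measurable] = x
  note [measurable_cong] = sets_PiM_cong[OF refl, of ?I "\<lambda>_. ?G" "\<lambda>_. borel", simplified]
  have "output_law a h = distr (?M \<Otimes>\<^sub>M ?N) (?M \<Otimes>\<^sub>M ?B) (\<lambda>(\<omega>, n). (\<omega>, \<lambda>i\<in>?I. noiseless a h \<omega> i + n i))"
    unfolding distr_signal_plus_noise[OF finite_lessThan M.sigma_finite_measure_axioms x]
    by (simp add: output_law_def split_beta')
  also have "prob_space \<dots>" by (rule MN.P.prob_space_distr) measurable
  finally show ?thesis .
qed

lemma user_rate_nonneg: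
  fixes h :: "complex ^ 'm::finite ^ 'k::finite"
  assumes a: "valid_transmission P N a" and k: "k \<in> served a"
  shows "0 \<le> user_rate a k h"
proof -
  let ?I = "{..<duration a}" and ?M = "source a" and ?W = "message a k" and ?D = "msg_space a"
  let ?Y = "PiM ?I (\<lambda>_. lborel :: (complex ^ 'k) measure)"
  interpret M: prob_space ?M by (rule valid_transmissionD[OF a])
  interpret O: prob_space "output_law a h" by (rule prob_space_output_law[OF a])
  have [measurable]: "?W \<in> ?M \<rightarrow>\<^sub>M ?D" by (rule valid_transmissionD(9)[OF a k])
  have [measurable_cong]: "sets (output_law a h) = sets (?M \<Otimes>\<^sub>M ?Y)"
    by (simp add: output_law_def)
  interpret PW: prob_space "distr ?M ?D ?W" by (rule M.prob_space_distr) measurable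
  interpret PY: prob_space "distr (output_law a h) ?Y snd" by (rule O.prob_space_distr) measurable
  interpret PP: pair_prob_space "distr ?M ?D ?W" "distr (output_law a h) ?Y snd" ..
  have Q: "prob_space (distr (output_law a h) (?D \<Otimes>\<^sub>M ?Y) (\<lambda>(\<omega>, y). (?W \<omega>, y)))"
    by (rule O.prob_space_distr) measurable
  have sets: "sets (distr (output_law a h) (?D \<Otimes>\<^sub>M ?Y) (\<lambda>(\<omega>, y). (?W \<omega>, y)))
      = sets (distr ?M ?D ?W \<Otimes>\<^sub>M distr (output_law a h) ?Y snd)"
    by (simp cong: sets_pair_measure_cong)
  have "0 \<le> KL_divergence (exp 1) (distr ?M ?D ?W \<Otimes>\<^sub>M distr (output_law a h) ?Y snd)
      (distr (output_law a h) (?D \<Otimes>\<^sub>M ?Y) (\<lambda>(\<omega>, y). (?W \<omega>, y)))"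
    by (rule KL_divergence_prob_nonneg[OF PP.P.prob_space_axioms Q sets]) simp
  then show ?thesis
    unfolding user_rate_eq[OF a k] by (intro divide_nonneg_nonneg) simp_all
qed

text \<open>Applies the general kernel to the strict contraction h/\<rho>, which sends \<rho> x to h
  x.\<close>

lemma matrix_degradation_kernel:
  fixes h :: "complex ^ 'm::finite ^ 'k::finite"
  assumes "0 < \<rho>" and h: "norm h < \<rho>"
  obtains \<kappa> :: "complex ^ 'm \<Rightarrow> complex ^ 'k \<Rightarrow> real"
  where "(\<lambda>(z, y). \<kappa> z y) \<in> borel_measurable borel"
    and "\<And>z y. \<kappa> z y > 0"
    and "\<And>z. (\<integral>\<^sup>+y. \<kappa> z y \<partial>lborel) = 1"
    and "\<And>x y. (\<integral>\<^sup>+z. ennreal (gauss 1 (z - \<rho> *\<^sub>R x)) * \<kappa> z y \<partial>lborel) = gauss 1 (y - h *v x)"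
proof -
  define A where "A x = (1 / \<rho>) *\<^sub>R (h *v x)" for x
  have lin: "linear A"
    unfolding A_def by (intro linear_compose_scale_right linear_matrix_vector_mult)
  have bound: "norm (A x) \<le> (norm h / \<rho>) * norm x" for x
    using norm_matrix_vector_mult_le[of h x] \<open>0 < \<rho>\<close> by (simp add: A_def divide_right_mono)
  have c: "0 \<le> norm h / \<rho>" "norm h / \<rho> < 1" using assms by auto
  have A\<rho>: "A (\<rho> *\<^sub>R x) = h *v x" for x
    using \<open>0 < \<rho>\<close> by (simp add: A_def linear_scale[OF linear_matrix_vector_mult])
  show thesis
  proof (rule gaussian_degradation_kernel[OF lin bound c])
    fix \<kappa> :: "complex ^ 'm \<Rightarrow> complex ^ 'k \<Rightarrow> real"
    assume \<kappa>: "(\<lambda>(z, y). \<kappa> z y) \<in> borel_measurable borel" "\<And>z y. \<kappa> z y > 0"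
      "\<And>z. (\<integral>\<^sup>+y. \<kappa> z y \<partial>lborel) = 1"
      "\<And>x y. (\<integral>\<^sup>+z. ennreal (gauss 1 (z - x)) * \<kappa> z y \<partial>lborel) = gauss 1 (y - A x)"
    have "(\<integral>\<^sup>+z. ennreal (gauss 1 (z - \<rho> *\<^sub>R x)) * \<kappa> z y \<partial>lborel) = gauss 1 (y - h *v x)" for x y
      by (simp only: \<kappa>(4) A\<rho>)
    then show thesis by (intro that[of \<kappa>] \<kappa>(1-3))
  qed
qed

text \<open>The users' kernels start from the same enhanced block, so
  \<open>sum_information_le\<close> bounds the total by the relative entropy of that block from a
  Gaussian reference law, and the power constraint bounds the latter.\<close>

lemma sum_user_rate_le:
  fixes a :: "('m::finite, 'w, 'o) transmission" and H :: "nat \<Rightarrow> complex ^ 'm ^ 'k::finite"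
  assumes a: "valid_transmission P N a" and P: "0 < P" and \<rho>: "0 < \<rho>"
    and H: "\<And>k. k \<in> served a \<Longrightarrow> norm (H k) < \<rho>"
  shows "(\<Sum>k\<in>served a. user_rate a k (H k)) \<le> CARD('m) * ln (1 + \<rho>\<^sup>2 * P / CARD('m))"
proof -
  define I where "I = {..<duration a}"
  let ?M = "source a" and ?D = "msg_space a"
  define Z where "Z = PiM I (\<lambda>_. lborel :: (complex ^ 'm) measure)"
  define Y where "Y = PiM I (\<lambda>_. lborel :: (complex ^ 'k) measure)"
  have I: "finite I" "card I = duration a" by (auto simp: I_def)
  note aD = valid_transmissionD[OF a]
  interpret M: prob_space ?M by (rule aD)
  interpret LZ: product_sigma_finite "\<lambda>_::nat. lborel :: (complex ^ 'm) measure" by standard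
  interpret LY: product_sigma_finite "\<lambda>_::nat. lborel :: (complex ^ 'k) measure" by standard
  have sfZ: "sigma_finite_measure Z" and sfY: "sigma_finite_measure Y"
    unfolding Z_def Y_def by (auto intro!: LZ.sigma_finite LY.sigma_finite I)
  have setsZ [measurable_cong]: "sets Z = sets (PiM I (\<lambda>_. borel))"
    unfolding Z_def by (intro sets_PiM_cong) auto
  have setsY [measurable_cong]: "sets Y = sets (PiM I (\<lambda>_. borel))"
    unfolding Y_def by (intro sets_PiM_cong) auto
  have signal [measurable]: "signal a \<in> ?M \<rightarrow>\<^sub>M PiM I (\<lambda>_. borel)"
    using aD(5) by (simp add: I_def)
  \<comment> \<open>The variance that the enhanced signal plus noise has per complex dimension when
    the power P is spread evenly over the antennas.\<close>
  define v where "v = 1 + \<rho>\<^sup>2 * P / CARD('m)"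
  have v: "v > 1" using P \<rho> by (simp add: v_def)
  define x where "x \<omega> = (\<lambda>t\<in>I. \<rho> *\<^sub>R signal a \<omega> t)" for \<omega>
  have x [measurable]: "x \<in> ?M \<rightarrow>\<^sub>M PiM I (\<lambda>_. borel)"
    unfolding x_def[abs_def] by measurable
  have x_energy: "(\<Sum>t\<in>I. (norm (x \<omega> t))\<^sup>2) = \<rho>\<^sup>2 * (\<Sum>t\<in>I. (norm (signal a \<omega> t))\<^sup>2)" for \<omega>
    using \<rho> by (simp add: x_def sum_distrib_left power_mult_distrib cong: sum.cong)
  have x_int: "integrable ?M (\<lambda>\<omega>. \<Sum>t\<in>I. (norm (x \<omega> t))\<^sup>2)"
    unfolding x_energy using aD(6) by (simp add: I_def)
  have x_le: "M.expectation (\<lambda>\<omega>. \<Sum>t\<in>I. (norm (x \<omega> t))\<^sup>2) \<le> \<rho>\<^sup>2 * (card I * P)"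
    unfolding x_energy using mult_left_mono[OF aD(7), of "\<rho>\<^sup>2"] by (simp add: I_def)
  define g where "g \<omega> z = gauss_vec I (x \<omega>) z" for \<omega> z
  define q where "q z = (\<Prod>t\<in>I. gauss v (z t :: complex ^ 'm))" for z
  have energy: "integrable (?M \<Otimes>\<^sub>M Z) (\<lambda>(\<omega>, z). g \<omega> z * ln (g \<omega> z / q z))"
    "(\<integral>p. (case p of (\<omega>, z) \<Rightarrow> g \<omega> z * ln (g \<omega> z / q z)) \<partial>(?M \<Otimes>\<^sub>M Z))
      = card I * (DIM(complex ^ 'm) / 2) * (ln v + 1 / v - 1) + M.expectation (\<lambda>\<omega>. \<Sum>t\<in>I. (norm (x \<omega> t))\<^sup>2) / v"
    unfolding g_def q_def Z_def using M.gauss_vec_energy[OF I(1) x x_int, of v] v by simp_all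
  \<comment> \<open>For this v the energy term is at most n M (1 - 1/v), with n the duration and M
    the number of antennas; it cancels n M (1/v - 1) and leaves n M ln v.\<close>
  have energy_le: "(\<integral>p. (case p of (\<omega>, z) \<Rightarrow> g \<omega> z * ln (g \<omega> z / q z)) \<partial>(?M \<Otimes>\<^sub>M Z))
    \<le> card I * CARD('m) * ln v"
  proof -
    have "M.expectation (\<lambda>\<omega>. \<Sum>t\<in>I. (norm (x \<omega> t))\<^sup>2) / v \<le> \<rho>\<^sup>2 * (card I * P) / v"
      using x_le v by (intro divide_right_mono) auto
    moreover have "\<rho>\<^sup>2 * (card I * P) / v = card I * CARD('m) * (1 - 1 / v)"
    proof -
      have "\<rho>\<^sup>2 * P = CARD('m) * (v - 1)" by (simp add: v_def)
      then have "\<rho>\<^sup>2 * (card I * P) / v = card I * (CARD('m) * (v - 1)) / v"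
        by (simp add: mult.left_commute)
      then show ?thesis using v by (simp add: field_simps)
    qed
    ultimately show ?thesis unfolding energy(2) by (simp add: algebra_simps)
  qed
  \<comment> \<open>A kernel is chosen for every k at once; users that are not served get the
    constant 1, so that positivity holds for all k.\<close>
  define good where "good k \<kappa> \<longleftrightarrow> (\<forall>z y. 0 < \<kappa> z y) \<and> (k \<in> served a \<longrightarrow>
    (\<lambda>(z, y). \<kappa> z y) \<in> borel_measurable borel \<and> (\<forall>z. (\<integral>\<^sup>+y. ennreal (\<kappa> z y) \<partial>lborel) = 1) \<and>
    (\<forall>x y. (\<integral>\<^sup>+z. ennreal (gauss 1 (z - \<rho> *\<^sub>R x)) * ennreal (\<kappa> z y) \<partial>lborel) = ennreal (gauss 1 (y - H k *v x))))"
    for k and \<kappa> :: "complex ^ 'm \<Rightarrow> complex ^ 'k \<Rightarrow> real"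
  have "\<forall>k. \<exists>\<kappa>. good k \<kappa>"
  proof
    fix k
    show "\<exists>\<kappa>. good k \<kappa>"
    proof (cases "k \<in> served a")
      case True
      show ?thesis
        by (rule matrix_degradation_kernel[OF \<rho> H[OF True]]) (auto simp: good_def)
    next
      case False
      then show ?thesis by (intro exI[of _ "\<lambda>_ _. 1"]) (simp add: good_def)
    qed
  qed
  from choice[OF this] obtain \<kappa> where \<kappa>: "\<And>k. good k (\<kappa> k)" by blast
  have \<kappa>_pos: "0 < \<kappa> k z y" for k z y
    using \<kappa>[of k] by (simp add: good_def)
  have \<kappa>_meas [measurable]: "(\<lambda>(z, y). \<kappa> k z y) \<in> borel_measurable (borel \<Otimes>\<^sub>M borel)" if "k \<in> served a" for k
    using \<kappa>[of k] that by (simp add: good_def borel_prod)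
  have \<kappa>_1: "(\<integral>\<^sup>+y. \<kappa> k z y \<partial>lborel) = 1" if "k \<in> served a" for k z
    using \<kappa>[of k] that by (simp add: good_def)
  have \<kappa>_deg: "(\<integral>\<^sup>+z. ennreal (gauss 1 (z - \<rho> *\<^sub>R x)) * \<kappa> k z y \<partial>lborel) = gauss 1 (y - H k *v x)" if "k \<in> served a" for k x y
    using \<kappa>[of k] that by (simp add: good_def)
  \<comment> \<open>Degradation without memory: the one-use kernel acts separately at each
    time.\<close>
  define \<kappa>v where "\<kappa>v k z y = (\<Prod>t\<in>I. \<kappa> k (z t) (y t))" for k z y
  define f where "f k \<omega> y = gauss_vec I (noiseless a (H k) \<omega>) y" for k \<omega> y
  define out where "out k = density (?M \<Otimes>\<^sub>M Y) (\<lambda>(\<omega>, y). ennreal (f k \<omega> y))" for k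
  have out: "output_law a (H k) = out k" for k
    unfolding output_law_def out_def f_def Y_def I_def ..
  define PP where "PP k = distr ?M ?D (message a k) \<Otimes>\<^sub>M distr (out k) Y snd" for k
  define Q where "Q k = distr (out k) (?D \<Otimes>\<^sub>M Y) (\<lambda>(\<omega>, y). (message a k \<omega>, y))" for k
  define R where "R k w y = enn2real (RN_deriv (PP k) (Q k) (w, y))" for k w y
  have rate: "user_rate a k (H k) = KL_divergence (exp 1) (PP k) (Q k) / duration a" if "k \<in> served a" for k
    using user_rate_eq[OF a that, of "H k"] unfolding PP_def Q_def out Y_def I_def .
  \<comment> \<open>Users with divergence 0 add nothing to the sum, and for the remaining ones
    \<open>KL_divergence_kernel\<close> applies.\<close>
  define S where "S = {k \<in> served a. KL_divergence (exp 1) (PP k) (Q k) \<noteq> 0}"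
  have S: "k \<in> served a" "KL_divergence (exp 1) (PP k) (Q k) \<noteq> 0" if "k \<in> S" for k
    using that by (auto simp: S_def)
  have f_meas: "(\<lambda>(\<omega>, y). f k \<omega> y) \<in> borel_measurable (?M \<Otimes>\<^sub>M Y)" for k
    unfolding f_def Y_def by (rule gauss_vec_measurable[OF I(1)]) (use noiseless_measurable[OF a] in \<open>simp add: I_def\<close>)
  have f_pos: "0 < f k \<omega> y" for k \<omega> y by (simp add: f_def gauss_vec_pos)
  have f_1: "(\<integral>\<^sup>+y. f k \<omega> y \<partial>Y) = 1" for k \<omega>
    unfolding f_def Y_def by (rule nn_integral_gauss_vec[OF I(1)])
  note kern = M.KL_divergence_kernel[where f = "f k" and W = "message a k" and D = ?D for k,
      OF sfY aD(9) f_meas f_pos f_1, folded out_def, folded PP_def Q_def, folded R_def]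
  have KL: "KL_divergence (exp 1) (PP k) (Q k) = (\<integral>p. (case p of (\<omega>, y) \<Rightarrow> f k \<omega> y * ln (R k (message a k \<omega>) y)) \<partial>(?M \<Otimes>\<^sub>M Y))"
    if "k \<in> S" for k
    by (rule kern(5)) (use S[OF that] in auto)
  have "(\<Sum>k\<in>served a. user_rate a k (H k)) = (\<Sum>k\<in>served a. KL_divergence (exp 1) (PP k) (Q k)) / card I"
    by (simp add: sum_divide_distrib I(2) rate)
  also have "(\<Sum>k\<in>served a. KL_divergence (exp 1) (PP k) (Q k)) = (\<Sum>k\<in>S. KL_divergence (exp 1) (PP k) (Q k))"
    using aD(8) by (intro sum.mono_neutral_right) (auto simp: S_def)
  also have "\<dots> = (\<Sum>k\<in>S. \<integral>p. (case p of (\<omega>, y) \<Rightarrow> f k \<omega> y * ln (R k (message a k \<omega>) y)) \<partial>(?M \<Otimes>\<^sub>M Y))"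
    by (intro sum.cong refl KL)
  also have "\<dots> \<le> (\<integral>p. (case p of (\<omega>, z) \<Rightarrow> g \<omega> z * ln (g \<omega> z / q z)) \<partial>(?M \<Otimes>\<^sub>M Z))"
  proof (rule M.sum_information_le[where \<kappa> = \<kappa>v and D = ?D])
    show "sigma_finite_measure Z" "sigma_finite_measure Y" by (rule sfZ sfY)+
    show "finite S" using aD(8) by (simp add: S_def)
    show "M.indep_vars (\<lambda>_. ?D) (message a) S"
      by (rule M.indep_vars_subset[OF aD(4)]) (auto simp: S_def)
    show "(\<lambda>(\<omega>, z). g \<omega> z) \<in> borel_measurable (?M \<Otimes>\<^sub>M Z)"
      unfolding g_def Z_def by (rule gauss_vec_measurable[OF I(1) x])
    show "q \<in> borel_measurable Z" unfolding q_def by measurable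
    show "(\<lambda>(z, y). \<kappa>v k z y) \<in> borel_measurable (Z \<Otimes>\<^sub>M Y)" if "k \<in> S" for k
    proof -
      have [measurable]: "k \<in> served a" using S that by blast
      show ?thesis unfolding \<kappa>v_def by measurable
    qed
    show "(\<lambda>(w, y). R k w y) \<in> borel_measurable (?D \<Otimes>\<^sub>M Y)" if "k \<in> S" for k
      by (rule kern(1)) (use S[OF that] in auto)
    show "0 < g \<omega> z" for \<omega> z by (simp add: g_def gauss_vec_pos)
    show "0 < q z" for z using v by (auto simp: q_def intro!: prod_pos gauss_pos)
    show "0 < \<kappa>v k z y" for k z y by (auto simp: \<kappa>v_def intro!: prod_pos \<kappa>_pos)
    show "0 \<le> R k w y" for k w y by (simp add: R_def)
    show "0 \<le> f k \<omega> y" for k \<omega> y using f_pos less_imp_le by blast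
    show "(\<integral>\<^sup>+z. g \<omega> z \<partial>Z) = 1" for \<omega>
      unfolding g_def Z_def by (rule nn_integral_gauss_vec[OF I(1)])
    show "(\<integral>\<^sup>+z. q z \<partial>Z) = 1"
    proof -
      have "(\<integral>\<^sup>+z. q z \<partial>Z) = (\<integral>\<^sup>+z. (\<Prod>t\<in>I. ennreal (gauss v (z t))) \<partial>Z)"
        using v by (simp add: q_def prod_ennreal gauss_pos less_imp_le)
      also have "\<dots> = (\<Prod>t\<in>I. \<integral>\<^sup>+z. gauss v (z::complex ^ 'm) \<partial>lborel)"
        unfolding Z_def by (rule LZ.product_nn_integral_prod[OF I(1)]) simp
      also have "\<dots> = 1" using v by (simp add: nn_integral_gauss)
      finally show ?thesis .
    qed
    show "(\<integral>\<^sup>+y. \<kappa>v k z y \<partial>Y) = 1" if "k \<in> S" for k z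
    proof -
      have k [measurable]: "k \<in> served a" using S that by blast
      have "(\<integral>\<^sup>+y. \<kappa>v k z y \<partial>Y) = (\<integral>\<^sup>+y. (\<Prod>t\<in>I. ennreal (\<kappa> k (z t) (y t))) \<partial>Y)"
        by (simp add: \<kappa>v_def prod_ennreal \<kappa>_pos less_imp_le)
      also have "\<dots> = (\<Prod>t\<in>I. \<integral>\<^sup>+y. \<kappa> k (z t) y \<partial>lborel)"
        unfolding Y_def by (rule LY.product_nn_integral_prod[OF I(1)]) simp
      finally show ?thesis by (simp add: \<kappa>_1[OF k])
    qed
    show "(\<integral>\<^sup>+z. ennreal (g \<omega> z) * \<kappa>v k z y \<partial>Z) = ennreal (f k \<omega> y)" if "k \<in> S" for k \<omega> y
    proof -
      have k [measurable]: "k \<in> served a" using S that by blast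
      have "ennreal (g \<omega> z) * \<kappa>v k z y = (\<Prod>t\<in>I. ennreal (gauss 1 (z t - x \<omega> t)) * \<kappa> k (z t) (y t))" for z
        by (simp add: g_def gauss_vec_def \<kappa>v_def prod.distrib prod_ennreal \<kappa>_pos gauss_pos less_imp_le)
      then have "(\<integral>\<^sup>+z. ennreal (g \<omega> z) * \<kappa>v k z y \<partial>Z) = (\<integral>\<^sup>+z. (\<Prod>t\<in>I. ennreal (gauss 1 (z t - x \<omega> t)) * \<kappa> k (z t) (y t)) \<partial>Z)"
        by simp
      also have "\<dots> = (\<Prod>t\<in>I. \<integral>\<^sup>+z. ennreal (gauss 1 (z - x \<omega> t)) * \<kappa> k z (y t) \<partial>lborel)"
        unfolding Z_def by (rule LZ.product_nn_integral_prod[OF I(1)]) simp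
      also have "\<dots> = (\<Prod>t\<in>I. ennreal (gauss 1 (y t - noiseless a (H k) \<omega> t)))"
        by (intro prod.cong refl) (simp add: x_def \<kappa>_deg[OF k] noiseless_def I_def)
      finally show ?thesis
        by (simp add: f_def gauss_vec_def prod_ennreal gauss_pos less_imp_le)
    qed
    show "AE y in Y. (\<integral>\<^sup>+\<omega>. R k (message a k \<omega>) y \<partial>?M) \<le> 1" if "k \<in> S" for k
      by (rule kern(2)) (use S[OF that] in auto)
    show "AE p in ?M \<Otimes>\<^sub>M Y. 0 < R k (message a k (fst p)) (snd p)" if "k \<in> S" for k
      by (rule kern(3)) (use S[OF that] in auto)
    show "integrable (?M \<Otimes>\<^sub>M Y) (\<lambda>(\<omega>, y). f k \<omega> y * ln (R k (message a k \<omega>) y))" if "k \<in> S" for k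
      by (rule kern(4)) (use S[OF that] in auto)
    show "integrable (?M \<Otimes>\<^sub>M Z) (\<lambda>(\<omega>, z). g \<omega> z * ln (g \<omega> z / q z))" by (rule energy)
  qed
  also have "\<dots> \<le> card I * CARD('m) * ln v" by (rule energy_le)
  finally show ?thesis
    using aD(2) by (simp add: divide_right_mono I(2) v_def mult.assoc)
qed

section \<open>Determinants and positive semidefinite matrices\<close>

lemma det_replace_identity_row:
  fixes d :: "'a::field ^ 'n::finite"
  shows "det (\<chi> i. if i = k then d else mat 1 $ i) = d $ k"
proof -
  have d: "(\<Sum>i\<in>UNIV. d $ i *s row i (mat 1)) = d"
    by (simp add: vec_eq_iff row_def mat_def if_distrib[of "(*) _"] sum.delta' cong: if_cong)
  have "(\<chi> i. if i = k then d else mat 1 $ i) = (\<chi> i. if i = k then \<Sum>i\<in>UNIV. d $ i *s row i (mat 1) else row i (mat 1))"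
    unfolding d by (simp add: vec_eq_iff row_def)
  then show ?thesis
    using cramer_lemma_transpose[of k d "mat 1 :: 'a ^ 'n ^ 'n"] by simp
qed

text \<open>By linearity in row j, the added multiple of \<open>d\<close> contributes a determinant
  with rows j and k equal, so each step of the induction over \<open>S\<close> leaves the value
  unchanged.\<close>

lemma det_identity_plus_rank_one_row:
  fixes d :: "'a::field ^ 'n::finite"
  assumes "finite S" "k \<notin> S"
  shows "det (\<chi> i. if i = k then d else mat 1 $ i + (if i \<in> S then c i *s d else 0)) = d $ k"
  using assms
proof (induction S)
  case empty
  then show ?case
    using det_replace_identity_row[of k d] by (simp cong: if_cong)
next
  case (insert j S)
  let ?f = "\<lambda>i. if i = k then d else mat 1 $ i + (if i \<in> S then c i *s d else 0)"
  have jk: "j \<noteq> k" using insert by auto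
  have "det (\<chi> i. if i = k then d else mat 1 $ i + (if i \<in> insert j S then c i *s d else 0))
      = det (\<chi> i. if i = j then ?f i + c i *s d else ?f i)"
    by (rule arg_cong[where f = det]) (use insert jk in \<open>simp add: vec_eq_iff\<close>)
  also have "\<dots> = det (\<chi> i. if i = j then ?f i else ?f i) + det (\<chi> i. if i = j then c i *s d else ?f i)"
    by (rule det_row_add)
  also have "det (\<chi> i. if i = j then c i *s d else ?f i) = det (\<chi> i. if i = j then c j *s d else ?f i)"
    by (rule arg_cong[where f = det]) (simp add: vec_eq_iff)
  also have "\<dots> = c j * det (\<chi> i. if i = j then d else ?f i)"
    by (rule det_row_mul)
  also have "det (\<chi> i. if i = j then d else ?f i) = 0"
    by (rule det_identical_rows[OF jk]) (use jk in \<open>simp add: row_def vec_eq_iff\<close>)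
  finally show ?case using insert by simp
qed

text \<open>Linearity in one row at a time: row k is either the old row or a multiple of
  \<open>d\<close>, and the second determinant is given by the preceding lemma. This evaluates the
  rate of a single user with one active antenna.\<close>

lemma det_identity_plus_rank_one:
  fixes d :: "'a::field ^ 'n::finite"
  shows "det (\<chi> i j. (if i = j then 1 else 0) + c i * d $ j) = 1 + (\<Sum>i\<in>UNIV. c i * d $ i)"
proof -
  have "det (\<chi> i. mat 1 $ i + (if i \<in> S then c i *s d else 0)) = 1 + (\<Sum>i\<in>S. c i * d $ i)" if "finite S" for S
    using that
  proof (induction S)
    case empty
    then show ?case by simp
  next
    case (insert k S)
    let ?f = "\<lambda>i. mat 1 $ i + (if i \<in> S then c i *s d else 0)"
    have "det (\<chi> i. mat 1 $ i + (if i \<in> insert k S then c i *s d else 0))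
        = det (\<chi> i. if i = k then ?f i + c i *s d else ?f i)"
      by (rule arg_cong[where f = det]) (use insert in \<open>simp add: vec_eq_iff\<close>)
    also have "\<dots> = det (\<chi> i. if i = k then ?f i else ?f i) + det (\<chi> i. if i = k then c i *s d else ?f i)"
      by (rule det_row_add)
    also have "det (\<chi> i. if i = k then c i *s d else ?f i) = det (\<chi> i. if i = k then c k *s d else ?f i)"
      by (rule arg_cong[where f = det]) (simp add: vec_eq_iff)
    also have "\<dots> = c k * det (\<chi> i. if i = k then d else ?f i)"
      by (rule det_row_mul)
    also have "det (\<chi> i. if i = k then d else ?f i) = d $ k"
      by (rule det_identity_plus_rank_one_row) (use insert in auto)
    finally show ?case using insert by simp
  qed
  from this[of UNIV] show ?thesis
    by (simp add: mat_def vector_scalar_mult_def[abs_def] plus_vec_def)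
qed

definition hform :: "complex ^ 'k ^ 'k::finite \<Rightarrow> complex ^ 'k \<Rightarrow> complex" where
  "hform A x = (\<Sum>i\<in>UNIV. cnj (x $ i) * (A *v x) $ i)"

lemma psd_alt: "psd A \<longleftrightarrow> herm A = A \<and> (\<forall>x. 0 \<le> Re (hform A x))"
  by (simp add: psd_def hform_def)

lemma hform_double_sum: "hform A x = (\<Sum>i\<in>UNIV. \<Sum>j\<in>UNIV. cnj (x $ i) * A $ i $ j * x $ j)"
  by (simp add: hform_def matrix_vector_mult_def sum_distrib_left mult.assoc)

lemma hform_add: "hform (A + B) x = hform A x + hform B x"
  by (simp add: hform_double_sum algebra_simps sum.distrib)

lemma hform_mat_1: "hform (mat 1) x = complex_of_real ((norm x)\<^sup>2)"
  by (simp add: hform_def norm_vec_def L2_set_def sum_nonneg complex_norm_square mult.commute del: of_real_power)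

lemma herm_add: "herm (A + B) = herm A + herm B"
  by (simp add: herm_def vec_eq_iff)

lemma psd_zero: "psd 0"
  by (simp add: psd_alt hform_double_sum herm_def vec_eq_iff)

lemma psd_add: "psd A \<Longrightarrow> psd B \<Longrightarrow> psd (A + B)"
  by (simp add: psd_alt herm_add hform_add)

lemma psd_sum: "(\<And>i. i \<in> I \<Longrightarrow> psd (A i)) \<Longrightarrow> psd (\<Sum>i\<in>I. A i)"
  by (induction I rule: infinite_finite_induct) (auto intro: psd_zero psd_add)

lemma herm_mult: "herm (A ** B) = herm B ** herm A"
  by (simp add: herm_def matrix_matrix_mult_def vec_eq_iff mult.commute)

lemma herm_herm [simp]: "herm (herm A) = A"
  by (simp add: herm_def vec_eq_iff)

text \<open>The form of the congruence at x is the form of \<open>Q\<close> at H x.\<close>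

lemma psd_congruence:
  assumes "psd Q"
  shows "psd (herm H ** Q ** H)"
proof -
  have hv: "(herm H *v y) $ i = (\<Sum>k\<in>UNIV. cnj (H $ k $ i) * y $ k)" for y i
    by (simp add: matrix_vector_mult_def herm_def)
  have "hform (herm H ** Q ** H) x = hform Q (H *v x)" for x
  proof -
    have "hform (herm H ** Q ** H) x = (\<Sum>i\<in>UNIV. cnj (x $ i) * (herm H *v (Q *v (H *v x))) $ i)"
      by (simp add: hform_def matrix_vector_mul_assoc matrix_mul_assoc)
    also have "\<dots> = (\<Sum>i\<in>UNIV. \<Sum>k\<in>UNIV. cnj (x $ i) * cnj (H $ k $ i) * (Q *v (H *v x)) $ k)"
      by (simp add: hv sum_distrib_left mult.assoc)
    also have "\<dots> = (\<Sum>k\<in>UNIV. \<Sum>i\<in>UNIV. cnj (x $ i) * cnj (H $ k $ i) * (Q *v (H *v x)) $ k)"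
      by (rule sum.swap)
    also have "\<dots> = hform Q (H *v x)"
      by (simp add: hform_def matrix_vector_mult_def[of H] sum_distrib_right mult.commute)
    finally show ?thesis .
  qed
  then show ?thesis
    using assms by (simp add: psd_alt herm_mult matrix_mul_assoc)
qed

lemma det_herm: "det (herm A) = cnj (det A)"
proof -
  have "herm A = transpose (\<chi> i j. cnj (A $ i $ j))"
    by (simp add: herm_def transpose_def vec_eq_iff)
  then have "det (herm A) = det (\<chi> i j. cnj (A $ i $ j))"
    by (simp add: det_transpose)
  also have "\<dots> = cnj (det A)"
    by (simp add: det_def)
  finally show ?thesis .
qed

text \<open>The form of I + A at x is at least the squared norm of x, so the kernel is trivial, and
  the determinant of a Hermitian matrix is real. Nonvanishing is what continuity of the logarithm at
  admissible covariances requires.\<close>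

lemma Re_det_identity_plus_psd_nonzero:
  assumes "psd A"
  shows "Re (det (mat 1 + A)) \<noteq> 0"
proof -
  have "x = 0" if "(mat 1 + A) *v x = 0" for x
  proof -
    have "hform (mat 1 + A) x = 0" by (simp add: hform_def that)
    then have "(norm x)\<^sup>2 + Re (hform A x) = 0"
      by (simp add: hform_add hform_mat_1 complex_eq_iff)
    moreover have "0 \<le> Re (hform A x)" using assms by (simp add: psd_alt)
    moreover have "0 \<le> (norm x)\<^sup>2" by simp
    ultimately have "(norm x)\<^sup>2 = 0" by linarith
    then show ?thesis by simp
  qed
  then have "invertible (mat 1 + A)"
    using matrix_left_invertible_ker invertible_left_inverse by blast
  then have "det (mat 1 + A) \<noteq> 0" by (simp add: invertible_det_nz)
  moreover have "herm (mat 1 + A) = mat 1 + A"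
    using assms by (simp add: herm_add psd_alt) (simp add: herm_def mat_def vec_eq_iff)
  then have "Im (det (mat 1 + A)) = 0"
    using det_herm[of "mat 1 + A"] by (simp add: complex_eq_iff)
  ultimately show ?thesis by (simp add: complex_eq_iff)
qed

lemma matrix_vector_mult_axis: "(A *v axis i 1) $ k = (A $ k $ i :: 'a::semiring_1)"
  by (simp add: matrix_vector_mult_def axis_def if_distrib[of "(*) _"] cong: if_cong)

lemma psd_diagonal:
  assumes "psd A"
  shows "A $ i $ i = complex_of_real (Re (A $ i $ i))" and "0 \<le> Re (A $ i $ i)"
proof -
  have "cnj (A $ i $ i) = A $ i $ i"
    using assms by (auto simp: psd_alt herm_def vec_eq_iff)
  then show "A $ i $ i = complex_of_real (Re (A $ i $ i))" by (simp add: complex_eq_iff)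
  have "hform A (axis i 1) = A $ i $ i"
    unfolding hform_def matrix_vector_mult_axis
    by (simp add: axis_def if_distrib[of cnj] if_distrib[of "\<lambda>x. x * _"] cong: if_cong)
  then show "0 \<le> Re (A $ i $ i)" using assms by (auto simp: psd_alt dest: spec[of _ "axis i 1"])
qed

text \<open>Testing the form on e_i + c e_j with a suitable phase c bounds twice the modulus of an
  off-diagonal entry by the sum of two diagonal entries, each at most the trace. This makes the
  admissible covariances uniformly bounded.\<close>

lemma psd_entry_le:
  assumes A: "psd A"
  shows "cmod (A $ i $ j) \<le> Re (trace A)"
proof -
  have diag: "Re (A $ k $ k) \<le> Re (trace A)" for k
    unfolding trace_def Re_sum using psd_diagonal(2)[OF A] by (intro member_le_sum) auto
  show ?thesis
  proof (cases "i = j \<or> A $ i $ j = 0")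
    case True
    then show ?thesis
      using diag[of i] psd_diagonal[OF A, of i] by (auto simp: cmod_def complex_eq_iff intro: order_trans)
  next
    case False
    \<comment> \<open>The phase that makes both cross terms equal to minus the modulus of the
      entry.\<close>
    define c where "c = - cnj (A $ i $ j) / cmod (A $ i $ j)"
    have c: "c * A $ i $ j = - cmod (A $ i $ j)" "cnj c * c = 1"
      using False complex_norm_square[of "A $ i $ j"]
      by (simp_all add: c_def power2_eq_square field_simps)
    have ji: "A $ j $ i = cnj (A $ i $ j)"
      using A by (auto simp: psd_alt herm_def vec_eq_iff)
    define x where "x = axis i 1 + c *s axis j 1"
    have Ax: "(A *v x) $ k = A $ k $ i + c * A $ k $ j" for k
      by (simp add: x_def matrix_vector_right_distrib vec.scale matrix_vector_mult_axis)
    have "hform A x = (\<Sum>k\<in>UNIV. (if k = i then (A *v x) $ k else 0) + (if k = j then cnj c * (A *v x) $ k else 0))"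
      unfolding hform_def by (rule sum.cong[OF refl]) (use False in \<open>auto simp: x_def axis_def\<close>)
    also have "\<dots> = (A *v x) $ i + cnj c * (A *v x) $ j"
      by (simp add: sum.distrib)
    also have "\<dots> = A $ i $ i + A $ j $ j + (c * A $ i $ j + cnj (c * A $ i $ j))"
      using c(2) by (simp add: Ax ji algebra_simps)
    finally have "0 \<le> Re (A $ i $ i) + Re (A $ j $ j) - 2 * cmod (A $ i $ j)"
      using A unfolding c(1) by (auto simp: psd_alt dest: spec[of _ x])
    then show ?thesis using diag[of i] diag[of j] by linarith
  qed
qed

text \<open>The Leibniz expansion has n! terms. This crude bound serves only to make the supremum
  over covariances finite and integrable.\<close>

lemma cmod_det_le:
  fixes A :: "complex ^ 'n ^ 'n::finite"
  assumes "\<And>i j. cmod (A $ i $ j) \<le> b"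
  shows "cmod (det A) \<le> fact CARD('n) * b ^ CARD('n)"
proof -
  have "cmod (det A) \<le> (\<Sum>p | p permutes (UNIV :: 'n set). cmod (of_int (sign p) * (\<Prod>i\<in>UNIV. A $ i $ p i)))"
    unfolding det_def by (rule norm_sum)
  also have "\<dots> \<le> (\<Sum>p | p permutes (UNIV :: 'n set). b ^ CARD('n))"
  proof (rule sum_mono)
    fix p :: "'n \<Rightarrow> 'n"
    have "cmod (of_int (sign p) * (\<Prod>i\<in>UNIV. A $ i $ p i)) = (\<Prod>i\<in>UNIV. cmod (A $ i $ p i))"
      by (simp add: norm_mult prod_norm sign_def)
    also have "\<dots> \<le> (\<Prod>i\<in>(UNIV::'n set). b)"
      using assms by (intro prod_mono) auto
    finally show "cmod (of_int (sign p) * (\<Prod>i\<in>UNIV. A $ i $ p i)) \<le> b ^ CARD('n)" by simp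
  qed
  also have "\<dots> = fact CARD('n) * b ^ CARD('n)"
    by (simp add: card_permutations)
  finally show ?thesis .
qed

section \<open>The maximum sum-rate\<close>

definition covs :: "real \<Rightarrow> nat \<Rightarrow> (nat \<Rightarrow> complex ^ 'k ^ 'k::finite) set" where
  "covs P N = {Q. (\<forall>n<N. psd (Q n)) \<and> (\<Sum>n<N. trace (Q n)) = complex_of_real P}"

definition gram :: "nat \<Rightarrow> (nat \<Rightarrow> complex ^ 'm ^ 'k) \<Rightarrow> (nat \<Rightarrow> complex ^ 'k ^ 'k) \<Rightarrow> complex ^ 'm::finite ^ 'm" where
  "gram N H Q = (\<Sum>n<N. herm (H n) ** Q n ** H n)"

definition cov_rate :: "nat \<Rightarrow> (nat \<Rightarrow> complex ^ 'm ^ 'k) \<Rightarrow> (nat \<Rightarrow> complex ^ 'k ^ 'k) \<Rightarrow> 'm::finite itself \<Rightarrow> real" where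
  "cov_rate N H Q _ = ln (Re (det (mat 1 + gram N H Q)))"

lemma opt_sum_rate_eq:
  "opt_sum_rate P N (H :: nat \<Rightarrow> complex ^ 'm::finite ^ 'k::finite) = (SUP Q\<in>covs P N. cov_rate N H Q TYPE('m))"
  by (simp add: opt_sum_rate_def cov_rate_def gram_def covs_def setcompr_eq_image)

lemma psd_gram: "Q \<in> covs P N \<Longrightarrow> psd (gram N H Q)"
  unfolding gram_def covs_def by (auto intro!: psd_sum psd_congruence)

lemma covs_entry_le:
  assumes Q: "Q \<in> covs P N" and n: "n < N"
  shows "cmod (Q n $ i $ j) \<le> P"
proof -
  have psd: "psd (Q n)" if "n < N" for n using Q that by (simp add: covs_def)
  have nn: "0 \<le> Re (trace (Q n))" if "n < N" for n
    unfolding trace_def Re_sum by (intro sum_nonneg psd_diagonal(2) psd that)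
  have "(\<Sum>n<N. Re (trace (Q n))) = P"
    using Q by (simp add: covs_def flip: Re_sum)
  moreover have "Re (trace (Q n)) \<le> (\<Sum>n<N. Re (trace (Q n)))"
    using nn n by (intro member_le_sum) auto
  moreover have "cmod (Q n $ i $ j) \<le> Re (trace (Q n))"
    by (rule psd_entry_le[OF psd[OF n]])
  ultimately show ?thesis by linarith
qed

lemma norm_entry_le: "cmod (h $ i $ j) \<le> norm (h :: complex ^ 'm::finite ^ 'k::finite)"
  using Finite_Cartesian_Product.norm_nth_le[of "h $ i" j] Finite_Cartesian_Product.norm_nth_le[of h i] by linarith

lemma congruence_entry_le:
  fixes h :: "complex ^ 'm::finite ^ 'k::finite"
  assumes "\<And>k l. cmod (Q $ k $ l) \<le> P"
  shows "cmod ((herm h ** Q ** h) $ i $ j) \<le> (real CARD('k))\<^sup>2 * (P * (norm h)\<^sup>2)"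
proof -
  have "0 \<le> P" using assms[of undefined undefined] norm_ge_zero order_trans by blast
  have "(herm h ** Q ** h) $ i $ j = (\<Sum>k\<in>UNIV. \<Sum>l\<in>UNIV. cnj (h $ l $ i) * Q $ l $ k * h $ k $ j)"
    by (simp add: matrix_matrix_mult_def herm_def sum_distrib_right)
  also have "cmod \<dots> \<le> (\<Sum>k\<in>(UNIV::'k set). \<Sum>l\<in>(UNIV::'k set). P * (norm h)\<^sup>2)"
  proof (intro sum_norm_le)
    fix k l
    have "cmod (cnj (h $ l $ i) * Q $ l $ k * h $ k $ j) = cmod (h $ l $ i) * cmod (Q $ l $ k) * cmod (h $ k $ j)"
      by (simp add: norm_mult)
    also have "\<dots> \<le> norm h * P * norm h"
      using \<open>0 \<le> P\<close> by (intro mult_mono norm_entry_le assms) auto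
    finally show "cmod (cnj (h $ l $ i) * Q $ l $ k * h $ k $ j) \<le> P * (norm h)\<^sup>2"
      by (simp add: power2_eq_square mult_ac)
  qed
  finally show ?thesis by (simp add: power2_eq_square)
qed

text \<open>Deliberately crude: linear in the squared channel norms, hence integrable, and
  independent of the covariances.\<close>

definition rate_cap :: "real \<Rightarrow> nat \<Rightarrow> (nat \<Rightarrow> complex ^ 'm::finite ^ 'k::finite) \<Rightarrow> real" where
  "rate_cap P N H = ln (fact CARD('m)) + real CARD('m) * ((real CARD('k))\<^sup>2 * P * (\<Sum>n<N. (norm (H n))\<^sup>2))"

lemma cov_rate_le:
  fixes H :: "nat \<Rightarrow> complex ^ 'm::finite ^ 'k::finite"
  assumes Q: "Q \<in> covs P N" and P: "0 \<le> P"
  shows "cov_rate N H Q TYPE('m) \<le> rate_cap P N H"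
proof -
  define s where "s = (real CARD('k))\<^sup>2 * P * (\<Sum>n<N. (norm (H n))\<^sup>2)"
  have s: "0 \<le> s" using P by (simp add: s_def sum_nonneg)
  let ?B = "mat 1 + gram N H Q"
  have "cmod (?B $ i $ j) \<le> 1 + s" for i j
  proof -
    have "cmod (gram N H Q $ i $ j) \<le> (\<Sum>n<N. (real CARD('k))\<^sup>2 * (P * (norm (H n))\<^sup>2))"
      unfolding gram_def sum_component
      by (intro sum_norm_le congruence_entry_le covs_entry_le[OF Q]) auto
    also have "\<dots> = s" by (simp add: s_def sum_distrib_left mult.assoc)
    finally have "cmod (gram N H Q $ i $ j) \<le> s" .
    moreover have "cmod (mat 1 $ i $ j :: complex) \<le> 1" by (simp add: mat_def)
    ultimately show ?thesis
      using norm_triangle_ineq[of "mat 1 $ i $ j" "gram N H Q $ i $ j"] by simp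
  qed
  then have "cmod (det ?B) \<le> fact CARD('m) * (1 + s) ^ CARD('m)"
    by (rule cmod_det_le)
  moreover have "\<bar>Re (det ?B)\<bar> \<le> cmod (det ?B)" by (rule abs_Re_le_cmod)
  moreover have nz: "Re (det ?B) \<noteq> 0"
    by (rule Re_det_identity_plus_psd_nonzero[OF psd_gram[OF Q]])
  ultimately have "ln \<bar>Re (det ?B)\<bar> \<le> ln (fact CARD('m) * (1 + s) ^ CARD('m))"
    by (subst ln_le_cancel_iff) auto
  \<comment> \<open>The real \<open>ln\<close> depends only on the absolute value of its argument,
    so the bound holds whatever the sign of the determinant.\<close>
  also have "ln \<bar>Re (det ?B)\<bar> = ln (Re (det ?B))"
    by (simp add: ln_real_def)
  also have "ln (fact CARD('m) * (1 + s) ^ CARD('m)) = ln (fact CARD('m)) + CARD('m) * ln (1 + s)"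
    using s by (simp add: ln_mult ln_realpow)
  also have "\<dots> \<le> ln (fact CARD('m)) + CARD('m) * s"
    using ln_add_one_self_le_self[OF s] by simp
  finally show ?thesis by (simp add: cov_rate_def rate_cap_def s_def)
qed

lemma bdd_above_cov_rate:
  fixes H :: "nat \<Rightarrow> complex ^ 'm::finite ^ 'k::finite"
  assumes "0 \<le> P"
  shows "bdd_above ((\<lambda>Q. cov_rate N H Q TYPE('m)) ` covs P N)"
  using cov_rate_le[OF _ assms] by (auto intro!: bdd_aboveI2)

text \<open>Covariance of a user that puts power c on its antenna l alone; the congruence by a
  channel then has rank at most one and sees only row l.\<close>

definition unit_matrix :: "'k \<Rightarrow> real \<Rightarrow> complex ^ 'k ^ 'k::finite" where
  "unit_matrix l c = (\<chi> i j. if i = l \<and> j = l then complex_of_real c else 0)"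

lemma double_sum_single:
  fixes F :: "'k::finite \<Rightarrow> 'k \<Rightarrow> 'a::comm_monoid_add"
  assumes "\<And>i j. i \<noteq> l \<or> j \<noteq> l \<Longrightarrow> F i j = 0"
  shows "(\<Sum>i\<in>UNIV. \<Sum>j\<in>UNIV. F i j) = F l l"
proof -
  have "(\<Sum>i\<in>UNIV. \<Sum>j\<in>UNIV. F i j) = (\<Sum>i\<in>{l}. \<Sum>j\<in>UNIV. F i j)"
    using assms by (intro sum.mono_neutral_right) auto
  also have "\<dots> = (\<Sum>j\<in>{l}. F l j)"
    using assms by (simp, intro sum.mono_neutral_right[of UNIV "{l}" "F l", simplified]) auto
  finally show ?thesis by simp
qed

lemma psd_unit_matrix:
  assumes "0 \<le> c"
  shows "psd (unit_matrix l c)"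
proof -
  have "hform (unit_matrix l c) x = complex_of_real (c * (cmod (x $ l))\<^sup>2)" for x
  proof -
    have "hform (unit_matrix l c) x = cnj (x $ l) * unit_matrix l c $ l $ l * x $ l"
      unfolding hform_double_sum by (rule double_sum_single) (auto simp: unit_matrix_def)
    also have "\<dots> = complex_of_real (c * (cmod (x $ l))\<^sup>2)"
      by (simp add: unit_matrix_def complex_norm_square mult_ac del: of_real_power)
    finally show ?thesis .
  qed
  then show ?thesis
    using assms by (auto simp: psd_alt herm_def unit_matrix_def vec_eq_iff)
qed

lemma trace_unit_matrix: "trace (unit_matrix l c) = complex_of_real c"
  by (simp add: trace_def unit_matrix_def)

lemma congruence_unit_matrix:
  "(herm h ** unit_matrix l c ** h) $ i $ j = complex_of_real c * cnj (h $ l $ i) * h $ l $ j"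
proof -
  have "(herm h ** unit_matrix l c ** h) $ i $ j
    = (\<Sum>k\<in>UNIV. \<Sum>k'\<in>UNIV. cnj (h $ k' $ i) * unit_matrix l c $ k' $ k * h $ k $ j)"
    by (simp add: matrix_matrix_mult_def herm_def sum_distrib_right)
  also have "\<dots> = cnj (h $ l $ i) * unit_matrix l c $ l $ l * h $ l $ j"
    by (rule double_sum_single) (auto simp: unit_matrix_def)
  finally show ?thesis by (simp add: unit_matrix_def mult_ac)
qed

text \<open>User 0 spends all the power on one antenna, and the rank-one formula gives a determinant
  of at least 1. This shows that \<open>covs\<close> is nonempty and that the maximum sum-rate is
  nonnegative.\<close>

lemma single_user_cov:
  fixes H :: "nat \<Rightarrow> complex ^ 'm::finite ^ 'k::finite"
  assumes P: "0 \<le> P" and N: "0 < N"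
  shows "\<exists>Q\<in>covs P N. 0 \<le> cov_rate N H Q TYPE('m)"
proof -
  define l :: 'k where "l = undefined"
  define Q where "Q n = (if n = 0 then unit_matrix l P else 0 :: complex ^ 'k ^ 'k)" for n :: nat
  have "(\<Sum>n<N. trace (Q n)) = (\<Sum>n<N. if n = 0 then complex_of_real P else 0)"
    by (intro sum.cong refl) (simp add: Q_def trace_unit_matrix, simp add: trace_def)
  then have Q: "Q \<in> covs P N"
    using N P by (auto simp: covs_def Q_def psd_unit_matrix psd_zero)
  have gram: "gram N H Q = herm (H 0) ** unit_matrix l P ** H 0"
  proof -
    have "gram N H Q = (\<Sum>n<N. if n = 0 then herm (H 0) ** unit_matrix l P ** H 0 else 0)"
      unfolding gram_def by (intro sum.cong refl) (simp add: Q_def matrix_matrix_mult_def vec_eq_iff)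
    then show ?thesis using N by simp
  qed
  have "mat 1 + gram N H Q = (\<chi> i j. (if i = j then 1 else 0) + (complex_of_real P * cnj (H 0 $ l $ i)) * (H 0 $ l) $ j)"
    unfolding gram by (simp add: vec_eq_iff congruence_unit_matrix mat_def)
  then have "det (mat 1 + gram N H Q) = 1 + (\<Sum>i\<in>UNIV. complex_of_real P * cnj (H 0 $ l $ i) * (H 0 $ l) $ i)"
    by (simp only: det_identity_plus_rank_one)
  also have "\<dots> = complex_of_real (1 + (\<Sum>i\<in>UNIV. P * (cmod (H 0 $ l $ i))\<^sup>2))"
    by (simp add: complex_norm_square mult_ac del: of_real_power)
  finally have "Re (det (mat 1 + gram N H Q)) \<ge> 1"
    using P by (simp add: sum_nonneg)
  then have "0 \<le> cov_rate N H Q TYPE('m)" by (simp add: cov_rate_def)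
  with Q show ?thesis by blast
qed

lemma cov_rate_le_opt:
  fixes H :: "nat \<Rightarrow> complex ^ 'm::finite ^ 'k::finite"
  assumes "0 \<le> P" "Q \<in> covs P N"
  shows "cov_rate N H Q TYPE('m) \<le> opt_sum_rate P N H"
  unfolding opt_sum_rate_eq by (rule cSUP_upper[OF assms(2) bdd_above_cov_rate[OF assms(1)]])

lemma opt_sum_rate_nonneg:
  fixes H :: "nat \<Rightarrow> complex ^ 'm::finite ^ 'k::finite"
  assumes "0 \<le> P" "0 < N"
  shows "0 \<le> opt_sum_rate P N H"
  using single_user_cov[OF assms, of H] cov_rate_le_opt[OF assms(1)] order_trans by blast

lemma opt_sum_rate_le:
  fixes H :: "nat \<Rightarrow> complex ^ 'm::finite ^ 'k::finite"
  assumes "0 \<le> P" "0 < N"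
  shows "opt_sum_rate P N H \<le> rate_cap P N H"
  unfolding opt_sum_rate_eq
  by (rule cSUP_least) (use single_user_cov[OF assms, of H] cov_rate_le[OF _ assms(1)] in auto)

section \<open>Measurability of the maximum sum-rate\<close>

lemma continuous_on_det [continuous_intros]:
  fixes f :: "'a::topological_space \<Rightarrow> complex ^ 'm::finite ^ 'm"
  shows "continuous_on S f \<Longrightarrow> continuous_on S (\<lambda>x. det (f x))"
  unfolding det_def by (intro continuous_intros)

lemma continuous_on_congruence:
  "continuous_on UNIV (\<lambda>(Q, h). herm h ** Q ** (h :: complex ^ 'm::finite ^ 'k::finite))"
  unfolding split_beta' matrix_matrix_mult_def herm_def by (intro continuous_intros)

text \<open>The supremum is over an uncountable set. As the rate is continuous at every admissible
  covariance, a countable dense subset of \<open>covs\<close> has the same supremum.\<close>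

lemma borel_measurable_opt_sum_rate:
  assumes P: "0 \<le> P" and N: "0 < N"
  shows "(opt_sum_rate P N :: (nat \<Rightarrow> complex ^ 'm::finite ^ 'k::finite) \<Rightarrow> real) \<in> borel_measurable (PiM {..<N} (\<lambda>_. borel))"
proof -
  \<comment> \<open>The values at n \<ge> N are unconstrained, but \<open>covs\<close> still lies in
    a countable product of finite-dimensional spaces, which is second countable.\<close>
  obtain T :: "(nat \<Rightarrow> complex ^ 'k ^ 'k) set" where T: "countable T" "T \<subseteq> covs P N" "covs P N \<subseteq> closure T"
    by (rule separable)
  have "T \<noteq> {}"
    using T(3) single_user_cov[OF P N, of "undefined :: nat \<Rightarrow> complex ^ 'm ^ 'k"] by auto
  have bdd: "bdd_above ((\<lambda>Q. cov_rate N H Q TYPE('m)) ` T)" for H :: "nat \<Rightarrow> complex ^ 'm ^ 'k"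
    using bdd_above_cov_rate[OF P] T(2) by (rule bdd_above_mono[OF _ image_mono])
  have eq: "opt_sum_rate P N H = (SUP Q\<in>T. cov_rate N H Q TYPE('m))" for H :: "nat \<Rightarrow> complex ^ 'm ^ 'k"
    unfolding opt_sum_rate_eq
  proof (rule antisym)
    show "(SUP Q\<in>T. cov_rate N H Q TYPE('m)) \<le> (SUP Q\<in>covs P N. cov_rate N H Q TYPE('m))"
      by (intro cSUP_subset_mono \<open>T \<noteq> {}\<close> bdd_above_cov_rate P T order_refl)
    show "(SUP Q\<in>covs P N. cov_rate N H Q TYPE('m)) \<le> (SUP Q\<in>T. cov_rate N H Q TYPE('m))"
    proof (rule cSUP_least)
      show "covs P N \<noteq> ({} :: (nat \<Rightarrow> complex ^ 'k ^ 'k) set)" using T(2) \<open>T \<noteq> {}\<close> by auto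
      fix Q :: "nat \<Rightarrow> complex ^ 'k ^ 'k" assume Q: "Q \<in> covs P N"
      have "continuous_on UNIV (\<lambda>Q :: nat \<Rightarrow> complex ^ 'k ^ 'k. Re (det (mat 1 + gram N H Q)))"
        unfolding gram_def
        by (intro continuous_intros continuous_on_compose2[OF continuous_on_congruence, of _ "\<lambda>Q. (Q n, H n)" for n, simplified]
            continuous_on_product_coordinates)
      moreover have "Re (det (mat 1 + gram N H Q)) \<noteq> 0"
        by (rule Re_det_identity_plus_psd_nonzero[OF psd_gram[OF Q]])
      ultimately have cont: "isCont (\<lambda>Q. cov_rate N H Q TYPE('m)) Q"
        unfolding cov_rate_def by (intro continuous_intros) (auto simp: continuous_on_eq_continuous_at)
      have "Q \<in> closure T" using T(3) Q by blast
      then obtain X where X: "\<forall>i. X i \<in> T" "X \<longlonglongrightarrow> Q"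
        unfolding closure_sequential by blast
      have "(\<lambda>i. cov_rate N H (X i) TYPE('m)) \<longlonglongrightarrow> cov_rate N H Q TYPE('m)"
        using cont X(2) by (rule isCont_tendsto_compose)
      then show "cov_rate N H Q TYPE('m) \<le> (SUP Q\<in>T. cov_rate N H Q TYPE('m))"
        by (rule LIMSEQ_le_const2) (use X(1) bdd in \<open>auto intro!: cSUP_upper\<close>)
    qed
  qed
  have [measurable]: "(\<lambda>H. cov_rate N H Q TYPE('m)) \<in> borel_measurable (PiM {..<N} (\<lambda>_. borel))" for Q :: "nat \<Rightarrow> complex ^ 'k ^ 'k"
  proof -
    have c: "(\<lambda>h :: complex ^ 'm ^ 'k. herm h ** Q n ** h) \<in> borel_measurable borel" for n
      by (intro borel_measurable_continuous_onI continuous_on_compose2[OF continuous_on_congruence, of _ "\<lambda>h. (Q n, h)", simplified] continuous_intros)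
    have [measurable]: "(\<lambda>H. herm (H n) ** Q n ** (H n :: complex ^ 'm ^ 'k)) \<in> borel_measurable (PiM {..<N} (\<lambda>_. borel))" if "n < N" for n
    proof -
      have "(\<lambda>H. H n) \<in> PiM {..<N} (\<lambda>_. borel) \<rightarrow>\<^sub>M (borel :: (complex ^ 'm ^ 'k) measure)"
        using that by simp
      from measurable_compose[OF this c] show ?thesis .
    qed
    have [measurable]: "(\<lambda>H. gram N H Q :: complex ^ 'm ^ 'm) \<in> borel_measurable (PiM {..<N} (\<lambda>_. borel))"
      unfolding gram_def by (intro borel_measurable_sum) simp
    have [measurable]: "(\<lambda>A :: complex ^ 'm ^ 'm. Re (det (mat 1 + A))) \<in> borel_measurable borel"
      by (intro borel_measurable_continuous_onI continuous_intros)
    show ?thesis unfolding cov_rate_def by measurable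
  qed
  have "(\<lambda>H. SUP Q\<in>T. cov_rate N (H :: nat \<Rightarrow> complex ^ 'm ^ 'k) Q TYPE('m)) \<in> borel_measurable (PiM {..<N} (\<lambda>_. borel))"
    using T(1) bdd by (intro borel_measurable_cSUP) auto
  then show ?thesis by (simp add: eq[abs_def])
qed


section \<open>Sum-rate on nearly orthogonal channels\<close>

definition beam :: "'k \<Rightarrow> 'm \<Rightarrow> complex ^ 'm::finite ^ 'k::finite" where
  "beam l j = (\<chi> i i'. if i = l \<and> i' = j then 1 else 0)"

lemma norm_le_sum_entries:
  "norm (A :: complex ^ 'm::finite ^ 'k::finite) \<le> (\<Sum>i\<in>UNIV. \<Sum>j\<in>UNIV. cmod (A $ i $ j))"
proof -
  have "norm A \<le> (\<Sum>i\<in>UNIV. norm (A $ i))"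
    unfolding norm_vec_def[of A] by (rule L2_set_le_sum) simp
  also have "\<dots> \<le> (\<Sum>i\<in>UNIV. \<Sum>j\<in>UNIV. cmod (A $ i $ j))"
    unfolding norm_vec_def[of "A $ i" for i] by (intro sum_mono L2_set_le_sum) simp
  finally show ?thesis .
qed

text \<open>Expanding around (p, q) gives two linear errors and a quadratic one, which e \<le> 1
  makes linear.\<close>

lemma cmod_product_perturbed:
  assumes "cmod (x - p) \<le> e" "cmod (y - q) \<le> e" "cmod p \<le> 1" "cmod q \<le> 1" "e \<le> 1"
  shows "cmod (x * y - p * q) \<le> 3 * e"
proof -
  have "0 \<le> e" using assms(1) norm_ge_zero order_trans by blast
  have "x * y - p * q = (x - p) * (y - q) + (x - p) * q + p * (y - q)"
    by (simp add: algebra_simps)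
  also have "cmod \<dots> \<le> cmod (x - p) * cmod (y - q) + cmod (x - p) * cmod q + cmod p * cmod (y - q)"
    by (intro norm_triangle_le add_mono) (simp_all add: norm_mult)
  also have "\<dots> \<le> 1 * e + e * 1 + 1 * e"
    using assms \<open>0 \<le> e\<close> by (intro add_mono mult_mono) auto
  finally show ?thesis by simp
qed

text \<open>Each scaled beam links antenna l of one user to one base station antenna. Give the M
  users near these beams power P/M on antenna l. Then I plus the Gram matrix is s X with s = (P/M)
  a^2, and X tends to I as a grows, because an absolute error 1 in the channel is a relative error
  1/a. Continuity of the determinant at I does the rest.\<close>

lemma opt_sum_rate_ge:
  fixes P \<epsilon> :: real and l :: "'k::finite"
  assumes P: "P > 0" and \<epsilon>: "\<epsilon> > 0"
  shows "\<exists>a0>0. \<forall>a\<ge>a0. \<forall>N. \<forall>H :: nat \<Rightarrow> complex ^ 'm::finite ^ 'k.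
    (\<forall>j. \<exists>n<N. norm (H n - a *\<^sub>R beam l j) \<le> 1) \<longrightarrow>
    CARD('m) * ln (P / CARD('m) * a\<^sup>2) - \<epsilon> \<le> opt_sum_rate P N H"
proof -
  let ?m = "real CARD('m)"
  have m: "?m \<ge> 1" using zero_less_card_finite[where 'a='m] by linarith
  \<comment> \<open>Chosen so that 1 - \<eta> = exp (- \<epsilon>), which turns closeness of det X
    to 1 into a loss of at most \<epsilon> in rate.\<close>
  define \<eta> where "\<eta> = 1 - exp (- \<epsilon>)"
  have \<eta>: "\<eta> > 0" using \<epsilon> by (simp add: \<eta>_def)
  have "isCont (det :: complex ^ 'm ^ 'm \<Rightarrow> complex) (mat 1)"
    using continuous_on_det[OF continuous_on_id, of UNIV] by (auto simp: continuous_on_eq_continuous_at id_def)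
  then obtain \<delta> where \<delta>: "\<delta> > 0" "\<And>X :: complex ^ 'm ^ 'm. norm (X - mat 1) < \<delta> \<Longrightarrow> cmod (det X - 1) < \<eta>"
    using \<eta> unfolding continuous_at_eps_delta by (auto simp: dist_norm)
  \<comment> \<open>X - I has M^2 entries, each of modulus at most (M/P + 3 M)/a: 1/s contributes
    M/(P a), and M perturbed products contribute 3/a each. Thus c/a bounds the norm.\<close>
  define c where "c = ?m * ?m * (?m / P + 3 * ?m)"
  have c: "c > 0" using m P by (simp add: c_def add_pos_pos)
  \<comment> \<open>Beyond a = 2 no channel is within 1 of two different beams, so the selected
    users are distinct; the second bound makes c/a < \<delta>.\<close>
  define a0 where "a0 = max 3 (c / \<delta> + 1)"
  have "CARD('m) * ln (P / CARD('m) * a\<^sup>2) - \<epsilon> \<le> opt_sum_rate P N H"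
    if a: "a \<ge> a0" and H: "\<forall>j. \<exists>n<N. norm (H n - a *\<^sub>R beam l j) \<le> 1"
    for a N and H :: "nat \<Rightarrow> complex ^ 'm ^ 'k"
  proof -
    have a3: "a \<ge> 3" and ac: "c / \<delta> < a" using a by (auto simp: a0_def)
    obtain \<nu> where \<nu>: "\<And>j. \<nu> j < N" "\<And>j. norm (H (\<nu> j) - a *\<^sub>R beam l j) \<le> 1"
      using H by metis
    have entry: "cmod (H (\<nu> j) $ l $ i - (if i = j then a else 0)) \<le> 1" for i j
    proof -
      have "H (\<nu> j) $ l $ i - (if i = j then a else 0) = (H (\<nu> j) - a *\<^sub>R beam l j) $ l $ i"
        by (simp add: beam_def of_real_def)
      then show ?thesis using norm_entry_le[of "H (\<nu> j) - a *\<^sub>R beam l j" l i] \<nu>(2)[of j] by simp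
    qed
    have inj: "inj \<nu>"
    proof (rule injI, rule ccontr)
      fix i j assume ij: "\<nu> i = \<nu> j" "i \<noteq> j"
      have "cmod (H (\<nu> i) $ l $ i - a) \<le> 1" "cmod (H (\<nu> i) $ l $ i) \<le> 1"
        using entry[of i i] entry[of j i] ij by auto
      then have "cmod (complex_of_real a) \<le> 1 + 1"
        using norm_triangle_ineq4[of "H (\<nu> i) $ l $ i" "H (\<nu> i) $ l $ i - a"] by simp
      then show False using a3 by simp
    qed
    define Q where "Q n = (if n \<in> range \<nu> then unit_matrix l (P / ?m) else 0)" for n
    have sub: "range \<nu> \<subseteq> {..<N}" using \<nu>(1) by auto
    have range_sum: "(\<Sum>n<N. F n) = (\<Sum>j\<in>UNIV. F (\<nu> j))" if "\<And>n. n \<notin> range \<nu> \<Longrightarrow> F n = 0" for F :: "nat \<Rightarrow> complex"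
    proof -
      have "(\<Sum>n<N. F n) = (\<Sum>n\<in>range \<nu>. F n)"
        using sub that by (intro sum.mono_neutral_right) auto
      also have "\<dots> = (\<Sum>j\<in>UNIV. F (\<nu> j))"
        by (rule sum.reindex[OF inj, unfolded o_def])
      finally show ?thesis .
    qed
    have "(\<Sum>n<N. trace (Q n)) = (\<Sum>j\<in>(UNIV::'m set). trace (Q (\<nu> j)))"
      by (rule range_sum) (simp add: Q_def trace_def)
    also have "\<dots> = complex_of_real P"
      using m by (simp add: Q_def trace_unit_matrix)
    finally have Q: "Q \<in> covs P N"
      using P by (auto simp: covs_def Q_def psd_unit_matrix psd_zero)
    define s where "s = P / ?m * a\<^sup>2"
    have s: "s > 0" using P m a3 by (simp add: s_def)
    define X :: "complex ^ 'm ^ 'm" where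
      "X = (\<chi> i i'. (if i = i' then 1 / s else 0) + (\<Sum>j\<in>UNIV. cnj (H (\<nu> j) $ l $ i / a) * (H (\<nu> j) $ l $ i' / a)))"
    have gram: "gram N H Q $ i $ i' = (\<Sum>j\<in>UNIV. complex_of_real (P / ?m) * cnj (H (\<nu> j) $ l $ i) * H (\<nu> j) $ l $ i')" for i i'
    proof -
      have "gram N H Q $ i $ i' = (\<Sum>n<N. (herm (H n) ** Q n ** H n) $ i $ i')"
        by (simp add: gram_def)
      also have "\<dots> = (\<Sum>j\<in>UNIV. (herm (H (\<nu> j)) ** Q (\<nu> j) ** H (\<nu> j)) $ i $ i')"
        by (rule range_sum) (simp add: Q_def matrix_matrix_mult_def)
      finally show ?thesis by (simp add: Q_def congruence_unit_matrix)
    qed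
    have sX: "mat 1 + gram N H Q = (\<chi> i. complex_of_real s *s (X $ i))"
    proof -
      have id: "complex_of_real s * (cnj (x / a) * (y / a)) = complex_of_real (P / ?m) * cnj x * y" for x y :: complex
        using a3 by (simp add: s_def power2_eq_square)
      have "complex_of_real s * (\<Sum>j\<in>UNIV. cnj (H (\<nu> j) $ l $ i / a) * (H (\<nu> j) $ l $ i' / a)) = gram N H Q $ i $ i'" for i i'
        by (simp only: sum_distrib_left id gram)
      moreover have "complex_of_real s * (if i = i' then 1 / s else 0) = mat 1 $ i $ i'" for i i' :: 'm
        using s by (simp add: mat_def)
      ultimately show ?thesis
        by (simp add: vec_eq_iff X_def distrib_left)
    qed
    have det: "det (mat 1 + gram N H Q) = complex_of_real s ^ CARD('m) * det X"
      unfolding sX using det_rows_mul[of "\<lambda>_. complex_of_real s" "\<lambda>i. X $ i"] by simp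
    have X_near: "cmod ((X - mat 1) $ i $ i') \<le> (?m / P + 3 * ?m) / a" for i i'
    proof -
      have u: "cmod (H (\<nu> j) $ l $ i / a - (if i = j then 1 else 0)) \<le> 1 / a" for i j
      proof -
        have "H (\<nu> j) $ l $ i / a - (if i = j then 1 else 0) = (H (\<nu> j) $ l $ i - (if i = j then a else 0)) / a"
          using a3 by (simp add: diff_divide_distrib)
        then show ?thesis using entry[of j i] a3 by (simp add: norm_divide divide_right_mono)
      qed
      have cu: "cmod (cnj (H (\<nu> j) $ l $ i / a) - (if i = j then 1 else 0)) \<le> 1 / a" for i j
      proof -
        have "cnj (H (\<nu> j) $ l $ i / a) - (if i = j then 1 else 0) = cnj (H (\<nu> j) $ l $ i / a - (if i = j then 1 else 0))"
          by simp
        then show ?thesis using u[of j i] by (simp only: complex_mod_cnj)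
      qed
      have "(mat 1 :: complex ^ 'm ^ 'm) $ i $ i' = (\<Sum>j\<in>UNIV. (if i = j then 1 else 0) * (if i' = j then 1 else 0))"
        by (simp add: mat_def if_distrib[of "\<lambda>x. x * _"] cong: if_cong)
      then have "(X - mat 1) $ i $ i' = (if i = i' then 1 / s else 0)
        + (\<Sum>j\<in>UNIV. cnj (H (\<nu> j) $ l $ i / a) * (H (\<nu> j) $ l $ i' / a) - (if i = j then 1 else 0) * (if i' = j then 1 else 0))"
        by (simp add: X_def sum_subtractf)
      also have "cmod \<dots> \<le> 1 / s + (\<Sum>j\<in>(UNIV::'m set). 3 * (1 / a))"
        using s a3 by (intro norm_triangle_le add_mono sum_norm_le cmod_product_perturbed u cu) (auto simp: norm_divide)
      also have "1 / s \<le> ?m / P / a"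
      proof -
        have "P / ?m * a \<le> s"
          using P m a3 by (simp add: s_def power2_eq_square divide_right_mono)
        then have "1 / s \<le> 1 / (P / ?m * a)"
          using P m a3 s by (intro divide_left_mono mult_pos_pos) auto
        then show ?thesis by simp
      qed
      finally show ?thesis by (simp add: add_divide_distrib mult.commute)
    qed
    have "norm (X - mat 1) \<le> (\<Sum>i\<in>(UNIV::'m set). \<Sum>i'\<in>(UNIV::'m set). (?m / P + 3 * ?m) / a)"
      using norm_le_sum_entries[of "X - mat 1"] by (rule order_trans) (intro sum_mono X_near)
    also have "\<dots> = c / a" by (simp add: c_def)
    also have "\<dots> < \<delta>" using ac \<delta>(1) a3 by (simp add: field_simps)
    finally have "cmod (det X - 1) < \<eta>" by (rule \<delta>(2))
    then have X: "exp (- \<epsilon>) < Re (det X)"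
      using abs_Re_le_cmod[of "det X - 1"] by (simp add: \<eta>_def)
    have "ln (exp (- \<epsilon>)) < ln (Re (det X))"
      using X by (subst ln_less_cancel_iff) (auto intro: less_trans[OF exp_gt_zero])
    then have "- \<epsilon> < ln (Re (det X))" by simp
    moreover have "cov_rate N H Q TYPE('m) = ?m * ln s + ln (Re (det X))"
    proof -
      have pos: "0 < Re (det X)" using X exp_gt_zero less_trans by blast
      have "complex_of_real s ^ CARD('m) * det X = complex_of_real (s ^ CARD('m)) * det X" by simp
      then have "Re (det (mat 1 + gram N H Q)) = s ^ CARD('m) * Re (det X)"
        unfolding det by (simp del: of_real_power)
      then show ?thesis using s pos by (simp add: cov_rate_def ln_mult ln_realpow)
    qed
    ultimately have "?m * ln s - \<epsilon> \<le> cov_rate N H Q TYPE('m)" by simp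
    also have "\<dots> \<le> opt_sum_rate P N H" using P by (intro cov_rate_le_opt Q) simp
    finally show ?thesis by (simp add: s_def)
  qed
  moreover have "a0 > 0" by (simp add: a0_def)
  ultimately show ?thesis by blast
qed

section \<open>Random channels\<close>

lemma prob_space_channel_law: "prob_space (channel_law :: (complex ^ 'm::finite ^ 'k::finite) measure)"
  unfolding channel_law_eq by (rule prob_space_gauss) simp

lemma sets_channel_law [measurable_cong, simp]: "sets channel_law = sets borel"
  by (simp add: channel_law_eq)

lemma space_channel_law [simp]: "space channel_law = UNIV"
  by (simp add: channel_law_eq)

lemma measurable_channel_law1 [simp]: "measurable channel_law M = measurable borel M"
  by (rule measurable_cong_sets) simp_all

lemma sets_channels_law [measurable_cong]: "sets (channels_law N) = sets (PiM {..<N} (\<lambda>_. borel))"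
  unfolding channels_law_def by (intro sets_PiM_cong) auto

lemma prob_space_channels_law: "prob_space (channels_law N :: (nat \<Rightarrow> complex ^ 'm::finite ^ 'k::finite) measure)"
  unfolding channels_law_def by (rule prob_space_PiM) (rule prob_space_channel_law)

lemma measurable_channel [measurable]:
  "n < N \<Longrightarrow> (\<lambda>H. H n) \<in> channels_law N \<rightarrow>\<^sub>M (borel :: (complex ^ 'm::finite ^ 'k::finite) measure)"
proof -
  assume "n < N"
  then have "(\<lambda>H. H n) \<in> PiM {..<N} (\<lambda>_. borel) \<rightarrow>\<^sub>M (borel :: (complex ^ 'm ^ 'k) measure)" by simp
  then show ?thesis by (simp cong: measurable_cong_sets add: sets_channels_law)
qed

lemma integral_channel:
  fixes f :: "complex ^ 'm::finite ^ 'k::finite \<Rightarrow> real"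
  assumes "n < N" and [measurable]: "f \<in> borel_measurable borel"
  shows "integrable (channels_law N) (\<lambda>H. f (H n)) \<longleftrightarrow> integrable channel_law f"
    and "(\<integral>H. f (H n) \<partial>channels_law N) = (\<integral>h. f h \<partial>channel_law)"
proof -
  interpret product_prob_space "\<lambda>_. channel_law :: (complex ^ 'm ^ 'k) measure" "{..<N}"
    by (intro product_prob_spaceI prob_space_channel_law)
  show "integrable (channels_law N) (\<lambda>H. f (H n)) \<longleftrightarrow> integrable channel_law f"
    unfolding channels_law_def using assms(1) by (intro PiM_component_integral(1)) auto
  show "(\<integral>H. f (H n) \<partial>channels_law N) = (\<integral>h. f h \<partial>channel_law)"
    unfolding channels_law_def using assms(1) by (intro PiM_component_integral(2)) auto
qed

lemma measure_channels_all:
  fixes D :: "(complex ^ 'm::finite ^ 'k::finite) set"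
  assumes [measurable]: "D \<in> sets borel"
  shows "measure (channels_law N) {H \<in> space (channels_law N). \<forall>n<N. H n \<in> D} = measure channel_law D ^ N"
proof -
  interpret product_prob_space "\<lambda>_. channel_law :: (complex ^ 'm ^ 'k) measure" "{..<N}"
    by (intro product_prob_spaceI prob_space_channel_law)
  have "{H \<in> space (channels_law N). \<forall>n<N. H n \<in> D} = Pi\<^sub>E {..<N} (\<lambda>_. D)"
    by (auto simp: channels_law_def space_PiM PiE_def Pi_def)
  moreover have "emeasure (PiM {..<N} (\<lambda>_. channel_law)) (Pi\<^sub>E {..<N} (\<lambda>_. D)) = (\<Prod>n\<in>{..<N}. emeasure channel_law D)"
    by (intro emeasure_PiM) auto
  ultimately show ?thesis
    
    by (intro measure_eq_emeasure_eq_ennreal) (simp_all add: channels_law_def M.emeasure_eq_measure ennreal_power)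
qed

text \<open>The Gaussian density leaves the exponent -(1 - \<theta>) times the squared norm, which
  decays since \<theta> < 1.\<close>

lemma channel_exp_moment:
  fixes \<theta> :: real
  assumes "\<theta> < 1"
  shows "integrable channel_law (\<lambda>h :: complex ^ 'm::finite ^ 'k::finite. exp (\<theta> * (norm h)\<^sup>2))"
proof -
  have "integrable lborel (\<lambda>h :: complex ^ 'm ^ 'k. exp (- (1 - \<theta>) * (norm h)\<^sup>2) / sqrt pi ^ DIM(complex ^ 'm ^ 'k))"
    using assms by (intro integrable_divide integral_exp_norm_sq(1)) auto
  also have "(\<lambda>h :: complex ^ 'm ^ 'k. exp (- (1 - \<theta>) * (norm h)\<^sup>2) / sqrt pi ^ DIM(complex ^ 'm ^ 'k))
      = (\<lambda>h. gauss 1 h * exp (\<theta> * (norm h)\<^sup>2))"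
    by (rule ext) (simp add: gauss_def exp_add[symmetric] algebra_simps)
  finally show ?thesis
    unfolding channel_law_eq by (subst integrable_density) (auto simp: gauss_pos less_imp_le)
qed

lemma channel_norm_sq_integrable:
  "integrable channel_law (\<lambda>h :: complex ^ 'm::finite ^ 'k::finite. (norm h)\<^sup>2)"
  unfolding channel_law_eq by (rule integrable_gauss_law)

text \<open>A Chernoff bound: an excess x - t is at most exp (\<theta> (x - t)) / \<theta>.
  Excesses, unlike a maximum over users, have expectations that simply add up.\<close>

lemma channel_excess:
  fixes \<theta> t :: real
  assumes \<theta>: "0 < \<theta>" "\<theta> < 1"
  shows "integrable channel_law (\<lambda>h :: complex ^ 'm::finite ^ 'k::finite. max 0 ((norm h)\<^sup>2 - t))"
    and "(\<integral>h. max 0 ((norm (h :: complex ^ 'm ^ 'k))\<^sup>2 - t) \<partial>channel_law)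
      \<le> exp (- \<theta> * t) / \<theta> * (\<integral>h. exp (\<theta> * (norm (h :: complex ^ 'm ^ 'k))\<^sup>2) \<partial>channel_law)"
proof -
  have le: "max 0 (x - t) \<le> exp (- \<theta> * t) / \<theta> * exp (\<theta> * x)" for x
  proof -
    have "\<theta> * (x - t) \<le> exp (\<theta> * (x - t))"
      using exp_ge_add_one_self[of "\<theta> * (x - t)"] by linarith
    then have "x - t \<le> exp (\<theta> * (x - t)) / \<theta>" using \<theta> by (simp add: field_simps)
    also have "\<dots> = exp (- \<theta> * t) / \<theta> * exp (\<theta> * x)"
      by (simp add: exp_add[symmetric] algebra_simps)
    finally show ?thesis using \<theta> by auto
  qed
  have int: "integrable channel_law (\<lambda>h :: complex ^ 'm ^ 'k. exp (- \<theta> * t) / \<theta> * exp (\<theta> * (norm h)\<^sup>2))"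
    using \<theta> by (intro integrable_mult_right channel_exp_moment)
  show 1: "integrable channel_law (\<lambda>h :: complex ^ 'm ^ 'k. max 0 ((norm h)\<^sup>2 - t))"
    by (rule Bochner_Integration.integrable_bound[OF int]) (use le \<theta> in \<open>auto intro!: AE_I2\<close>)
  have "(\<integral>h. max 0 ((norm (h :: complex ^ 'm ^ 'k))\<^sup>2 - t) \<partial>channel_law)
      \<le> (\<integral>h. exp (- \<theta> * t) / \<theta> * exp (\<theta> * (norm (h :: complex ^ 'm ^ 'k))\<^sup>2) \<partial>channel_law)"
    by (rule integral_mono[OF 1 int]) (rule le)
  then show "(\<integral>h. max 0 ((norm (h :: complex ^ 'm ^ 'k))\<^sup>2 - t) \<partial>channel_law)
      \<le> exp (- \<theta> * t) / \<theta> * (\<integral>h. exp (\<theta> * (norm (h :: complex ^ 'm ^ 'k))\<^sup>2) \<partial>channel_law)"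
    by simp
qed

lemma norm_beam: "norm (beam l j :: complex ^ 'm::finite ^ 'k::finite) \<le> 1"
proof -
  have "(\<Sum>i\<in>UNIV. \<Sum>i'\<in>UNIV. cmod ((beam l j :: complex ^ 'm ^ 'k) $ i $ i'))
    = (\<Sum>i\<in>UNIV. if i = l then (\<Sum>i'\<in>UNIV. if i' = j then 1 else 0) else 0)"
    by (intro sum.cong refl) (auto simp: beam_def if_distrib[of cmod] cong: if_cong)
  then show ?thesis using norm_le_sum_entries[of "beam l j :: complex ^ 'm ^ 'k"] by simp
qed

text \<open>A point of this unit ball has norm at most a + 1, which bounds the density from below; V
  is the volume of the ball divided by the normalising constant, independent of a, l and j.\<close>

lemma channel_near_beam:
  obtains V :: real where "V > 0"
    and "\<And>a l j. a \<ge> 0 \<Longrightarrow> V * exp (- (a + 1)\<^sup>2)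
      \<le> measure channel_law (cball (a *\<^sub>R beam l j) 1 :: (complex ^ 'm::finite ^ 'k::finite) set)"
proof
  let ?D = "sqrt pi ^ DIM(complex ^ 'm ^ 'k)"
  define b where "b = measure lborel (cball 0 1 :: (complex ^ 'm ^ 'k) set)"
  have b: "b > 0"
    unfolding b_def using content_cball_pos[of 1 "0 :: complex ^ 'm ^ 'k"] by simp
  show "b / ?D > 0" using b by simp
  fix a :: real and l :: 'k and j :: 'm assume a: "a \<ge> 0"
  define B :: "(complex ^ 'm ^ 'k) set" where "B = cball (a *\<^sub>R beam l j) 1"
  interpret prob_space "channel_law :: (complex ^ 'm ^ 'k) measure" by (rule prob_space_channel_law)
  have [measurable]: "B \<in> sets borel" by (simp add: B_def)
  have fin: "emeasure lborel B = ennreal b"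
    unfolding B_def b_def by (simp add: emeasure_cball content_cball)
  have "ennreal (b / ?D * exp (- (a + 1)\<^sup>2)) = (\<integral>\<^sup>+h. ennreal (exp (- (a + 1)\<^sup>2) / ?D) * indicator B h \<partial>lborel)"
    using b by (subst nn_integral_cmult_indicator) (simp_all add: fin ennreal_mult''[symmetric] mult.commute)
  also have "\<dots> \<le> (\<integral>\<^sup>+h. ennreal (gauss 1 h) * indicator B h \<partial>lborel)"
  proof (rule nn_integral_mono)
    fix h :: "complex ^ 'm ^ 'k"
    show "ennreal (exp (- (a + 1)\<^sup>2) / ?D) * indicator B h \<le> ennreal (gauss 1 h) * indicator B h"
    proof (cases "h \<in> B")
      case True
      have "norm h \<le> norm (a *\<^sub>R (beam l j :: complex ^ 'm ^ 'k)) + 1"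
        using True norm_triangle_ineq4[of "a *\<^sub>R beam l j" "a *\<^sub>R beam l j - h"] by (simp add: B_def dist_norm)
      also have "\<dots> \<le> a + 1" using norm_beam[of l j] a by (simp add: mult_left_le)
      finally have "(norm h)\<^sup>2 \<le> (a + 1)\<^sup>2" by (intro power_mono) auto
      then show ?thesis using True by (simp add: gauss_def divide_right_mono ennreal_leI)
    qed simp
  qed
  also have "\<dots> = emeasure channel_law B"
    by (simp add: channel_law_eq emeasure_density)
  finally show "b / ?D * exp (- (a + 1)\<^sup>2) \<le> prob (cball (a *\<^sub>R beam l j) 1)"
    unfolding B_def[symmetric] emeasure_eq_measure by (simp add: ennreal_le_iff)
qed

text \<open>Lies between 0 and \<open>rate_cap\<close>. It excludes the default value 0 of the
  integral in \<open>R_opt\<close>, so pointwise lower bounds pass to the mean.\<close>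

lemma integrable_opt_sum_rate:
  assumes P: "0 \<le> P" and N: "0 < N"
  shows "integrable (channels_law N) (opt_sum_rate P N :: (nat \<Rightarrow> complex ^ 'm::finite ^ 'k::finite) \<Rightarrow> real)"
proof (rule Bochner_Integration.integrable_bound)
  interpret prob_space "channels_law N :: (nat \<Rightarrow> complex ^ 'm ^ 'k) measure" by (rule prob_space_channels_law)
  show "integrable (channels_law N) (rate_cap P N :: (nat \<Rightarrow> complex ^ 'm ^ 'k) \<Rightarrow> real)"
  proof -
    have "integrable (channels_law N) (\<lambda>H :: nat \<Rightarrow> complex ^ 'm ^ 'k. (norm (H n))\<^sup>2)" if "n < N" for n
      by (subst integral_channel(1)[OF that]) (simp_all add: channel_norm_sq_integrable)
    then show ?thesis
      unfolding rate_cap_def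
      by (intro Bochner_Integration.integrable_add integrable_mult_right Bochner_Integration.integrable_sum) simp_all
  qed
  show "opt_sum_rate P N \<in> borel_measurable (channels_law N :: (nat \<Rightarrow> complex ^ 'm ^ 'k) measure)"
    using borel_measurable_opt_sum_rate[OF P N, where 'm='m and 'k='k]
    by (simp cong: measurable_cong_sets add: sets_channels_law)
  have "norm (opt_sum_rate P N H) \<le> norm (rate_cap P N H)" for H :: "nat \<Rightarrow> complex ^ 'm ^ 'k"
    using opt_sum_rate_nonneg[OF P N, of H] opt_sum_rate_le[OF P N, of H] by simp
  then show "AE H in channels_law N. norm (opt_sum_rate P N (H :: nat \<Rightarrow> complex ^ 'm ^ 'k)) \<le> norm (rate_cap P N H)"
    by (intro AE_I2)
qed

text \<open>The first factor is a union bound over the M beams: if q is the probability that one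
  user is near a given beam, all N users miss it with probability (1 - q)^N \<le> exp (- N q). On
  the failure event only nonnegativity of the rate is used; the premise on \<epsilon> makes the
  second factor nonnegative.\<close>

lemma R_opt_ge:
  fixes P \<epsilon> :: real
  assumes P: "P > 0" and \<epsilon>: "\<epsilon> > 0"
  shows "\<exists>V>0. \<exists>a0>0. \<forall>a\<ge>a0. \<forall>N>0. CARD('m) * ln (P / CARD('m) * a\<^sup>2) \<ge> \<epsilon> \<longrightarrow>
    (1 - CARD('m) * exp (- (real N * (V * exp (- (a + 1)\<^sup>2))))) * (CARD('m) * ln (P / CARD('m) * a\<^sup>2) - \<epsilon>)
      \<le> R_opt TYPE('m::finite) TYPE('k::finite) P N"
proof -
  define l :: 'k where "l = undefined"
  obtain a0 where a0: "a0 > 0" and opt: "\<And>a N (H :: nat \<Rightarrow> complex ^ 'm ^ 'k). a \<ge> a0 \<Longrightarrow>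
    \<forall>j. \<exists>n<N. norm (H n - a *\<^sub>R beam l j) \<le> 1 \<Longrightarrow> CARD('m) * ln (P / CARD('m) * a\<^sup>2) - \<epsilon> \<le> opt_sum_rate P N H"
    using opt_sum_rate_ge[OF P \<epsilon>, of l, where 'm='m] by blast
  obtain V :: real where V: "V > 0" "\<And>a l j. a \<ge> 0 \<Longrightarrow> V * exp (- (a + 1)\<^sup>2)
      \<le> measure channel_law (cball (a *\<^sub>R beam l j) 1 :: (complex ^ 'm ^ 'k) set)"
    by (rule channel_near_beam[where 'm='m and 'k='k]) blast
  have main: "(1 - CARD('m) * exp (- (real N * (V * exp (- (a + 1)\<^sup>2))))) * u \<le> R_opt TYPE('m) TYPE('k) P N"
    if a: "a \<ge> a0" and N: "N > 0" and u: "u = CARD('m) * ln (P / CARD('m) * a\<^sup>2) - \<epsilon>" "u \<ge> 0" for a N u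
  proof -
    let ?L = "channels_law N :: (nat \<Rightarrow> complex ^ 'm ^ 'k) measure"
    interpret C: prob_space "channel_law :: (complex ^ 'm ^ 'k) measure" by (rule prob_space_channel_law)
    interpret prob_space ?L by (rule prob_space_channels_law)
    define B :: "'m \<Rightarrow> (complex ^ 'm ^ 'k) set" where "B j = cball (a *\<^sub>R beam l j) 1" for j
    have [measurable]: "B j \<in> sets borel" for j by (simp add: B_def)
    define G where "G = {H \<in> space ?L. \<forall>j. \<exists>n<N. H n \<in> B j}"
    define F where "F j = {H \<in> space ?L. \<forall>n<N. H n \<in> - B j}" for j
    have F_sets [measurable]: "F j \<in> sets ?L" for j
      unfolding F_def by measurable
    have G_sets [measurable]: "G \<in> sets ?L"
      unfolding G_def by measurable
    have "prob (F j) \<le> exp (- (real N * (V * exp (- (a + 1)\<^sup>2))))" for j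
    proof -
      have "prob (F j) = C.prob (- B j) ^ N"
        unfolding F_def by (rule measure_channels_all) simp
      also have "C.prob (- B j) = 1 - C.prob (B j)"
        using C.prob_compl[of "B j"] by (simp add: Compl_eq_Diff_UNIV)
      also have "\<dots> ^ N \<le> exp (- (V * exp (- (a + 1)\<^sup>2))) ^ N"
      proof (rule power_mono)
        have "1 - C.prob (B j) \<le> 1 + - (V * exp (- (a + 1)\<^sup>2))"
          using V(2)[of a l j] a a0 by (simp add: B_def)
        also have "\<dots> \<le> exp (- (V * exp (- (a + 1)\<^sup>2)))" by (rule exp_ge_add_one_self)
        finally show "1 - C.prob (B j) \<le> exp (- (V * exp (- (a + 1)\<^sup>2)))" .
      qed simp
      finally show ?thesis by (simp add: exp_of_nat_mult[symmetric])
    qed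
    then have "(\<Sum>j\<in>UNIV. prob (F j)) \<le> CARD('m) * exp (- (real N * (V * exp (- (a + 1)\<^sup>2))))"
      by (intro sum_bounded_above[where A = UNIV, simplified])
    moreover have "prob (space ?L - G) \<le> (\<Sum>j\<in>UNIV. prob (F j))"
    proof -
      have "space ?L - G = (\<Union>j\<in>UNIV. F j)" by (auto simp: G_def F_def)
      moreover have "prob (\<Union>j\<in>UNIV. F j) \<le> (\<Sum>j\<in>UNIV. prob (F j))"
        by (rule finite_measure_subadditive_finite) auto
      ultimately show ?thesis by simp
    qed
    ultimately have G: "1 - CARD('m) * exp (- (real N * (V * exp (- (a + 1)\<^sup>2)))) \<le> prob G"
      using prob_compl[of G] by simp
    have "(1 - CARD('m) * exp (- (real N * (V * exp (- (a + 1)\<^sup>2))))) * u \<le> prob G * u"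
      using G u(2) by (rule mult_right_mono)
    also have "\<dots> = (\<integral>H. u * indicator G H \<partial>?L)" by simp
    also have "\<dots> \<le> (\<integral>H. opt_sum_rate P N H \<partial>?L)"
    proof (rule integral_mono)
      show "integrable ?L (opt_sum_rate P N)"
        using P N by (intro integrable_opt_sum_rate) auto
      show "u * indicator G H \<le> opt_sum_rate P N H" for H
        using opt[OF a, of N H] opt_sum_rate_nonneg[of P N H] P N
        by (auto simp: indicator_def G_def B_def u(1) dist_norm norm_minus_commute)
      show "integrable ?L (\<lambda>H. u * indicator G H)"
        by (intro integrable_mult_right integrable_real_indicator) (simp_all add: emeasure_eq_measure)
    qed
    finally show ?thesis by (simp add: R_opt_def)
  qed
  have bound: "\<forall>a\<ge>a0. \<forall>N>0. CARD('m) * ln (P / CARD('m) * a\<^sup>2) \<ge> \<epsilon> \<longrightarrow>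
    (1 - CARD('m) * exp (- (real N * (V * exp (- (a + 1)\<^sup>2))))) * (CARD('m) * ln (P / CARD('m) * a\<^sup>2) - \<epsilon>)
      \<le> R_opt TYPE('m) TYPE('k) P N"
  proof (intro allI impI)
    fix a N assume a: "a0 \<le> a" "0 < (N::nat)" and \<epsilon>: "\<epsilon> \<le> CARD('m) * ln (P / CARD('m) * a\<^sup>2)"
    from \<epsilon> have "0 \<le> CARD('m) * ln (P / CARD('m) * a\<^sup>2) - \<epsilon>" by (rule diff_ge_0_iff_ge[THEN iffD2])
    with a show "(1 - CARD('m) * exp (- (real N * (V * exp (- (a + 1)\<^sup>2))))) * (CARD('m) * ln (P / CARD('m) * a\<^sup>2) - \<epsilon>)
        \<le> R_opt TYPE('m) TYPE('k) P N"
      using main[of a N "CARD('m) * ln (P / CARD('m) * a\<^sup>2) - \<epsilon>"] by blast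
  qed
  show ?thesis
    by (rule exI[of _ V], rule conjI[OF V(1)], rule exI[of _ a0], rule conjI[OF a0], rule bound)
qed

section \<open>The average sum-rate of a strategy\<close>

definition silent :: "('m::finite, 'k::finite, 'f, 'w, 'o) strategy \<Rightarrow> (complex ^ 'm ^ 'k) set" where
  "silent S = {h. user_rule S h = None}"

lemma silent_sets:
  assumes "user_selection_strategy P N S"
  shows "silent S \<in> sets borel"
proof -
  have "silent S = - {h. user_rule S h \<noteq> None}" by (auto simp: silent_def)
  moreover have "- {h. user_rule S h \<noteq> None} \<in> sets borel"
    using assms by (intro borel_comp) (simp only: user_selection_strategy_def)
  ultimately show ?thesis by (simp only:)
qed

lemma expected_senders_eq:
  fixes S :: "('m::finite, 'k::finite, 'f, 'w, 'o) strategy"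
  assumes S: "user_selection_strategy P N S"
  shows "expected_senders S N = real N * (1 - measure channel_law (silent S))"
proof -
  interpret C: prob_space "channel_law :: (complex ^ 'm ^ 'k) measure" by (rule prob_space_channel_law)
  note [measurable] = silent_sets[OF S]
  let ?f = "indicator (- silent S) :: complex ^ 'm ^ 'k \<Rightarrow> real"
  have f_int: "integrable channel_law ?f"
    by (intro integrable_real_indicator) (simp_all add: C.emeasure_eq_measure)
  have "num_senders S N H = (\<Sum>k<N. ?f (H k))" for H
  proof -
    have "{k. k < N \<and> feedback S N H k \<noteq> None} = {k \<in> {..<N}. H k \<in> - silent S}"
      by (auto simp: feedback_def silent_def)
    then have "num_senders S N H = card ({..<N} \<inter> {k. H k \<in> - silent S})"
      by (simp only: num_senders_def Int_def mem_Collect_eq)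
    also have "real \<dots> = (\<Sum>k<N. ?f (H k))"
      by (simp add: indicator_def sum.If_cases)
    finally show ?thesis .
  qed
  then have "expected_senders S N = (\<integral>H. (\<Sum>k<N. ?f (H k)) \<partial>channels_law N)"
    by (simp add: expected_senders_def)
  also have "\<dots> = (\<Sum>k<N. \<integral>H. ?f (H k) \<partial>channels_law N)"
    using f_int by (intro Bochner_Integration.integral_sum integral_channel(1)[THEN iffD2]) auto
  also have "\<dots> = (\<Sum>k<N. \<integral>h. ?f h \<partial>channel_law)"
    by (intro sum.cong refl integral_channel(2)) auto
  also have "(\<integral>h. ?f h \<partial>channel_law) = 1 - measure channel_law (silent S)"
    using C.prob_compl[of "silent S"] by (simp add: Compl_eq_Diff_UNIV)
  finally show ?thesis by simp
qed

text \<open>Without feedback the served users' channels are identically distributed, so each of them may be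
  replaced by one and the same channel \<open>h\<close>, for which the total rate is bounded.\<close>
lemma silent_rate_le:
  fixes S :: "('m::finite, 'k::finite, 'f, 'w, 'o) strategy"
  assumes S: "user_selection_strategy P N S" and P: "P > 0" and N: "N > 0"
  defines "\<alpha> \<equiv> measure channel_law (silent S)"
    and "C0 \<equiv> P * (1 + (\<integral>h. (norm (h :: complex ^ 'm ^ 'k))\<^sup>2 \<partial>channel_law))"
  shows "(\<integral>\<^sup>+H. ennreal (sum_rate S N H) * indicator {H. \<forall>n<N. H n \<in> silent S} H \<partial>channels_law N)
    \<le> ennreal (C0 * \<alpha> ^ (N - 1))"
proof (cases "silent S = {}")
  case True
  then have "{H :: nat \<Rightarrow> complex ^ 'm ^ 'k. \<forall>n<N. H n \<in> silent S} = {}" using N by auto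
  then show ?thesis by simp
next
  case False
  \<comment> \<open>Serves below to freeze the channels of the other users. If no channel is silent,
    the event is empty because N > 0.\<close>
  then obtain h0 where h0: "h0 \<in> silent S" by blast
  let ?m = "real CARD('m)"
  let ?C = "channel_law :: (complex ^ 'm ^ 'k) measure"
  interpret C: prob_space ?C by (rule prob_space_channel_law)
  interpret PC: product_prob_space "\<lambda>_. ?C" "{..<N}"
    by (intro product_prob_spaceI prob_space_channel_law)
  define A where "A = silent S"
  have [measurable]: "A \<in> sets borel" unfolding A_def by (rule silent_sets[OF S])
  \<comment> \<open>With everyone silent, the served set and the signal no longer depend on the
    channels.\<close>
  define a where "a = bs_rule S (\<lambda>_. None)"
  have valid: "valid_transmission P N a"
    using S by (simp add: user_selection_strategy_def a_def)
  note aD = valid_transmissionD[OF valid]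
  have rate: "sum_rate S N H = (\<Sum>k\<in>served a. user_rate a k (H k))" if "\<forall>n<N. H n \<in> A" for H
  proof -
    have "feedback S N H = (\<lambda>_. None)"
      using that by (auto simp: feedback_def A_def silent_def)
    then show ?thesis by (simp add: sum_rate_def a_def Let_def)
  qed
  define g where "g k h = user_rate a k h * indicator A h" for k h
  have g_nonneg: "0 \<le> g k h" if "k \<in> served a" for k h
    using user_rate_nonneg[OF valid that, of h] by (simp add: g_def indicator_def)
  \<comment> \<open>A strategy guarantees measurability of the total rate only. That of one user's
    rate on \<open>A\<close> is recovered by varying the channel of user k, keeping the other
    channels at \<open>h0\<close>, and subtracting the resulting constant.\<close>
  have g_meas [measurable]: "g k \<in> borel_measurable borel" if k: "k \<in> served a" for k
  proof -
    define \<phi> where "\<phi> h = (\<lambda>n\<in>{..<N}. if n = k then h else h0)" for h :: "complex ^ 'm ^ 'k"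
    have \<phi>: "\<phi> \<in> borel \<rightarrow>\<^sub>M (channels_law N :: (nat \<Rightarrow> complex ^ 'm ^ 'k) measure)"
    proof -
      have "\<phi> \<in> borel \<rightarrow>\<^sub>M PiM {..<N} (\<lambda>_. borel)"
        unfolding \<phi>_def[abs_def] by measurable
      then show ?thesis by (simp cong: measurable_cong_sets add: sets_channels_law)
    qed
    have "sum_rate S N \<in> borel_measurable (channels_law N)"
      using S by (simp add: user_selection_strategy_def)
    then have [measurable]: "(\<lambda>h. sum_rate S N (\<phi> h)) \<in> borel_measurable borel"
      using measurable_compose[OF \<phi>] by blast
    define r where "r = (\<Sum>j\<in>served a - {k}. user_rate a j h0)"
    have "g k h = (sum_rate S N (\<phi> h) - r) * indicator A h" for h
    proof (cases "h \<in> A")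
      case True
      then have "sum_rate S N (\<phi> h) = (\<Sum>j\<in>served a. user_rate a j (\<phi> h j))"
        using h0 by (intro rate) (auto simp: \<phi>_def A_def)
      also have "\<dots> = user_rate a k (\<phi> h k) + (\<Sum>j\<in>served a - {k}. user_rate a j (\<phi> h j))"
        using k aD(8) by (intro sum.remove) auto
      also have "(\<Sum>j\<in>served a - {k}. user_rate a j (\<phi> h j)) = r"
        unfolding r_def using aD(1) by (intro sum.cong refl) (auto simp: \<phi>_def)
      also have "\<phi> h k = h" using k aD(1) by (auto simp: \<phi>_def)
      finally show ?thesis using True by (simp add: g_def)
    qed (simp add: g_def)
    then show ?thesis by (subst measurable_cong) (auto intro!: borel_measurable_times)
  qed
  \<comment> \<open>All served users now have the same channel h. The 1 in \<rho>^2 = 1 + |h|^2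
    provides strictness, and ln (1 + x) \<le> x makes the bound integrable.\<close>
  have sum_g: "(\<Sum>k\<in>served a. g k h) \<le> P * (1 + (norm h)\<^sup>2)" for h :: "complex ^ 'm ^ 'k"
  proof -
    have "(\<Sum>k\<in>served a. g k h) \<le> (\<Sum>k\<in>served a. user_rate a k h)"
      using user_rate_nonneg[OF valid, where h = h] by (intro sum_mono) (auto simp: g_def indicator_def)
    also have "\<dots> \<le> ?m * ln (1 + (sqrt (1 + (norm h)\<^sup>2))\<^sup>2 * P / ?m)"
      by (rule sum_user_rate_le[OF valid P]) (auto simp: add_pos_nonneg intro!: real_less_rsqrt)
    also have "\<dots> = ?m * ln (1 + (1 + (norm h)\<^sup>2) * P / ?m)" by simp
    also have "\<dots> \<le> ?m * ((1 + (norm h)\<^sup>2) * P / ?m)"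
      using P by (intro mult_left_mono ln_add_one_self_le_self) auto
    finally show ?thesis by (simp add: mult.commute)
  qed
  \<comment> \<open>Each summand is a product over independent channels. The indicator for user k is
    already inside \<open>g\<close>, so the other users contribute the power N - 1.\<close>
  have "ennreal (sum_rate S N H) * indicator {H. \<forall>n<N. H n \<in> silent S} H
      = (\<Sum>k\<in>served a. \<Prod>n<N. ennreal (if n = k then g k (H n) else indicator A (H n)))" for H :: "nat \<Rightarrow> complex ^ 'm ^ 'k"
  proof -
    have prod: "(\<Prod>n<N. ennreal (if n = k then g k (H n) else indicator A (H n)))
      = ennreal (user_rate a k (H k)) * indicator {H. \<forall>n<N. H n \<in> silent S} H" if k: "k \<in> served a" for k
    proof (cases "\<forall>n<N. H n \<in> A")
      case True
      then have "(\<Prod>n<N. ennreal (if n = k then g k (H n) else indicator A (H n))) = (\<Prod>n<N. if n = k then ennreal (user_rate a k (H k)) else 1)"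
        by (intro prod.cong refl) (auto simp: g_def)
      then show ?thesis using True k aD(1) by (auto simp: A_def prod.delta subset_iff)
    next
      case False
      then obtain n where n: "n < N" "H n \<notin> A" by blast
      then have "(\<Prod>n<N. ennreal (if n = k then g k (H n) else indicator A (H n))) = 0"
        by (intro prod_zero bexI[of _ n]) (auto simp: g_def)
      then show ?thesis using False by (simp add: A_def)
    qed
    show ?thesis
    proof (cases "\<forall>n<N. H n \<in> A")
      case True
      then show ?thesis
        using user_rate_nonneg[OF valid, where 'k='k] by (simp add: prod rate sum_ennreal A_def)
    next
      case False
      then show ?thesis by (simp add: prod A_def)
    qed
  qed
  then have "(\<integral>\<^sup>+H. ennreal (sum_rate S N H) * indicator {H. \<forall>n<N. H n \<in> silent S} H \<partial>channels_law N)
    = (\<integral>\<^sup>+H. (\<Sum>k\<in>served a. \<Prod>n<N. ennreal (if n = k then g k (H n) else indicator A (H n))) \<partial>channels_law N)"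
    by simp
  also have "\<dots> = (\<Sum>k\<in>served a. \<integral>\<^sup>+H. (\<Prod>n<N. ennreal (if n = k then g k (H n) else indicator A (H n))) \<partial>channels_law N)"
    unfolding channels_law_def by (intro nn_integral_sum) measurable
  also have "\<dots> = (\<Sum>k\<in>served a. (\<integral>\<^sup>+h. g k h \<partial>?C) * ennreal (\<alpha> ^ (N - 1)))"
  proof (rule sum.cong[OF refl])
    fix k assume k [measurable]: "k \<in> served a"
    have kN: "k < N" using k aD(1) by auto
    have "(\<integral>\<^sup>+H. (\<Prod>n<N. ennreal (if n = k then g k (H n) else indicator A (H n))) \<partial>channels_law N)
      = (\<Prod>n<N. \<integral>\<^sup>+h. ennreal (if n = k then g k h else indicator A h) \<partial>?C)"
      unfolding channels_law_def by (intro PC.product_nn_integral_prod) auto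
    also have "\<dots> = (\<integral>\<^sup>+h. g k h \<partial>?C) * (\<Prod>n\<in>{..<N} - {k}. \<integral>\<^sup>+h. ennreal (if n = k then g k h else indicator A h) \<partial>?C)"
      using kN by (subst prod.remove[of _ k]) auto
    also have "(\<Prod>n\<in>{..<N} - {k}. \<integral>\<^sup>+h. ennreal (if n = k then g k h else indicator A h) \<partial>?C) = (\<Prod>n\<in>{..<N} - {k}. ennreal \<alpha>)"
      by (intro prod.cong refl)
        (auto simp: ennreal_indicator C.emeasure_eq_measure \<alpha>_def A_def[symmetric] nn_integral_indicator)
    also have "\<dots> = ennreal (\<alpha> ^ (N - 1))"
      using kN by (simp add: ennreal_power \<alpha>_def)
    finally show "(\<integral>\<^sup>+H. (\<Prod>n<N. ennreal (if n = k then g k (H n) else indicator A (H n))) \<partial>channels_law N)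
      = (\<integral>\<^sup>+h. g k h \<partial>?C) * ennreal (\<alpha> ^ (N - 1))" .
  qed
  also have "\<dots> = (\<integral>\<^sup>+h. (\<Sum>k\<in>served a. ennreal (g k h)) \<partial>?C) * ennreal (\<alpha> ^ (N - 1))"
    by (subst nn_integral_sum) (auto simp: sum_distrib_right)
  also have "(\<integral>\<^sup>+h. (\<Sum>k\<in>served a. ennreal (g k h)) \<partial>?C) \<le> (\<integral>\<^sup>+h. ennreal (P * (1 + (norm h)\<^sup>2)) \<partial>?C)"
    using sum_g g_nonneg by (intro nn_integral_mono) (simp add: sum_ennreal ennreal_leI)
  also have "(\<integral>\<^sup>+h. ennreal (P * (1 + (norm h)\<^sup>2)) \<partial>?C) = ennreal C0"
  proof -
    have "(\<integral>\<^sup>+h. ennreal (P * (1 + (norm h)\<^sup>2)) \<partial>?C) = ennreal (\<integral>h. P * (1 + (norm h)\<^sup>2) \<partial>?C)"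
      using P by (intro nn_integral_eq_integral integrable_mult_right Bochner_Integration.integrable_add
          channel_norm_sq_integrable) auto
    also have "(\<integral>h. P * (1 + (norm h)\<^sup>2) \<partial>?C) = C0"
      using channel_norm_sq_integrable[where 'm='m and 'k='k] C.prob_space by (simp add: C0_def)
    finally show ?thesis .
  qed
  finally show ?thesis
    by (simp add: mult_right_mono ennreal_mult'' \<alpha>_def)
qed

text \<open>The three terms are the rate under complete silence, the rate cap at squared norm 1 + t
  on the complementary event, and the price of channels whose squared norm exceeds t. The level t
  and the moment parameter \<theta> remain free for the asymptotics.\<close>

lemma avg_sum_rate_le:
  fixes S :: "('m::finite, 'k::finite, 'f, 'w, 'o) strategy" and \<theta> t :: real
  assumes S: "user_selection_strategy P N S" and P: "P > 0" and N: "N > 0"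
    and \<theta>: "0 < \<theta>" "\<theta> < 1" and t: "t > 0"
  defines "\<alpha> \<equiv> measure channel_law (silent S)"
    and "C0 \<equiv> P * (1 + (\<integral>h. (norm (h :: complex ^ 'm ^ 'k))\<^sup>2 \<partial>channel_law))"
    and "C1 \<equiv> (\<integral>h. exp (\<theta> * (norm (h :: complex ^ 'm ^ 'k))\<^sup>2) \<partial>channel_law)"
  shows "avg_sum_rate S N \<le> C0 * \<alpha> ^ (N - 1)
    + (1 - \<alpha> ^ N) * (CARD('m) * ln (1 + (1 + t) * P / CARD('m)))
    + CARD('m) / t * (real N * (exp (- \<theta> * t) / \<theta> * C1))"
proof -
  let ?m = "real CARD('m)"
  let ?L = "channels_law N :: (nat \<Rightarrow> complex ^ 'm ^ 'k) measure"
  interpret C: prob_space "channel_law :: (complex ^ 'm ^ 'k) measure" by (rule prob_space_channel_law)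
  interpret prob_space ?L by (rule prob_space_channels_law)
  have m: "?m > 0" by simp
  note [measurable] = silent_sets[OF S]
  define E where "E = {H \<in> space ?L. \<forall>n<N. H n \<in> silent S}"
  have [measurable]: "E \<in> sets ?L" unfolding E_def by measurable
  have prob_E: "prob E = \<alpha> ^ N"
    unfolding E_def \<alpha>_def by (rule measure_channels_all) simp
  \<comment> \<open>The sum of all excesses replaces the excess of the largest norm: it dominates
    each of them and has an explicit mean.\<close>
  define X where "X H = (\<Sum>k<N. max 0 ((norm (H k))\<^sup>2 - t))" for H :: "nat \<Rightarrow> complex ^ 'm ^ 'k"
  define u where "u = ?m * ln (1 + (1 + t) * P / ?m)"
  have u: "u \<ge> 0" using t P by (auto simp: u_def intro!: mult_nonneg_nonneg ln_ge_zero)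
  have X_nonneg: "X H \<ge> 0" for H by (simp add: X_def sum_nonneg)
  have X_int: "integrable ?L X" and X_le: "(\<integral>H. X H \<partial>?L) \<le> real N * (exp (- \<theta> * t) / \<theta> * C1)"
  proof -
    have 1: "integrable ?L (\<lambda>H. max 0 ((norm (H k))\<^sup>2 - t))" if "k < N" for k
      using that by (subst integral_channel(1)) (auto intro: channel_excess[OF \<theta>])
    show "integrable ?L X" unfolding X_def using 1 by (intro Bochner_Integration.integrable_sum) auto
    have "(\<integral>H. X H \<partial>?L) = (\<Sum>k<N. \<integral>H. max 0 ((norm (H k))\<^sup>2 - t) \<partial>?L)"
      unfolding X_def using 1 by (intro Bochner_Integration.integral_sum) auto
    also have "\<dots> = (\<Sum>k<N. \<integral>h. max 0 ((norm (h :: complex ^ 'm ^ 'k))\<^sup>2 - t) \<partial>channel_law)"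
      by (intro sum.cong refl integral_channel(2)) auto
    also have "\<dots> \<le> (\<Sum>k<N. exp (- \<theta> * t) / \<theta> * C1)"
      unfolding C1_def by (intro sum_mono channel_excess[OF \<theta>])
    finally show "(\<integral>H. X H \<partial>?L) \<le> real N * (exp (- \<theta> * t) / \<theta> * C1)" by simp
  qed
  have meas [measurable]: "sum_rate S N \<in> borel_measurable ?L"
    using S by (simp add: user_selection_strategy_def)
  have [measurable]: "X \<in> borel_measurable ?L" using X_int by auto
  have rate_le: "sum_rate S N H \<le> u + ?m / t * X H" and rate_nonneg: "0 \<le> sum_rate S N H" for H
  proof -
    define a where "a = bs_rule S (feedback S N H)"
    have a: "valid_transmission P N a" using S by (simp add: user_selection_strategy_def a_def)
    have rate: "sum_rate S N H = (\<Sum>k\<in>served a. user_rate a k (H k))"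
      by (simp add: sum_rate_def a_def Let_def)
    show "0 \<le> sum_rate S N H"
      unfolding rate by (intro sum_nonneg user_rate_nonneg[OF a])
    \<comment> \<open>The summand 1 makes \<rho> strictly larger than every channel norm, as the
      degradation kernel requires.\<close>
    define \<rho> where "\<rho> = sqrt (1 + t + X H)"
    have \<rho>2: "\<rho>\<^sup>2 = 1 + t + X H" using t X_nonneg[of H] by (simp add: \<rho>_def)
    have pos: "0 < 1 + t + X H" using t X_nonneg[of H] by linarith
    have "sum_rate S N H \<le> ?m * ln (1 + \<rho>\<^sup>2 * P / ?m)"
      unfolding rate
    proof (rule sum_user_rate_le[OF a P])
      show "0 < \<rho>" using pos by (simp add: \<rho>_def)
      fix k assume "k \<in> served a"
      then have "k < N" using valid_transmissionD(1)[OF a] by auto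
      then have "max 0 ((norm (H k))\<^sup>2 - t) \<le> X H"
        unfolding X_def by (intro member_le_sum) auto
      then have "(norm (H k))\<^sup>2 < 1 + t + X H" by linarith
      then show "norm (H k) < \<rho>" unfolding \<rho>_def by (rule real_less_rsqrt)
    qed
    also have "ln (1 + \<rho>\<^sup>2 * P / ?m) \<le> ln (1 + (1 + t) * P / ?m) + X H / t"
    proof -
      \<comment> \<open>Tangent of the logarithm at v; since v \<ge> t P / M, the excess enters with
        a slope that amounts to at most 1/t.\<close>
      define v where "v = 1 + (1 + t) * P / ?m"
      have v: "t * P / ?m \<le> v" "0 < t * P / ?m" using P t m by (auto simp: v_def field_simps)
      have v0: "v > 0" using v by linarith
      have XP: "0 \<le> X H * P / ?m" using X_nonneg[of H] P by simp
      have "1 + \<rho>\<^sup>2 * P / ?m = v + X H * P / ?m"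
        unfolding \<rho>2 v_def by (simp add: algebra_simps add_divide_distrib)
      then have "ln (1 + \<rho>\<^sup>2 * P / ?m) \<le> ln v + (v + X H * P / ?m) / v - 1"
        using ln_le_ln_add[of "v + X H * P / ?m" v] v0 XP by simp
      also have "\<dots> = ln v + (X H * P / ?m) / v" using v0 by (simp add: add_divide_distrib)
      also have "(X H * P / ?m) / v \<le> (X H * P / ?m) / (t * P / ?m)"
        using v v0 XP by (intro divide_left_mono mult_pos_pos) auto
      also have "\<dots> = X H / t" using P m by simp
      finally show ?thesis by (simp add: v_def)
    qed
    finally show "sum_rate S N H \<le> u + ?m / t * X H"
      using m by (simp add: u_def distrib_left)
  qed
  have "(\<integral>\<^sup>+H. ennreal (sum_rate S N H) \<partial>?L)
    \<le> (\<integral>\<^sup>+H. ennreal (sum_rate S N H) * indicator {H. \<forall>n<N. H n \<in> silent S} H + ennreal (u * indicator (space ?L - E) H + ?m / t * X H) \<partial>?L)"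
  \<comment> \<open>On \<open>E\<close> the rate itself is kept, to be bounded by
    \<open>silent_rate_le\<close>; the nonnegative excess term is charged everywhere.\<close>
  proof (rule nn_integral_mono)
    fix H assume H: "H \<in> space ?L"
    show "ennreal (sum_rate S N H) \<le> ennreal (sum_rate S N H) * indicator {H. \<forall>n<N. H n \<in> silent S} H + ennreal (u * indicator (space ?L - E) H + ?m / t * X H)"
      using H rate_le[of H] by (cases "H \<in> E") (auto simp: E_def indicator_def intro: ennreal_leI)
  qed
  also have "\<dots> = (\<integral>\<^sup>+H. ennreal (sum_rate S N H) * indicator {H. \<forall>n<N. H n \<in> silent S} H \<partial>?L)
      + (\<integral>\<^sup>+H. ennreal (u * indicator (space ?L - E) H + ?m / t * X H) \<partial>?L)"
  proof (rule nn_integral_add)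
    have "(\<lambda>H. ennreal (sum_rate S N H) * indicator E H) \<in> borel_measurable ?L" by measurable
    then show "(\<lambda>H. ennreal (sum_rate S N H) * indicator {H. \<forall>n<N. H n \<in> silent S} H) \<in> borel_measurable ?L"
      by (rule measurable_cong[THEN iffD1, rotated]) (auto simp: E_def indicator_def)
  qed measurable
  also have "\<dots> \<le> ennreal (C0 * \<alpha> ^ (N - 1)) + ennreal ((1 - \<alpha> ^ N) * u + ?m / t * (\<integral>H. X H \<partial>?L))"
  proof (rule add_mono)
    show "(\<integral>\<^sup>+H. ennreal (sum_rate S N H) * indicator {H. \<forall>n<N. H n \<in> silent S} H \<partial>?L) \<le> ennreal (C0 * \<alpha> ^ (N - 1))"
      unfolding C0_def \<alpha>_def by (rule silent_rate_le[OF S P N])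
    have 1: "integrable ?L (\<lambda>H. u * indicator (space ?L - E) H)"
      by (intro integrable_mult_right integrable_real_indicator) (simp_all add: emeasure_eq_measure)
    have "(\<integral>\<^sup>+H. ennreal (u * indicator (space ?L - E) H + ?m / t * X H) \<partial>?L)
      = ennreal (\<integral>H. u * indicator (space ?L - E) H + ?m / t * X H \<partial>?L)"
      using u t X_nonneg
      by (intro nn_integral_eq_integral Bochner_Integration.integrable_add 1 integrable_mult_right X_int) auto
    also have "(\<integral>H. u * indicator (space ?L - E) H + ?m / t * X H \<partial>?L) = (1 - \<alpha> ^ N) * u + ?m / t * (\<integral>H. X H \<partial>?L)"
      using prob_compl[of E] prob_E
      by (subst Bochner_Integration.integral_add[OF 1 integrable_mult_right[OF X_int]]) (simp_all add: mult.commute)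
    finally show "(\<integral>\<^sup>+H. ennreal (u * indicator (space ?L - E) H + ?m / t * X H) \<partial>?L) \<le> ennreal ((1 - \<alpha> ^ N) * u + ?m / t * (\<integral>H. X H \<partial>?L))"
      by simp
  qed
  also have "\<dots> = ennreal (C0 * \<alpha> ^ (N - 1) + ((1 - \<alpha> ^ N) * u + ?m / t * (\<integral>H. X H \<partial>?L)))"
  proof (rule ennreal_plus[symmetric])
    show "0 \<le> C0 * \<alpha> ^ (N - 1)" using P by (simp add: C0_def \<alpha>_def)
    show "0 \<le> (1 - \<alpha> ^ N) * u + ?m / t * (\<integral>H. X H \<partial>?L)"
      using u t X_nonneg C.prob_le_1 by (intro add_nonneg_nonneg mult_nonneg_nonneg) (auto simp: \<alpha>_def power_le_one)
  qed
  finally have le: "(\<integral>\<^sup>+H. ennreal (sum_rate S N H) \<partial>?L) \<le> ennreal (C0 * \<alpha> ^ (N - 1) + ((1 - \<alpha> ^ N) * u + ?m / t * (\<integral>H. X H \<partial>?L)))" .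
  have nonneg: "0 \<le> C0 * \<alpha> ^ (N - 1) + ((1 - \<alpha> ^ N) * u + ?m / t * (\<integral>H. X H \<partial>?L))"
    using u t X_nonneg P C.prob_le_1
    by (intro add_nonneg_nonneg mult_nonneg_nonneg) (auto simp: C0_def \<alpha>_def power_le_one)
  have "avg_sum_rate S N = enn2real (\<integral>\<^sup>+H. ennreal (sum_rate S N H) \<partial>?L)"
    unfolding avg_sum_rate_def by (rule integral_eq_nn_integral) (use rate_nonneg in auto)
  also have "\<dots> \<le> C0 * \<alpha> ^ (N - 1) + ((1 - \<alpha> ^ N) * u + ?m / t * (\<integral>H. X H \<partial>?L))"
    using le nonneg by (rule enn2real_leI[rotated])
  also have "?m / t * (\<integral>H. X H \<partial>?L) \<le> ?m / t * (real N * (exp (- \<theta> * t) / \<theta> * C1))"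
    using t by (intro mult_left_mono X_le) auto
  finally show ?thesis by (simp add: u_def)
qed

section \<open>Asymptotics\<close>

text \<open>With a^2 = \<beta> ln N the chance of being near a beam is at least of order
  N^(-\<beta>) exp (- 2 a), so N times it exceeds ln N eventually and the failure probability is at
  most M/N. The loss \<epsilon> is spent in quarters: on the near-beam error, on \<beta>, and on the
  failure event.\<close>

lemma R_opt_asymptotic:
  fixes P \<epsilon> :: real
  assumes P: "P > 0" and \<epsilon>: "\<epsilon> > 0"
  shows "eventually (\<lambda>N. CARD('m) * ln (P / CARD('m) * ln (real N)) - \<epsilon> \<le> R_opt TYPE('m::finite) TYPE('k::finite) P N) sequentially"
proof -
  let ?m = "real CARD('m)"
  have m: "?m > 0" by simp
  \<comment> \<open>Makes M ln (1/\<beta>) equal to \<epsilon> / 4.\<close>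
  define \<beta> where "\<beta> = exp (- (\<epsilon> / (4 * ?m)))"
  have \<beta>: "0 < \<beta>" "\<beta> < 1" using \<epsilon> m by (auto simp: \<beta>_def)
  define c where "c = P / ?m"
  have c: "c > 0" using P m by (simp add: c_def)
  obtain V a0 where V: "V > 0" and a0: "a0 > 0" and ge: "\<And>a N. a \<ge> a0 \<Longrightarrow> N > 0 \<Longrightarrow> ?m * ln (c * a\<^sup>2) \<ge> \<epsilon> / 4 \<Longrightarrow>
    (1 - ?m * exp (- (real N * (V * exp (- (a + 1)\<^sup>2))))) * (?m * ln (c * a\<^sup>2) - \<epsilon> / 4) \<le> R_opt TYPE('m) TYPE('k) P N"
    unfolding c_def using R_opt_ge[OF P, of "\<epsilon> / 4", where 'm='m and 'k='k] \<epsilon> by auto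
  define a where "a N = sqrt (\<beta> * ln (real N))" for N :: nat
  have 1: "eventually (\<lambda>N. a N \<ge> a0) sequentially"
    unfolding a_def using \<beta> by real_asymp
  have 2: "eventually (\<lambda>N. ?m * ln (c * (\<beta> * ln (real N))) \<ge> \<epsilon> / 4) sequentially"
    using \<beta> c m by real_asymp
  define \<gamma> where "\<gamma> = 1 - \<beta>"
  have \<gamma>: "0 < \<gamma>" using \<beta> by (simp add: \<gamma>_def)
  \<comment> \<open>With x = ln N the exponent is ln N - (a + 1)^2; its linear part, with
    coefficient \<gamma> = 1 - \<beta>, beats the square root.\<close>
  have "eventually (\<lambda>x. x \<le> V * exp (\<gamma> * x - 2 * sqrt (\<beta> * x) - 1)) at_top"
    using \<beta>(1) \<gamma> V by real_asymp
  moreover have "filterlim (\<lambda>N. ln (real N)) at_top sequentially" by real_asymp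
  ultimately have "eventually (\<lambda>N. ln (real N) \<le> V * exp (\<gamma> * ln (real N) - 2 * sqrt (\<beta> * ln (real N)) - 1)) sequentially"
    by (rule eventually_compose_filterlim)
  then have 3: "eventually (\<lambda>N. real N * (V * exp (- (sqrt (\<beta> * ln (real N)) + 1)\<^sup>2)) \<ge> ln (real N)) sequentially"
    using eventually_ge_at_top[of 1]
  proof eventually_elim
    fix N :: nat
    assume le: "ln (real N) \<le> V * exp (\<gamma> * ln (real N) - 2 * sqrt (\<beta> * ln (real N)) - 1)" and N: "1 \<le> N"
    have "(sqrt (\<beta> * ln (real N)))\<^sup>2 = \<beta> * ln (real N)" using \<beta> N by simp
    then have "\<gamma> * ln (real N) - 2 * sqrt (\<beta> * ln (real N)) - 1 = ln (real N) + - (sqrt (\<beta> * ln (real N)) + 1)\<^sup>2"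
      by (simp add: \<gamma>_def power2_sum algebra_simps)
    then have "exp (\<gamma> * ln (real N) - 2 * sqrt (\<beta> * ln (real N)) - 1) = real N * exp (- (sqrt (\<beta> * ln (real N)) + 1)\<^sup>2)"
      using N by (simp only: exp_add) simp
    then show "real N * (V * exp (- (sqrt (\<beta> * ln (real N)) + 1)\<^sup>2)) \<ge> ln (real N)"
      using le by (simp add: mult.left_commute)
  qed
  \<comment> \<open>The failure probability of order 1/N outweighs a rate of order ln ln N.\<close>
  have 4: "eventually (\<lambda>N. ?m * exp (- ln (real N)) * (?m * ln (c * (\<beta> * ln (real N))) - \<epsilon> / 4) \<le> \<epsilon> / 4) sequentially"
    using \<beta> c m \<epsilon> by real_asymp
  have "eventually (\<lambda>N. ln (real N) > 0) sequentially" by real_asymp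
  with 1 2 3 4 eventually_gt_at_top[of 0] show ?thesis
  proof eventually_elim
    fix N :: nat
    assume a: "a N \<ge> a0" and big: "?m * ln (c * (\<beta> * ln (real N))) \<ge> \<epsilon> / 4"
      and e: "real N * (V * exp (- (sqrt (\<beta> * ln (real N)) + 1)\<^sup>2)) \<ge> ln (real N)"
      and small: "?m * exp (- ln (real N)) * (?m * ln (c * (\<beta> * ln (real N))) - \<epsilon> / 4) \<le> \<epsilon> / 4"
      and N: "N > 0" and L: "ln (real N) > 0"
    have a2: "(a N)\<^sup>2 = \<beta> * ln (real N)" using \<beta> L by (simp add: a_def)
    define u where "u = ?m * ln (c * (a N)\<^sup>2) - \<epsilon> / 4"
    define \<delta> where "\<delta> = ?m * exp (- (real N * (V * exp (- (a N + 1)\<^sup>2))))"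
    have u: "u \<ge> 0" using big by (simp add: u_def a2)
    have "\<delta> \<le> ?m * exp (- ln (real N))"
      unfolding \<delta>_def using e by (intro mult_left_mono) (auto simp: a_def)
    then have "\<delta> * u \<le> ?m * exp (- ln (real N)) * u" using u by (rule mult_right_mono)
    also have "\<dots> \<le> \<epsilon> / 4" using small by (simp add: u_def a2)
    finally have "(1 - \<delta>) * u \<ge> u - \<epsilon> / 4" by (simp add: algebra_simps)
    moreover have "(1 - \<delta>) * u \<le> R_opt TYPE('m) TYPE('k) P N"
      unfolding \<delta>_def u_def by (rule ge[OF a N]) (use big in \<open>simp add: a2\<close>)
    moreover have "?m * ln (c * (a N)\<^sup>2) = ?m * ln (c * ln (real N)) - \<epsilon> / 4"
    proof -
      have "c * (a N)\<^sup>2 = \<beta> * (c * ln (real N))" by (simp add: a2)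
      then have "ln (c * (a N)\<^sup>2) = ln \<beta> + ln (c * ln (real N))"
        using \<beta> c L by (simp add: ln_mult)
      moreover have "?m * ln \<beta> = - (\<epsilon> / 4)" using m by (simp add: \<beta>_def)
      ultimately show ?thesis by (simp add: distrib_left)
    qed
    ultimately show "?m * ln (P / ?m * ln (real N)) - \<epsilon> \<le> R_opt TYPE('m) TYPE('k) P N"
      using \<epsilon> by (simp add: u_def c_def)
  qed
qed

theorem theorem2:
  fixes P :: real
    and S :: "nat \<Rightarrow> ('m::finite, 'k::finite, 'f, 'w, 'o) strategy"
  assumes "P > 0"
    and "CARD('m) \<ge> 2"
    and "CARD('k) \<le> CARD('m)"
    and "\<And>N. N \<ge> 1 \<Longrightarrow> user_selection_strategy P N (S N)"
    and "(\<lambda>N. R_opt TYPE('m) TYPE('k) P N - avg_sum_rate (S N) N) \<longlonglongrightarrow> 0"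
  shows "filterlim (\<lambda>N. expected_senders (S N) N - ln (ln (ln (real N)))) at_top sequentially"
  unfolding filterlim_at_top
proof
  fix Z :: real
  let ?m = "real CARD('m)"
  have m: "?m \<ge> 1" using assms(2) by simp
  \<comment> \<open>Were the claim false for Z, the probability of silence would be at least exp (-
    Z - 1) / ln ln N, and with U \<ge> ln ln N / 2 its product with U would be at least 4 \<eta>.
    Half of this survives the rate earned in silence, and 3 \<epsilon> = \<eta> is lost to the
    approximations, so the gap in rate would still be at least \<eta>.\<close>
  define \<eta> where "\<eta> = exp (- Z - 1) / 8"
  have \<eta>: "\<eta> > 0" by (simp add: \<eta>_def)
  define \<epsilon> where "\<epsilon> = \<eta> / 3"
  have \<epsilon>: "\<epsilon> > 0" using \<eta> by (simp add: \<epsilon>_def)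
  \<comment> \<open>The level t = ln N / \<theta> makes exp (- \<theta> t) = 1/N, which cancels the
    number of users in the excess term. This \<theta> makes M ln (1/\<theta>) equal to \<epsilon> /
    2.\<close>
  define \<theta> where "\<theta> = exp (- (\<epsilon> / (2 * ?m)))"
  have \<theta>: "0 < \<theta>" "\<theta> < 1" using \<epsilon> m by (auto simp: \<theta>_def)
  define c where "c = P / ?m"
  have c: "c > 0" using assms(1) m by (simp add: c_def)
  define C0 where "C0 = P * (1 + (\<integral>h. (norm (h :: complex ^ 'm ^ 'k))\<^sup>2 \<partial>channel_law))"
  define C1 where "C1 = (\<integral>h. exp (\<theta> * (norm (h :: complex ^ 'm ^ 'k))\<^sup>2) \<partial>channel_law)"
  have C0: "C0 > 0" using assms(1) by (auto simp: C0_def intro!: mult_pos_pos add_pos_nonneg)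
  let ?U = "\<lambda>N. ?m * ln (c * ln (real N))"
  let ?l3 = "\<lambda>N. ln (ln (ln (real N)))"
  \<comment> \<open>The limit is the price of the raised level, \<epsilon> / (2 M) per dimension;
    being strictly below \<epsilon> / M, it leaves room for convergence.\<close>
  have "((\<lambda>N. ln (1 + (1 + ln (real N) / \<theta>) * c) - ln (c * ln (real N))) \<longlongrightarrow> ln (inverse \<theta> * c) - ln c) sequentially"
    using \<theta> c by real_asymp
  moreover have "ln (inverse \<theta> * c) - ln c < \<epsilon> / ?m"
  proof -
    have "ln (inverse \<theta> * c) - ln c = \<epsilon> / (2 * ?m)"
      using \<theta> c by (simp only: ln_mult ln_inverse inverse_positive_iff_positive) (simp add: \<theta>_def)
    then show ?thesis using \<epsilon> m by (simp add: field_simps)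
  qed
  ultimately have "eventually (\<lambda>N. ln (1 + (1 + ln (real N) / \<theta>) * c) - ln (c * ln (real N)) < \<epsilon> / ?m) sequentially"
    by (rule order_tendstoD)
  then have 1: "eventually (\<lambda>N. ?m * ln (1 + (1 + ln (real N) / \<theta>) * c) \<le> ?U N + \<epsilon>) sequentially"
    by eventually_elim (use m in \<open>simp add: field_simps\<close>)
  have "((\<lambda>N. ?m * C1 / ln (real N)) \<longlongrightarrow> 0) sequentially" by real_asymp
  then have 2: "eventually (\<lambda>N. ?m * C1 / ln (real N) < \<epsilon>) sequentially"
    using \<epsilon> by (rule order_tendstoD)
  have 3: "eventually (\<lambda>N. ln (real N) > 0 \<and> ln (ln (real N)) > 0 \<and> ?l3 N + Z \<ge> 0) sequentially"
    by (intro eventually_conj; real_asymp)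
  \<comment> \<open>With p at most w/N, where w = ln ln ln N + Z, facts 4 and 5 give p \<le> 1/2 and
    bound the quadratic term N * 2 p^2 by 1.\<close>
  have 4: "eventually (\<lambda>N. (?l3 N + Z) / real N \<le> 1 / 2) sequentially" by real_asymp
  have 5: "eventually (\<lambda>N. 2 * (?l3 N + Z)\<^sup>2 / real N \<le> 1) sequentially" by real_asymp
  \<comment> \<open>Together with \<alpha> \<ge> 1/2 this gives C0 \<le> \<alpha> U / 2: the rate
    earned in silence recovers at most half of the loss.\<close>
  have 6: "eventually (\<lambda>N. ?U N \<ge> 4 * C0) sequentially" using c m by real_asymp
  \<comment> \<open>The constant c may be below 1; half of ln ln N absorbs its logarithm.\<close>
  have "eventually (\<lambda>N. ln (c * ln (real N)) \<ge> ln (ln (real N)) / 2) sequentially"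
    using c by real_asymp
  then have 7: "eventually (\<lambda>N. ?U N \<ge> ln (ln (real N)) / 2) sequentially"
    using 3
  proof eventually_elim
    fix N :: nat
    assume "ln (c * ln (real N)) \<ge> ln (ln (real N)) / 2" "ln (real N) > 0 \<and> ln (ln (real N)) > 0 \<and> ?l3 N + Z \<ge> 0"
    then show "?U N \<ge> ln (ln (real N)) / 2"
      using mult_right_mono[OF m, of "ln (c * ln (real N))"] by linarith
  qed
  have 8: "eventually (\<lambda>N. R_opt TYPE('m) TYPE('k) P N - avg_sum_rate (S N) N < \<eta>) sequentially"
    using assms(5) \<eta> by (rule order_tendstoD)
  have 9: "eventually (\<lambda>N. ?U N - \<epsilon> \<le> R_opt TYPE('m) TYPE('k) P N) sequentially"
    unfolding c_def by (rule R_opt_asymptotic[OF assms(1) \<epsilon>])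
  show "eventually (\<lambda>N. Z \<le> expected_senders (S N) N - ?l3 N) sequentially"
    using 1 2 3 4 5 6 7 8 9 eventually_ge_at_top[of 1]
  proof eventually_elim
    fix N :: nat
    assume 1: "?m * ln (1 + (1 + ln (real N) / \<theta>) * c) \<le> ?U N + \<epsilon>"
      and 2: "?m * C1 / ln (real N) < \<epsilon>"
      and 3: "ln (real N) > 0 \<and> ln (ln (real N)) > 0 \<and> ?l3 N + Z \<ge> 0"
      and 4: "(?l3 N + Z) / real N \<le> 1 / 2" and 5: "2 * (?l3 N + Z)\<^sup>2 / real N \<le> 1"
      and 6: "?U N \<ge> 4 * C0" and 7: "?U N \<ge> ln (ln (real N)) / 2"
      and 8: "R_opt TYPE('m) TYPE('k) P N - avg_sum_rate (S N) N < \<eta>"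
      and 9: "?U N - \<epsilon> \<le> R_opt TYPE('m) TYPE('k) P N" and N: "1 \<le> N"
    note S = assms(4)[OF N]
    interpret C: prob_space "channel_law :: (complex ^ 'm ^ 'k) measure" by (rule prob_space_channel_law)
    define U where "U = ?U N"
    define w where "w = ?l3 N + Z"
    define \<alpha> where "\<alpha> = C.prob (silent (S N))"
    define p where "p = 1 - \<alpha>"
    show "Z \<le> expected_senders (S N) N - ?l3 N"
    proof (rule ccontr)
      assume "\<not> Z \<le> expected_senders (S N) N - ?l3 N"
      then have Np: "real N * p < w"
        using expected_senders_eq[OF S] by (simp add: p_def \<alpha>_def w_def)
      have p0: "0 \<le> p" by (simp add: p_def \<alpha>_def)
      have pw: "p \<le> w / real N" using Np N by (simp add: field_simps)
      from pw 4[folded w_def] have p2: "p \<le> 1 / 2" by (rule order_trans)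
      then have \<alpha>: "1 / 2 \<le> \<alpha>" "\<alpha> \<le> 1" using p0 by (auto simp: p_def)
      \<comment> \<open>Prepares the lower bound ln (1 - p) \<ge> - p - 2 p^2, whose quadratic part
        accounts for the extra 1 in exp (- w - 1).\<close>
      have "real N * (2 * p\<^sup>2) \<le> real N * (2 * (w / real N)\<^sup>2)"
        using pw p0 by (intro mult_left_mono power_mono) auto
      also have "\<dots> = 2 * w\<^sup>2 / real N" using N by (simp add: power2_eq_square)
      also have "\<dots> \<le> 1" by (rule 5[folded w_def])
      finally have "- w - 1 \<le> real N * (- p - 2 * p\<^sup>2)" using Np by (simp add: algebra_simps)
      also have "\<dots> \<le> real N * ln (1 - p)"
        using ln_one_minus_pos_lower_bound[OF p0 p2] by (intro mult_left_mono) auto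
      also have "\<dots> = ln (\<alpha> ^ N)" using \<alpha> by (simp add: p_def ln_realpow)
      finally have "exp (- w - 1) \<le> \<alpha> ^ N" using \<alpha> by (simp add: ln_ge_iff)
      moreover have "exp (- w - 1) = 8 * \<eta> / ln (ln (real N))"
      proof -
        have "exp (- w - 1) = exp (- Z - 1) * exp (- ?l3 N)"
          by (simp add: w_def exp_add[symmetric])
        also have "exp (- ?l3 N) = 1 / ln (ln (real N))"
          using 3 by (simp add: exp_minus inverse_eq_divide)
        finally show ?thesis by (simp add: \<eta>_def)
      qed
      ultimately have \<alpha>N: "8 * \<eta> / ln (ln (real N)) \<le> \<alpha> ^ N" by simp
      have U: "U \<ge> 4 * C0" "U \<ge> ln (ln (real N)) / 2" "U > 0" using 6 7 C0 by (auto simp: U_def)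
      have "4 * \<eta> = 8 * \<eta> / ln (ln (real N)) * (ln (ln (real N)) / 2)" using 3 by auto
      also have "\<dots> \<le> \<alpha> ^ N * U"
        using \<alpha>N U 3 \<alpha> by (intro mult_mono) auto
      finally have gain: "4 * \<eta> \<le> \<alpha> ^ N * U" .
      have "C0 * \<alpha> ^ (N - 1) \<le> \<alpha> ^ N * U / 2"
      proof -
        \<comment> \<open>One factor \<alpha> is spent to raise the exponent N - 1 to N.\<close>
        have "C0 \<le> \<alpha> * U / 2" using U \<alpha> mult_mono[of "1/2" \<alpha> "4 * C0" U] C0 by simp
        then have "C0 * \<alpha> ^ (N - 1) \<le> \<alpha> * U / 2 * \<alpha> ^ (N - 1)" using \<alpha> by (intro mult_right_mono) auto
        also have "\<dots> = (\<alpha> * \<alpha> ^ (N - 1)) * U / 2" by simp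
        also have "\<alpha> * \<alpha> ^ (N - 1) = \<alpha> ^ N" using N by (simp add: power_eq_if)
        finally show ?thesis .
      qed
      moreover have "avg_sum_rate (S N) N \<le> C0 * \<alpha> ^ (N - 1) + (1 - \<alpha> ^ N) * (U + \<epsilon>) + \<epsilon>"
      proof -
        let ?t = "ln (real N) / \<theta>"
        have "avg_sum_rate (S N) N \<le> C0 * \<alpha> ^ (N - 1)
          + (1 - \<alpha> ^ N) * (?m * ln (1 + (1 + ?t) * P / ?m))
          + ?m / ?t * (real N * (exp (- \<theta> * ?t) / \<theta> * C1))"
          unfolding C0_def C1_def \<alpha>_def using 3 \<theta> N by (intro avg_sum_rate_le[OF S assms(1)]) auto
        also have "?m / ?t * (real N * (exp (- \<theta> * ?t) / \<theta> * C1)) = ?m * C1 / ln (real N)"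
          using 3 \<theta> N by (simp add: exp_minus field_simps)
        also have "\<dots> \<le> \<epsilon>" using 2 by simp
        also have "(1 - \<alpha> ^ N) * (?m * ln (1 + (1 + ?t) * P / ?m)) \<le> (1 - \<alpha> ^ N) * (U + \<epsilon>)"
          using 1 \<alpha> by (intro mult_left_mono) (auto simp: U_def c_def power_le_one)
        finally show ?thesis by simp
      qed
      moreover have "U - \<epsilon> \<le> R_opt TYPE('m) TYPE('k) P N" using 9 by (simp add: U_def)
      moreover have "0 \<le> \<alpha> ^ N * \<epsilon>" using \<alpha> \<epsilon> by simp
      \<comment> \<open>Of the three \<epsilon>, one comes from the lower bound on
        \<open>R_opt\<close>, one from the raised level and one from the excess term.\<close>
      ultimately have "R_opt TYPE('m) TYPE('k) P N - avg_sum_rate (S N) N \<ge> \<alpha> ^ N * U / 2 - 3 * \<epsilon>"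
        by (simp add: algebra_simps)
      then show False using gain 8 by (simp add: \<epsilon>_def)
    qed
  qed
qed

end
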